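(* Let $p\in[1,\infty)$, let $P,P'\in\mathcal{P}$ be measure topological networks, and let $(\pi^v,\pi^e)$ be a pair of optimal couplings for $d_{\mathrm{TpOT},p}(P,P')$. For $t\in[0,1]$ let $P_t$ be the interpolating topological network built from $(\pi^v,\pi^e)$. Then the path $\gamma:[0,1]\to\mathcal{P}/{\sim_w}$ defined by $\gamma_t=[P_t]$ is a geodesic between $[P]$ and $[P']$ with respect to $d_{\mathrm{TpOT},p}$.
   Context: Diagonal conventions. Let $\Lambda=\{(a,b)\in\mathbb{R}^2: b>a>0\}$ and $\overline{\Lambda}=\Lambda\sqcup\{\partial_\Lambda\}$ (disjoint union topology), where $\partial_\Lambda$ is a virtual point representing the diagonal. For $\lambda=(a,b)$ put $\mathrm{Proj}(\lambda)=((a+b)/2,(a+b)/2)$. For $\lambda,\lambda'\in\Lambda$, $\|\lambda-\lambda'\|_p$ is the $\ell^p$ norm on $\mathbb{R}^2$; $\|\lambda-\partial_\Lambda\|_p=\|\partial_\Lambda-\lambda\|_p:=\|\lambda-\mathrm{Proj}(\lambda)\|_p$ and $\|\partial_\Lambda-\partial_\Lambda\|_p:=0$. Measure persistence diagram: a Radon measure $\sigma$ on $\Lambda$ with $\int_\Lambda\|\lambda-\mathrm{Proj}(\lambda)\|_q^q\,d\sigma(\lambda)<\infty$ for every $q\ge 1$. Measure topological network (topological network): a triple $P=((X,k,\mu),(Y,\iota,\nu),\omega)$ where $X$ is a Polish space with a fully supported Borel probability measure $\mu$; $k:X\times X\to\mathbb{R}$ is symmetric, measurable and bounded; $Y$ is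 a locally compact Polish space with a fully supported Radon measure $\nu$; $\iota:Y\to\Lambda$ is continuous and $\iota_\#\nu$ is a measure persistence diagram; $\omega:X\times Y\to\mathbb{R}$ is non-negative, measurable and bounded. $\mathcal{P}$ is the class of all of these. Let $\overline{Y}=Y\sqcup\{\partial_Y\}$ (disjoint union topology, $\partial_Y$ an abstract point), and extend $\omega$ and $\iota$ by $\omega(x,\partial_Y)=0$ and $\iota(\partial_Y)=\partial_\Lambda$. Couplings: $\Pi(\mu,\mu')$ is the set of Borel probability measures on $X\times X'$ with marginals $\mu,\mu'$. $\Pi_{\mathrm{adm}}(\nu,\nu')$ is the set of Radon measures $\pi$ on $\overline{Y}\times\overline{Y'}$ that have marginals $\nu$ and $\nu'$, meaning $\pi(A\times\overline{Y'})=\nu(A)$ and $\pi(\overline{Y}\times B)=\nu'(B)$ for all Borel $A\subset Y$, $B\subset Y'$, and that satisfy $\pi(\{(\partial_Y,\partial_{Y'})\})=0$. Distance: for $P=((X,k,\mu),(Y,\iota,\nu),\omega)$ and $P'=((X',k',\mu'),(Y',\iota',\nu'),\omega')$, $$d_{\mathrm{TpOT},p}(P,P')=\inf_{\pi^v\in\Pi(\mu,\mu'),\ \pi^e\in\Pi_{\mathrm{adm}}(\nu,\nu')}\Big(\int_{\overline{Y}\times\overline{Y'}}\|\iota(y)-\iota'(y')\|_p^p\,d\pi^e(y,y')+\int_{(X\times X')^2}|k(x_1,x_2)-k'(x_1',x_2')|^p\,d\pi^v(x_1,x_1')\,d\pi^v(x_2,x_2')+\int_{X\times X'\times\overline{Y}\times\overline{Y'}}|\omega(x,y)-\omega'(x',y')|^p\,d\pi^v(x,x')\,d\pi^e(y,y')\Big)^{1/p}.$$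 A pair $(\pi^v,\pi^e)$ attaining the infimum is called a pair of optimal couplings. Weak isomorphism from $P$ to $P'$: a pair of measure-preserving maps $\phi:X\to X'$, $\psi:Y\to Y'$ with $\iota(y)=\iota'(\psi(y))$ for $\nu$-a.e. $y$, $\omega(x,y)=\omega'(\phi(x),\psi(y))$ for $\mu\otimes\nu$-a.e. $(x,y)$, and $k(x_1,x_2)=k'(\phi(x_1),\phi(x_2))$ for $\mu\otimes\mu$-a.e. $(x_1,x_2)$. Write $P\sim_w P'$ if there is a measure topological network $Q$ with weak isomorphisms from $Q$ to $P$ and from $Q$ to $P'$; $[P]$ denotes the $\sim_w$-class of $P$. The function $d_{\mathrm{TpOT},p}$ induces a metric on $\mathcal{P}/{\sim_w}$, denoted by the same symbol. Interpolation: given $P,P'$ and a pair of optimal couplings $(\pi^v,\pi^e)$, for $t\in[0,1]$ one constructs the topological network $P_t=((\tilde X,k_t,\pi^v),(\tilde Y,\iota_t,\pi^e),\omega_t)$ with $\tilde X=X\times X'$, $\tilde Y=(Y\times Y')\cup(Y\times\{\partial_{Y'}\})\cup(\{\partial_Y\}\times Y')$, $\omega_t((x,x'),(y,y'))=(1-t)\omega(x,y)+t\omega'(x',y')$, $k_t((x_1,x_1'),(x_2,x_2'))=(1-t)k(x_1,x_2)+tk'(x_1',x_2')$, $\iota_t(y,y')=(1-t)\iota(y)+t\iota'(y')$. Here $(1-t)\lambda+t\,\partial_\Lambda$ means $(1-t)\lambda+t\,\mathrm{Proj}(\lambda)$ and $(1-t)\partial_\Lambda+t\lambda$ means $(1-t)\mathrm{Proj}(\lambda)+t\lambda$,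 points of the diagonal being represented by $\partial_\Lambda$. Geodesic: in a metric space $(Z,d)$, a geodesic between $z$ and $z'$ is a path $\gamma:[0,1]\to Z$ with $\gamma(0)=z$, $\gamma(1)=z'$ and $d(\gamma(s),\gamma(t))=(t-s)\,d(z,z')$ for all $0\le s\le t\le 1$.
   Formalization: The distance between P and P' is assumed finite (bounded ω and infinite ν can make it infinite, and the claim then fails); P_t is restricted to the supports of the couplings, and points sent to the diagonal at t = 0, 1 are dropped, so that P_t is a topological network. *)

theory Defs
  imports "HOL-Probability.Probability"
begin

section \<open>Measures on topological spaces\<close>

definition borel_of :: "'a topology \<Rightarrow> 'a measure" where
  "borel_of T = sigma (topspace T) {U. openin T U}"

definition polish_topology :: "'a topology \<Rightarrow> bool" where
  "polish_topology T \<longleftrightarrow> completely_metrizable_space T \<and> separable_space T"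

definition borel_measure_on :: "'a topology \<Rightarrow> 'a measure \<Rightarrow> bool" where
  "borel_measure_on T M \<longleftrightarrow> sets M = sets (borel_of T)"

text \<open>Radon: locally finite and inner regular with respect to compact sets.\<close>

definition radon_measure_on :: "'a topology \<Rightarrow> 'a measure \<Rightarrow> bool" where
  "radon_measure_on T M \<longleftrightarrow>
     borel_measure_on T M \<and>
     (\<forall>x\<in>topspace T. \<exists>U. openin T U \<and> x \<in> U \<and> emeasure M U < \<infinity>) \<and>
     (\<forall>A\<in>sets M. emeasure M A = (SUP K\<in>{K. compactin T K \<and> K \<subseteq> A}. emeasure M K))"

definition fully_supported :: "'a topology \<Rightarrow> 'a measure \<Rightarrow> bool" where
  "fully_supported T M \<longleftrightarrow> (\<forall>U. openin T U \<and> U \<noteq> {} \<longrightarrow> emeasure M U > 0)"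

definition measure_support :: "'a topology \<Rightarrow> 'a measure \<Rightarrow> 'a set" where
  "measure_support T M =
     {x \<in> topspace T. \<forall>U. openin T U \<and> x \<in> U \<longrightarrow> emeasure M U > 0}"

definition measure_preserving :: "'a measure \<Rightarrow> 'b measure \<Rightarrow> ('a \<Rightarrow> 'b) \<Rightarrow> bool" where
  "measure_preserving M N f \<longleftrightarrow> f \<in> measurable M N \<and> distr M N f = N"

text \<open>The disjoint union of a space with one isolated point, the latter being \<^term>\<open>None\<close>.\<close>

definition add_point :: "'a topology \<Rightarrow> 'a option topology" where
  "add_point T = topology (\<lambda>U. U \<subseteq> insert None (Some ` topspace T) \<and> openin T {x. Some x \<in> U})"

lemma openin_add_point:
  "openin (add_point T) U \<longleftrightarrow>
     U \<subseteq> insert None (Some ` topspace T) \<and> openin T {x. Some x \<in> U}"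
proof -
  have "istopology (\<lambda>U. U \<subseteq> insert None (Some ` topspace T) \<and> openin T {x. Some x \<in> U})"
    unfolding istopology_def
  proof (intro conjI allI impI)
    fix S S' :: "'a option set"
    assume "S \<subseteq> insert None (Some ` topspace T) \<and> openin T {x. Some x \<in> S}"
      and "S' \<subseteq> insert None (Some ` topspace T) \<and> openin T {x. Some x \<in> S'}"
    moreover have "{x. Some x \<in> S \<inter> S'} = {x. Some x \<in> S} \<inter> {x. Some x \<in> S'}" by auto
    ultimately show "S \<inter> S' \<subseteq> insert None (Some ` topspace T)"
      and "openin T {x. Some x \<in> S \<inter> S'}" by auto
  next
    fix \<K> :: "'a option set set"
    assume *: "\<forall>K\<in>\<K>. K \<subseteq> insert None (Some ` topspace T) \<and> openin T {x. Some x \<in> K}"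
    then show "\<Union>\<K> \<subseteq> insert None (Some ` topspace T)" by blast
    have "{x. Some x \<in> \<Union>\<K>} = (\<Union>K\<in>\<K>. {x. Some x \<in> K})" by auto
    then show "openin T {x. Some x \<in> \<Union>\<K>}" using * by auto
  qed
  then show ?thesis by (simp add: add_point_def topology_inverse')
qed

lemma topspace_add_point: "topspace (add_point T) = insert None (Some ` topspace T)"
proof
  show "topspace (add_point T) \<subseteq> insert None (Some ` topspace T)"
    using openin_add_point[of T "topspace (add_point T)"] by simp
  have "openin (add_point T) (insert None (Some ` topspace T))"
    by (simp add: openin_add_point inj_image_mem_iff)
  then show "insert None (Some ` topspace T) \<subseteq> topspace (add_point T)"
    by (rule openin_subset)
qed

section \<open>The half plane with a virtual diagonal point\<close>

definition Lam :: "(real \<times> real) set" where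
  "Lam = {(a, b). b > a \<and> a > 0}"

definition Proj :: "real \<times> real \<Rightarrow> real \<times> real" where
  "Proj l = ((fst l + snd l) / 2, (fst l + snd l) / 2)"

definition lp_norm :: "real \<Rightarrow> real \<times> real \<Rightarrow> real" where
  "lp_norm p v = (\<bar>fst v\<bar> powr p + \<bar>snd v\<bar> powr p) powr (1 / p)"

text \<open>
  The extended half plane is encoded in \<^typ>\<open>(real \<times> real) option\<close>, with \<^term>\<open>None\<close> for the
  virtual diagonal point.  \<open>lam_dist p l l'\<close> is the quantity written as the \<open>p\<close>-norm of \<open>l - l'\<close>.
\<close>

fun lam_dist :: "real \<Rightarrow> (real \<times> real) option \<Rightarrow> (real \<times> real) option \<Rightarrow> real" where
  "lam_dist p (Some l) (Some l') = lp_norm p (l - l')"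
| "lam_dist p (Some l) None = lp_norm p (l - Proj l)"
| "lam_dist p None (Some l) = lp_norm p (l - Proj l)"
| "lam_dist p None None = 0"

text \<open>Diagonal points of the plane are represented by the virtual point.\<close>

definition lam_point :: "real \<times> real \<Rightarrow> (real \<times> real) option" where
  "lam_point v = (if fst v = snd v then None else Some v)"

fun lam_interp :: "real \<Rightarrow> (real \<times> real) option \<Rightarrow> (real \<times> real) option \<Rightarrow> (real \<times> real) option"
where
  "lam_interp t (Some l) (Some l') = lam_point ((1 - t) *\<^sub>R l + t *\<^sub>R l')"
| "lam_interp t (Some l) None = lam_point ((1 - t) *\<^sub>R l + t *\<^sub>R Proj l)"
| "lam_interp t None (Some l) = lam_point ((1 - t) *\<^sub>R Proj l + t *\<^sub>R l)"
| "lam_interp t None None = None"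

definition measure_persistence_diagram :: "(real \<times> real) measure \<Rightarrow> bool" where
  "measure_persistence_diagram \<sigma> \<longleftrightarrow>
     radon_measure_on (top_of_set Lam) \<sigma> \<and>
     (\<forall>q\<ge>1. (\<integral>\<^sup>+l. ennreal (lp_norm q (l - Proj l) powr q) \<partial>\<sigma>) < \<infinity>)"

section \<open>Measure topological networks\<close>

text \<open>
  The underlying spaces are carrier topologies on arbitrary types; functions are only
  meaningful on the carriers.
\<close>

record ('a, 'b) network =
  net_X :: "'a topology"
  net_k :: "'a \<Rightarrow> 'a \<Rightarrow> real"
  net_mu :: "'a measure"
  net_Y :: "'b topology"
  net_iota :: "'b \<Rightarrow> real \<times> real"
  net_nu :: "'b measure"
  net_omega :: "'a \<Rightarrow> 'b \<Rightarrow> real"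

definition topological_network :: "('a, 'b) network \<Rightarrow> bool" where
  "topological_network P \<longleftrightarrow>
     polish_topology (net_X P) \<and>
     borel_measure_on (net_X P) (net_mu P) \<and> prob_space (net_mu P) \<and>
     fully_supported (net_X P) (net_mu P) \<and>
     (\<forall>x\<in>topspace (net_X P). \<forall>x'\<in>topspace (net_X P). net_k P x x' = net_k P x' x) \<and>
     (\<lambda>(x, x'). net_k P x x') \<in> borel_measurable (net_mu P \<Otimes>\<^sub>M net_mu P) \<and>
     (\<exists>C. \<forall>x\<in>topspace (net_X P). \<forall>x'\<in>topspace (net_X P). \<bar>net_k P x x'\<bar> \<le> C) \<and>
     polish_topology (net_Y P) \<and> locally_compact_space (net_Y P) \<and>
     radon_measure_on (net_Y P) (net_nu P) \<and> fully_supported (net_Y P) (net_nu P) \<and>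
     continuous_map (net_Y P) (top_of_set Lam) (net_iota P) \<and>
     measure_persistence_diagram (distr (net_nu P) (borel_of (top_of_set Lam)) (net_iota P)) \<and>
     (\<forall>x\<in>topspace (net_X P). \<forall>y\<in>topspace (net_Y P). net_omega P x y \<ge> 0) \<and>
     (\<lambda>(x, y). net_omega P x y) \<in> borel_measurable (net_mu P \<Otimes>\<^sub>M net_nu P) \<and>
     (\<exists>C. \<forall>x\<in>topspace (net_X P). \<forall>y\<in>topspace (net_Y P). net_omega P x y \<le> C)"

definition ext_iota :: "('a, 'b) network \<Rightarrow> 'b option \<Rightarrow> (real \<times> real) option" where
  "ext_iota P = map_option (net_iota P)"

fun ext_omega :: "('a, 'b) network \<Rightarrow> 'a \<Rightarrow> 'b option \<Rightarrow> real" where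
  "ext_omega P x (Some y) = net_omega P x y"
| "ext_omega P x None = 0"

section \<open>Couplings and the distance\<close>

definition couplings ::
  "('a, 'b) network \<Rightarrow> ('c, 'd) network \<Rightarrow> ('a \<times> 'c) measure set" where
  "couplings P P' = {\<pi>. borel_measure_on (prod_topology (net_X P) (net_X P')) \<pi> \<and> prob_space \<pi> \<and>
     (\<forall>A\<in>sets (net_mu P). emeasure \<pi> (A \<times> topspace (net_X P')) = emeasure (net_mu P) A) \<and>
     (\<forall>B\<in>sets (net_mu P'). emeasure \<pi> (topspace (net_X P) \<times> B) = emeasure (net_mu P') B)}"

definition ext_prod ::
  "('a, 'b) network \<Rightarrow> ('c, 'd) network \<Rightarrow> ('b option \<times> 'd option) topology" where
  "ext_prod P P' = prod_topology (add_point (net_Y P)) (add_point (net_Y P'))"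

definition adm_couplings ::
  "('a, 'b) network \<Rightarrow> ('c, 'd) network \<Rightarrow> ('b option \<times> 'd option) measure set" where
  "adm_couplings P P' = {\<pi>. radon_measure_on (ext_prod P P') \<pi> \<and>
     (\<forall>A\<in>sets (net_nu P).
        emeasure \<pi> (Some ` A \<times> topspace (add_point (net_Y P'))) = emeasure (net_nu P) A) \<and>
     (\<forall>B\<in>sets (net_nu P').
        emeasure \<pi> (topspace (add_point (net_Y P)) \<times> Some ` B) = emeasure (net_nu P') B) \<and>
     emeasure \<pi> {(None, None)} = 0}"

definition ennreal_powr :: "ennreal \<Rightarrow> real \<Rightarrow> ennreal" where
  "ennreal_powr x r = (if x = \<infinity> then \<infinity> else ennreal (enn2real x powr r))"

definition TpOT_cost :: "real \<Rightarrow> ('a, 'b) network \<Rightarrow> ('c, 'd) network \<Rightarrow>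
    ('a \<times> 'c) measure \<Rightarrow> ('b option \<times> 'd option) measure \<Rightarrow> ennreal" where
  "TpOT_cost p P P' \<pi>v \<pi>e = ennreal_powr
     ((\<integral>\<^sup>+(y, y'). ennreal (lam_dist p (ext_iota P y) (ext_iota P' y') powr p) \<partial>\<pi>e) +
      (\<integral>\<^sup>+((x1, x1'), (x2, x2')).
         ennreal (\<bar>net_k P x1 x2 - net_k P' x1' x2'\<bar> powr p) \<partial>(\<pi>v \<Otimes>\<^sub>M \<pi>v)) +
      (\<integral>\<^sup>+((x, x'), (y, y')).
         ennreal (\<bar>ext_omega P x y - ext_omega P' x' y'\<bar> powr p) \<partial>(\<pi>v \<Otimes>\<^sub>M \<pi>e)))
     (1 / p)"

text \<open>
  The distance may be infinite: \<^term>\<open>net_nu P\<close> can have infinite mass, and \<^term>\<open>net_omega P\<close> is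
  only assumed to be bounded.
\<close>

definition d_TpOT :: "real \<Rightarrow> ('a, 'b) network \<Rightarrow> ('c, 'd) network \<Rightarrow> ennreal" where
  "d_TpOT p P P' =
     (INF (\<pi>v, \<pi>e)\<in>couplings P P' \<times> adm_couplings P P'. TpOT_cost p P P' \<pi>v \<pi>e)"

definition optimal_couplings :: "real \<Rightarrow> ('a, 'b) network \<Rightarrow> ('c, 'd) network \<Rightarrow>
    ('a \<times> 'c) measure \<Rightarrow> ('b option \<times> 'd option) measure \<Rightarrow> bool" where
  "optimal_couplings p P P' \<pi>v \<pi>e \<longleftrightarrow>
     \<pi>v \<in> couplings P P' \<and> \<pi>e \<in> adm_couplings P P' \<and> TpOT_cost p P P' \<pi>v \<pi>e = d_TpOT p P P'"

section \<open>Weak isomorphism and the quotient\<close>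

definition weak_isomorphism ::
  "('a, 'b) network \<Rightarrow> ('c, 'd) network \<Rightarrow> ('a \<Rightarrow> 'c) \<Rightarrow> ('b \<Rightarrow> 'd) \<Rightarrow> bool" where
  "weak_isomorphism P P' \<phi> \<psi> \<longleftrightarrow>
     measure_preserving (net_mu P) (net_mu P') \<phi> \<and>
     measure_preserving (net_nu P) (net_nu P') \<psi> \<and>
     (AE y in net_nu P. net_iota P y = net_iota P' (\<psi> y)) \<and>
     (AE (x, y) in net_mu P \<Otimes>\<^sub>M net_nu P. net_omega P x y = net_omega P' (\<phi> x) (\<psi> y)) \<and>
     (AE (x1, x2) in net_mu P \<Otimes>\<^sub>M net_mu P. net_k P x1 x2 = net_k P' (\<phi> x1) (\<phi> x2))"

text \<open>
  Types cannot be quantified over inside a formula.  A second countable T0 space injects into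
  \<^typ>\<open>nat set\<close> (send a point to the set of indices of the basic open sets containing it), so every
  Polish space is homeomorphic to one whose carrier is a subset of \<^typ>\<open>nat set\<close>.  Hence
  \<open>small_network\<close> contains an isomorphic copy of every network, and it serves as the domain of
  the existential in \<open>weakly_isomorphic\<close> and as the class of all networks in the quotient.
\<close>

type_synonym small_network = "(nat set, nat set) network"

definition weakly_isomorphic :: "('a, 'b) network \<Rightarrow> ('c, 'd) network \<Rightarrow> bool" where
  "weakly_isomorphic P P' \<longleftrightarrow>
     topological_network P \<and> topological_network P' \<and>
     (\<exists>(Q :: small_network) \<phi> \<psi> \<phi>' \<psi>'. topological_network Q \<and>
        weak_isomorphism Q P \<phi> \<psi> \<and> weak_isomorphism Q P' \<phi>' \<psi>')"

definition weak_class :: "('a, 'b) network \<Rightarrow> small_network set" where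
  "weak_class P = {R. weakly_isomorphic P R}"

definition network_quotient :: "small_network set set" where
  "network_quotient =
     {R. topological_network R} // {(R, R'). weakly_isomorphic R R'}"

text \<open>The value on a pair of classes is the common value on all pairs of representatives.\<close>

definition d_TpOT_quotient ::
  "real \<Rightarrow> small_network set \<Rightarrow> small_network set \<Rightarrow> ennreal" where
  "d_TpOT_quotient p c c' = the_elem ((\<lambda>(R, R'). d_TpOT p R R') ` (c \<times> c'))"

section \<open>Interpolation and geodesics\<close>

text \<open>
  Networks carry fully supported measures and their \<open>\<iota>\<close> takes values off the diagonal, so the
  product spaces are cut down to the supports of the couplings (a change of null sets only), and
  the points sent by the interpolated \<open>\<iota>\<close> to the virtual diagonal point are dropped.  The latter
  exist only for \<open>t = 0\<close> and \<open>t = 1\<close>.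
\<close>

definition interp_iota :: "('a, 'b) network \<Rightarrow> ('c, 'd) network \<Rightarrow> real \<Rightarrow>
    'b option \<times> 'd option \<Rightarrow> (real \<times> real) option" where
  "interp_iota P P' t = (\<lambda>(y, y'). lam_interp t (ext_iota P y) (ext_iota P' y'))"

definition interp_X ::
  "('a, 'b) network \<Rightarrow> ('c, 'd) network \<Rightarrow> ('a \<times> 'c) measure \<Rightarrow> ('a \<times> 'c) set" where
  "interp_X P P' \<pi>v = measure_support (prod_topology (net_X P) (net_X P')) \<pi>v"

definition interp_Y :: "('a, 'b) network \<Rightarrow> ('c, 'd) network \<Rightarrow> ('b option \<times> 'd option) measure \<Rightarrow>
    real \<Rightarrow> ('b option \<times> 'd option) set" where
  "interp_Y P P' \<pi>e t =
     {z \<in> measure_support (ext_prod P P') \<pi>e. z \<noteq> (None, None) \<and> interp_iota P P' t z \<noteq> None}"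

definition interp_network :: "('a, 'b) network \<Rightarrow> ('c, 'd) network \<Rightarrow>
    ('a \<times> 'c) measure \<Rightarrow> ('b option \<times> 'd option) measure \<Rightarrow> real \<Rightarrow>
    ('a \<times> 'c, 'b option \<times> 'd option) network" where
  "interp_network P P' \<pi>v \<pi>e t =
     \<lparr>net_X = subtopology (prod_topology (net_X P) (net_X P')) (interp_X P P' \<pi>v),
      net_k = (\<lambda>(x1, x1') (x2, x2'). (1 - t) * net_k P x1 x2 + t * net_k P' x1' x2'),
      net_mu = restrict_space \<pi>v (interp_X P P' \<pi>v),
      net_Y = subtopology (ext_prod P P') (interp_Y P P' \<pi>e t),
      net_iota = (\<lambda>z. the (interp_iota P P' t z)),
      net_nu = restrict_space \<pi>e (interp_Y P P' \<pi>e t),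
      net_omega = (\<lambda>(x, x') (y, y'). (1 - t) * ext_omega P x y + t * ext_omega P' x' y')\<rparr>"

definition geodesic_between ::
  "'z set \<Rightarrow> ('z \<Rightarrow> 'z \<Rightarrow> ennreal) \<Rightarrow> (real \<Rightarrow> 'z) \<Rightarrow> 'z \<Rightarrow> 'z \<Rightarrow> bool" where
  "geodesic_between Z d \<gamma> z z' \<longleftrightarrow>
     (\<forall>t\<in>{0..1}. \<gamma> t \<in> Z) \<and> \<gamma> 0 = z \<and> \<gamma> 1 = z' \<and>
     (\<forall>s t. 0 \<le> s \<and> s \<le> t \<and> t \<le> 1 \<longrightarrow> d (\<gamma> s) (\<gamma> t) = ennreal (t - s) * d z z')"

end

theory Submission
  imports Defs
begin

text \<open>
  Couplings are handled through maps from common measure spaces.  Disintegration over a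
  \<open>\<sigma>\<close>-finite base, realised by a quantile function fed with uniform noise, glues two couplings
  along their common network, and Minkowski's inequality then gives the triangle inequality for the
  costs.  A cost vanishes exactly for weakly isomorphic networks, so weak isomorphism is an
  equivalence relation and the distance descends to the quotient.  Transporting the interpolating
  networks at times \<open>s \<le> t\<close> along the identity of the optimal coupling costs \<open>t - s\<close> times the
  distance of the endpoints, and the triangle inequality along \<open>0 \<le> s \<le> t \<le> 1\<close> forces equality.
\<close>

section \<open>Borel structures of Polish topologies\<close>

text \<open>The delicate point is the virtual diagonal point. \<open>lam_dist\<close> is not a
  metric on the extended half plane: two points far apart but close to the diagonal are both near
  \<open>None\<close>. The triangle inequality for costs therefore needs a gluing that never joins
  two true points through a virtual one, and the common parameter space must be allowed surplus mass
  on pairs of virtual points, where nothing is charged. The cost puts three integrals over different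
  product spaces under one root, so Minkowski's inequality is kept as a bound with two free weights,
  linear in the integrals; the three bounds are added and only then are the weights optimised. Weak
  isomorphism is handled through couplings of cost zero rather than through distance zero, since
  gluing acts on couplings; the interpolating network at time 0 is the common source that such a
  coupling provides. Edge measures may be infinite, so the work on edges rests on sigma-finiteness.
  Networks live on various types while the quotient is formed over a single one, hence the copies on
  subsets of a fixed type.\<close>

lemma space_borel_of [simp]: "space (borel_of T) = topspace T"
  by (simp add: borel_of_def space_measure_of_conv)

lemma sets_borel_of: "sets (borel_of T) = sigma_sets (topspace T) {U. openin T U}"
  unfolding borel_of_def by (rule sets_measure_of) (auto dest: openin_subset)

lemma openin_in_borel_of: "openin T U \<Longrightarrow> U \<in> sets (borel_of T)"
  by (auto simp: sets_borel_of)

lemma closedin_in_borel_of: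
  assumes "closedin T C" shows "C \<in> sets (borel_of T)"
proof -
  have "topspace T - (topspace T - C) \<in> sets (borel_of T)"
    using assms by (intro sets.Diff openin_in_borel_of) (auto simp: closedin_def)
  moreover have "topspace T - (topspace T - C) = C"
    using closedin_subset[OF assms] by auto
  ultimately show ?thesis by simp
qed

lemma borel_measure_onD:
  assumes "borel_measure_on T M"
  shows "sets M = sets (borel_of T)" "space M = topspace T"
  using assms by (auto simp: borel_measure_on_def dest: sets_eq_imp_space_eq)

lemma measurable_borel_ofI:
  assumes "\<And>x. x \<in> space M \<Longrightarrow> f x \<in> topspace T"
    and "\<And>U. openin T U \<Longrightarrow> f -` U \<inter> space M \<in> sets M"
  shows "f \<in> measurable M (borel_of T)"
  unfolding borel_of_def using assms
  by (intro measurable_measure_of) (auto dest: openin_subset)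

lemma continuous_map_measurable:
  assumes "continuous_map S T f"
  shows "f \<in> measurable (borel_of S) (borel_of T)"
proof (rule measurable_borel_ofI)
  show "f x \<in> topspace T" if "x \<in> space (borel_of S)" for x
    using that assms by (auto simp: continuous_map_def)
next
  fix U assume "openin T U"
  then have "openin S {x \<in> topspace S. f x \<in> U}"
    using assms openin_continuous_map_preimage by blast
  moreover have "{x \<in> topspace S. f x \<in> U} = f -` U \<inter> space (borel_of S)" by auto
  ultimately show "f -` U \<inter> space (borel_of S) \<in> sets (borel_of S)"
    by (simp add: openin_in_borel_of)
qed

text \<open>Each inclusion is measurability of the identity map in one direction.\<close>

lemma sets_borel_of_subtopology:
  "sets (borel_of (subtopology T S)) = sets (restrict_space (borel_of T) S)"
proof
  have id: "(\<lambda>x. x) \<in> measurable (restrict_space (borel_of T) S) (borel_of (subtopology T S))"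
  proof (rule measurable_borel_ofI)
    fix U assume "openin (subtopology T S) U"
    then obtain V where V: "openin T V" "U = V \<inter> S" by (auto simp: openin_subtopology)
    then have "V \<subseteq> topspace T" by (simp add: openin_subset)
    then have "(\<lambda>x. x) -` U \<inter> space (restrict_space (borel_of T) S) = S \<inter> V"
      using V by (auto simp: space_restrict_space)
    then show "(\<lambda>x. x) -` U \<inter> space (restrict_space (borel_of T) S) \<in> sets (restrict_space (borel_of T) S)"
      using V by (auto simp: sets_restrict_space openin_in_borel_of)
  qed (auto simp: space_restrict_space)
  show "sets (borel_of (subtopology T S)) \<subseteq> sets (restrict_space (borel_of T) S)"
  proof
    fix A assume A: "A \<in> sets (borel_of (subtopology T S))"
    then have "A \<subseteq> topspace T \<inter> S"
      using sets.sets_into_space[OF A] by auto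
    then have "(\<lambda>x. x) -` A \<inter> space (restrict_space (borel_of T) S) = A"
      by (auto simp: space_restrict_space)
    then show "A \<in> sets (restrict_space (borel_of T) S)"
      using measurable_sets[OF id A] by simp
  qed
  have "(\<lambda>x. x) \<in> measurable (borel_of (subtopology T S)) (borel_of T)"
    by (intro continuous_map_measurable continuous_map_from_subtopology) simp
  then have "(\<lambda>x. x) \<in> measurable (borel_of (subtopology T S)) (restrict_space (borel_of T) S)"
    by (intro measurable_restrict_space2) auto
  note id' = measurable_sets[OF this]
  show "sets (restrict_space (borel_of T) S) \<subseteq> sets (borel_of (subtopology T S))"
  proof
    fix A assume A: "A \<in> sets (restrict_space (borel_of T) S)"
    then have "A \<subseteq> topspace T \<inter> S"
      using sets.sets_into_space[OF A] by (auto simp: space_restrict_space)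
    then have "(\<lambda>x. x) -` A \<inter> space (borel_of (subtopology T S)) = A"
      by auto
    then show "A \<in> sets (borel_of (subtopology T S))"
      using id'[OF A] by simp
  qed
qed

lemma sets_borel_of_euclidean: "sets (borel_of euclidean) = sets borel"
  by (simp add: sets_borel_of borel_def)

section \<open>Countable bases, products and closed subspaces of Polish spaces\<close>

lemma polish_second_countable:
  assumes "polish_topology T" shows "second_countable T"
proof -
  obtain M d where M: "Metric_space M d" "T = Metric_space.mtopology M d"
    using assms by (auto simp: polish_topology_def completely_metrizable_space_def)
  interpret Metric_space M d by (rule M)
  obtain C where C: "countable C" "C \<subseteq> M" "mtopology closure_of C = M"
    using assms M by (auto simp: polish_topology_def separable_space_def)
  define B where "B = (\<lambda>(c, n). mball c (1 / real (Suc n))) ` (C \<times> UNIV)"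
  have "\<exists>V\<in>B. x \<in> V \<and> V \<subseteq> U" if U: "openin T U" "x \<in> U" for U x
  proof -
    obtain r where r: "r > 0" "mball x r \<subseteq> U" and x: "x \<in> M"
      using U unfolding M(2) openin_mtopology by blast
    \<comment> \<open>Half of \<open>r\<close>: a centre within \<open>1 / (n + 1)\<close> of
      \<open>x\<close> has a ball that contains \<open>x\<close> and reaches less than
      \<open>2 / (n + 1) < r\<close> away from it.\<close>
    obtain n where n: "1 / real (Suc n) < r / 2"
      using r by (meson half_gt_zero nat_approx_posE)
    have "x \<in> mtopology closure_of C" using C x by simp
    then have "\<forall>r>0. \<exists>c\<in>C. c \<in> mball x r" unfolding metric_closure_of by auto
    moreover have "1 / real (Suc n) > 0" by simp
    ultimately obtain c where c: "c \<in> C" "c \<in> mball x (1 / real (Suc n))" by blast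
    show ?thesis
    proof (intro bexI conjI)
      show "mball c (1 / real (Suc n)) \<in> B" using c by (auto simp: B_def)
      show "x \<in> mball c (1 / real (Suc n))" using c by (auto simp: commute)
      show "mball c (1 / real (Suc n)) \<subseteq> U"
      proof
        fix z assume z: "z \<in> mball c (1 / real (Suc n))"
        then have "d x z \<le> d x c + d c z" using c x by (intro triangle) auto
        then show "z \<in> U" using z c n r x by auto
      qed
    qed
  qed
  moreover have "countable B" "\<forall>V\<in>B. openin T V"
    using C M by (auto simp: B_def)
  ultimately show ?thesis unfolding second_countable_def by blast
qed

lemma second_countable_sequence:
  assumes "second_countable T"
  obtains B :: "nat \<Rightarrow> 'a set" where "\<And>n. openin T (B n)"
    "\<And>U x. openin T U \<Longrightarrow> x \<in> U \<Longrightarrow> \<exists>n. x \<in> B n \<and> B n \<subseteq> U"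
proof -
  obtain \<B> where B: "countable \<B>" "\<forall>V\<in>\<B>. openin T V"
    "\<forall>U x. openin T U \<and> x \<in> U \<longrightarrow> (\<exists>V\<in>\<B>. x \<in> V \<and> V \<subseteq> U)"
    using assms by (auto simp: second_countable_def)
  \<comment> \<open>Only a nonempty set can be enumerated; the added empty set is open and makes the
    family nonempty even when the base is empty.\<close>
  have *: "range (from_nat_into (insert {} \<B>)) = insert {} \<B>"
    using B by (intro range_from_nat_into) auto
  show thesis
  proof
    show "openin T (from_nat_into (insert {} \<B>) n)" for n
    proof -
      have "from_nat_into (insert {} \<B>) n \<in> insert {} \<B>" by (rule from_nat_into) simp
      then show ?thesis using B(2) by auto
    qed
    show "\<exists>n. x \<in> from_nat_into (insert {} \<B>) n \<and> from_nat_into (insert {} \<B>) n \<subseteq> U"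
      if UX: "openin T U" "x \<in> U" for U x
    proof -
      obtain V where "V \<in> \<B>" "x \<in> V" "V \<subseteq> U" using B(3) UX by meson
      moreover have "V \<in> range (from_nat_into (insert {} \<B>))" using \<open>V \<in> \<B>\<close> * by simp
      then obtain n where "from_nat_into (insert {} \<B>) n = V" by blast
      ultimately show ?thesis by (intro exI[of _ n]) simp
    qed
  qed
qed

lemma second_countable_prod_topology:
  assumes "second_countable S" "second_countable T"
  shows "second_countable (prod_topology S T)"
proof -
  obtain A where A: "\<And>n. openin S (A n)" "\<And>U x. openin S U \<Longrightarrow> x \<in> U \<Longrightarrow> \<exists>n::nat. x \<in> A n \<and> A n \<subseteq> U"
    using second_countable_sequence[OF assms(1)] by blast
  obtain B where B: "\<And>n. openin T (B n)" "\<And>U x. openin T U \<Longrightarrow> x \<in> U \<Longrightarrow> \<exists>n::nat. x \<in> B n \<and> B n \<subseteq> U"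
    using second_countable_sequence[OF assms(2)] by blast
  show ?thesis
    unfolding second_countable_def
  proof (intro exI conjI allI impI)
    show "countable ((\<lambda>(m, n). A m \<times> B n) ` UNIV)" by simp
    show "\<forall>V\<in>(\<lambda>(m, n). A m \<times> B n) ` UNIV. openin (prod_topology S T) V"
      using A B by (auto simp: openin_prod_Times_iff)
    fix U x assume "openin (prod_topology S T) U \<and> x \<in> U"
    then obtain V W where VW: "openin S V" "openin T W" "fst x \<in> V" "snd x \<in> W" "V \<times> W \<subseteq> U"
      unfolding openin_prod_topology_alt by (metis prod.collapse)
    obtain m n where "fst x \<in> A m" "A m \<subseteq> V" "snd x \<in> B n" "B n \<subseteq> W"
      using A(2)[OF VW(1,3)] B(2)[OF VW(2,4)] by blast
    then show "\<exists>V\<in>(\<lambda>(m, n). A m \<times> B n) ` UNIV. x \<in> V \<and> V \<subseteq> U"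
      using VW by (intro bexI[of _ "A m \<times> B n"]) (auto simp: mem_Times_iff)
  qed
qed

text \<open>An open set of the product is a union of rectangles of basic open sets, and second
  countability makes this union countable. The other inclusion only uses that the projections are
  continuous.\<close>

lemma sets_borel_of_prod:
  assumes "second_countable S" "second_countable T"
  shows "sets (borel_of (prod_topology S T)) = sets (borel_of S \<Otimes>\<^sub>M borel_of T)"
proof
  obtain A where A: "\<And>n. openin S (A n)" "\<And>U x. openin S U \<Longrightarrow> x \<in> U \<Longrightarrow> \<exists>n::nat. x \<in> A n \<and> A n \<subseteq> U"
    using second_countable_sequence[OF assms(1)] by blast
  obtain B where B: "\<And>n. openin T (B n)" "\<And>U x. openin T U \<Longrightarrow> x \<in> U \<Longrightarrow> \<exists>n::nat. x \<in> B n \<and> B n \<subseteq> U"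
    using second_countable_sequence[OF assms(2)] by blast
  have "U \<in> sets (borel_of S \<Otimes>\<^sub>M borel_of T)" if U: "openin (prod_topology S T) U" for U
  proof -
    have "U = (\<Union>(m, n)\<in>{(m, n). A m \<times> B n \<subseteq> U}. A m \<times> B n)"
    proof (intro equalityI subsetI)
      fix x assume "x \<in> U"
      then obtain V W where VW: "openin S V" "openin T W" "fst x \<in> V" "snd x \<in> W" "V \<times> W \<subseteq> U"
        using U unfolding openin_prod_topology_alt by (metis prod.collapse)
      obtain m n where "fst x \<in> A m" "A m \<subseteq> V" "snd x \<in> B n" "B n \<subseteq> W"
        using A(2)[OF VW(1,3)] B(2)[OF VW(2,4)] by blast
      then show "x \<in> (\<Union>(m, n)\<in>{(m, n). A m \<times> B n \<subseteq> U}. A m \<times> B n)"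
        using VW by (intro UN_I[of "(m, n)"]) (auto simp: mem_Times_iff)
    qed auto
    moreover have "(\<Union>(m, n)\<in>{(m, n). A m \<times> B n \<subseteq> U}. A m \<times> B n) \<in> sets (borel_of S \<Otimes>\<^sub>M borel_of T)"
      using A B by (intro sets.countable_UN') (auto intro!: openin_in_borel_of)
    ultimately show ?thesis by simp
  qed
  then have "sigma_sets (topspace S \<times> topspace T) {U. openin (prod_topology S T) U}
      \<subseteq> sets (borel_of S \<Otimes>\<^sub>M borel_of T)"
    using sets.sigma_sets_subset[of "{U. openin (prod_topology S T) U}" "borel_of S \<Otimes>\<^sub>M borel_of T"]
    by (auto simp: space_pair_measure)
  then show "sets (borel_of (prod_topology S T)) \<subseteq> sets (borel_of S \<Otimes>\<^sub>M borel_of T)"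
    by (simp add: sets_borel_of)
  have "fst \<in> measurable (borel_of (prod_topology S T)) (borel_of S)"
    "snd \<in> measurable (borel_of (prod_topology S T)) (borel_of T)"
    by (auto intro!: continuous_map_measurable continuous_map_fst continuous_map_snd)
  then have "(\<lambda>x. (fst x, snd x)) \<in> measurable (borel_of (prod_topology S T)) (borel_of S \<Otimes>\<^sub>M borel_of T)"
    by (rule measurable_Pair)
  from measurable_sets[OF this]
  show "sets (borel_of S \<Otimes>\<^sub>M borel_of T) \<subseteq> sets (borel_of (prod_topology S T))"
  proof (intro subsetI)
    fix X assume X: "X \<in> sets (borel_of S \<Otimes>\<^sub>M borel_of T)"
      and *: "\<And>A. A \<in> sets (borel_of S \<Otimes>\<^sub>M borel_of T) \<Longrightarrow>
        (\<lambda>x. (fst x, snd x)) -` A \<inter> space (borel_of (prod_topology S T)) \<in> sets (borel_of (prod_topology S T))"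
    have "(\<lambda>x. (fst x, snd x)) -` X \<inter> space (borel_of (prod_topology S T)) = X"
      using sets.sets_into_space[OF X] by (auto simp: space_pair_measure)
    with *[OF X] show "X \<in> sets (borel_of (prod_topology S T))" by simp
  qed
qed

lemma polish_topology_prod:
  assumes "polish_topology S" "polish_topology T"
  shows "polish_topology (prod_topology S T)"
  using assms polish_second_countable[OF assms(1)] polish_second_countable[OF assms(2)]
  unfolding polish_topology_def
  by (simp add: completely_metrizable_space_prod_topology second_countable_prod_topology
      second_countable_imp_separable_space)

lemma polish_topology_closedin:
  assumes "polish_topology T" "closedin T S"
  shows "polish_topology (subtopology T S)"
  using assms polish_second_countable[OF assms(1)] unfolding polish_topology_def
  by (simp add: completely_metrizable_space_closedin second_countable_subtopology
      second_countable_imp_separable_space)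

section \<open>Adjoining an isolated point\<close>

text \<open>Complete metrizability, separability and local compactness pass to the product with a
  two-point discrete space and then to retracts, so the extended space inherits them. The point
  \<open>x0\<close> only fills the first coordinate over \<open>None\<close>; for want of it the
  empty space is treated apart.\<close>

lemma retraction_map_add_point:
  assumes "x0 \<in> topspace T"
  shows "retraction_map (prod_topology T (discrete_topology (UNIV :: bool set))) (add_point T)
    (\<lambda>(x, b). if b then Some x else None)"
proof -
  let ?P = "prod_topology T (discrete_topology (UNIV :: bool set))"
  let ?g = "\<lambda>(x, b). if b then Some x else None"
  let ?f = "\<lambda>z. case z of None \<Rightarrow> (x0, False) | Some x \<Rightarrow> (x, True)"
  have "continuous_map ?P (add_point T) ?g"
    unfolding continuous_map_def
  proof (intro conjI allI impI)
    fix U assume U: "openin (add_point T) U"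
    have "{x \<in> topspace ?P. ?g x \<in> U} =
      {x. Some x \<in> U} \<times> {True} \<union> (if None \<in> U then topspace T \<times> {False} else {})"
      using U by (auto simp: openin_add_point split: if_splits)
    also have "openin ?P \<dots>"
      using U by (intro openin_Un) (auto simp: openin_prod_Times_iff openin_add_point)
    finally show "openin ?P {x \<in> topspace ?P. ?g x \<in> U}" .
  qed (auto simp: topspace_add_point)
  moreover have "continuous_map (add_point T) ?P ?f"
    unfolding continuous_map_def
  proof (intro conjI allI impI)
    fix U assume U: "openin ?P U"
    have "continuous_map T ?P (\<lambda>x. (x, True))"
      by (auto intro!: continuous_map_pairedI)
    then have "openin T {x \<in> topspace T. (x, True) \<in> U}"
      using U openin_continuous_map_preimage by blast
    moreover have "{x. Some x \<in> {z \<in> topspace (add_point T). ?f z \<in> U}} = {x \<in> topspace T. (x, True) \<in> U}"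
      by (auto simp: topspace_add_point)
    ultimately show "openin (add_point T) {z \<in> topspace (add_point T). ?f z \<in> U}"
      unfolding openin_add_point by (auto simp: topspace_add_point)
  qed (use assms in \<open>auto simp: topspace_add_point\<close>)
  moreover have "\<forall>z \<in> topspace (add_point T). ?g (?f z) = z"
    by (auto split: option.splits)
  ultimately show ?thesis
    unfolding retraction_map_def retraction_maps_def by blast
qed

lemma add_point_trivial:
  assumes "topspace T = {}"
  shows "add_point T = discrete_topology {None}"
  using assms by (auto simp: topology_eq openin_add_point)

lemma polish_topology_add_point:
  assumes "polish_topology T" shows "polish_topology (add_point T)"
proof (cases "topspace T = {}")
  case True
  then show ?thesis
    by (simp add: add_point_trivial polish_topology_def completely_metrizable_space_discrete_topology
        separable_space_discrete_topology)
next
  case False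
  then obtain x0 where "x0 \<in> topspace T" by blast
  from retraction_map_add_point[OF this] show ?thesis
    using polish_topology_prod[OF assms, of "discrete_topology (UNIV :: bool set)"]
    by (auto simp: polish_topology_def completely_metrizable_space_discrete_topology
        separable_space_discrete_topology
        intro: completely_metrizable_space_retraction_map_image separable_space_retraction_map_image)
qed

lemma locally_compact_space_add_point:
  assumes "locally_compact_space T" shows "locally_compact_space (add_point T)"
proof (cases "topspace T = {}")
  case True
  then show ?thesis by (simp add: add_point_trivial locally_compact_space_discrete_topology)
next
  case False
  then obtain x0 where "x0 \<in> topspace T" by blast
  from retraction_map_add_point[OF this] show ?thesis
    using assms by (auto simp: locally_compact_space_prod_topology locally_compact_space_discrete_topology
        intro: locally_compact_space_retraction_map_image)
qed

lemma continuous_map_Some: "continuous_map T (add_point T) Some"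
  unfolding continuous_map_def
  by (auto simp: topspace_add_point openin_add_point) 
     (metis (no_types, lifting) Collect_cong openin_subset subset_eq mem_Collect_eq)

text \<open>The added point is isolated and so imposes no condition: a set is Borel as soon as its
  true part is. Sets and maps are moved between a space and its extension through this
  criterion.\<close>

lemma sets_borel_of_add_point:
  "A \<in> sets (borel_of (add_point T)) \<longleftrightarrow>
     A \<subseteq> insert None (Some ` topspace T) \<and> {x. Some x \<in> A} \<in> sets (borel_of T)"
proof
  assume A: "A \<in> sets (borel_of (add_point T))"
  have sub: "A \<subseteq> insert None (Some ` topspace T)"
    using sets.sets_into_space[OF A] by (simp add: topspace_add_point)
  have "Some -` A \<inter> space (borel_of T) \<in> sets (borel_of T)"
    by (rule measurable_sets[OF continuous_map_measurable[OF continuous_map_Some] A])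
  moreover have "Some -` A \<inter> space (borel_of T) = {x. Some x \<in> A}"
    using sub by auto
  ultimately show "A \<subseteq> insert None (Some ` topspace T) \<and> {x. Some x \<in> A} \<in> sets (borel_of T)"
    using sub by simp
next
  assume A: "A \<subseteq> insert None (Some ` topspace T) \<and> {x. Some x \<in> A} \<in> sets (borel_of T)"
  have None: "{None} \<in> sets (borel_of (add_point T))"
    by (intro openin_in_borel_of) (auto simp: openin_add_point)
  have *: "Some ` B \<in> sets (borel_of (add_point T))" if "B \<in> sets (borel_of T)" for B
    using that unfolding sets_borel_of[of T]
  proof induction
    case (Basic a)
    then show ?case
      by (intro openin_in_borel_of) (auto simp: openin_add_point inj_image_mem_iff dest: openin_subset)
  next
    case (Compl a)
    have "Some ` (topspace T - a) = space (borel_of (add_point T)) - {None} - Some ` a"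
      by (auto simp: topspace_add_point)
    then show ?case using Compl None by (metis sets.Diff sets.top)
  next
    case (Union a)
    then show ?case by (auto simp: image_UN)
  qed simp
  have "A = Some ` {x. Some x \<in> A} \<union> (A \<inter> {None})"
    by (auto simp: image_iff) (metis not_None_eq)
  moreover have "A \<inter> {None} \<in> sets (borel_of (add_point T))"
    using None by (cases "None \<in> A") auto
  ultimately show "A \<in> sets (borel_of (add_point T))"
    using *[of "{x. Some x \<in> A}"] A by (metis sets.Un)
qed

lemma None_in_sets: "{None} \<in> sets (borel_of (add_point T))"
  by (simp add: sets_borel_of_add_point)

lemma Some_image_in_sets: "A \<in> sets (borel_of T) \<Longrightarrow> Some ` A \<in> sets (borel_of (add_point T))"
  using sets.sets_into_space[of A "borel_of T"]
  by (auto simp: sets_borel_of_add_point inj_image_mem_iff)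

lemma measurable_Some: "Some \<in> measurable (borel_of T) (borel_of (add_point T))"
  by (rule continuous_map_measurable[OF continuous_map_Some])

lemma measurable_case_option_add_point:
  assumes "f \<in> measurable (borel_of T) N" "c \<in> space N"
  shows "case_option c f \<in> measurable (borel_of (add_point T)) N"
proof (rule measurableI)
  show "case_option c f z \<in> space N" if "z \<in> space (borel_of (add_point T))" for z
    using that measurable_space[OF assms(1)] assms(2) by (auto simp: topspace_add_point)
  fix A assume A: "A \<in> sets N"
  have "{x. Some x \<in> case_option c f -` A \<inter> space (borel_of (add_point T))} = f -` A \<inter> space (borel_of T)"
    by (auto simp: topspace_add_point)
  then show "case_option c f -` A \<inter> space (borel_of (add_point T)) \<in> sets (borel_of (add_point T))"
    using measurable_sets[OF assms(1) A] by (auto simp: sets_borel_of_add_point topspace_add_point)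
qed

section \<open>Supports and regularity\<close>

lemma closedin_measure_support: "closedin T (measure_support T M)"
proof -
  have "openin T (topspace T - measure_support T M)"
    unfolding openin_subopen[of T "topspace T - measure_support T M"]
    by (auto simp: measure_support_def not_gr_zero dest: openin_subset)
  then show ?thesis by (simp add: closedin_def measure_support_def)
qed

lemma null_openin_Int_measure_support:
  assumes "openin T U" "emeasure M U = 0"
  shows "U \<inter> measure_support T M = {}"
  using assms by (auto simp: measure_support_def)

text \<open>The complement of the support is covered by those members of a countable base that are
  null, hence is null itself.\<close>

lemma AE_measure_support:
  assumes "second_countable T" "sets M = sets (borel_of T)"
  shows "AE x in M. x \<in> measure_support T M"
proof -
  obtain B where B: "\<And>n. openin T (B n)" "\<And>U x. openin T U \<Longrightarrow> x \<in> U \<Longrightarrow> \<exists>n::nat. x \<in> B n \<and> B n \<subseteq> U"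
    using second_countable_sequence[OF assms(1)] by blast
  have sp: "space M = topspace T" using sets_eq_imp_space_eq[OF assms(2)] by simp
  let ?N = "\<Union>n\<in>{n. emeasure M (B n) = 0}. B n"
  have "{x \<in> space M. x \<notin> measure_support T M} \<subseteq> ?N"
  proof
    fix x assume "x \<in> {x \<in> space M. x \<notin> measure_support T M}"
    then obtain U where U: "openin T U" "x \<in> U" "emeasure M U = 0"
      by (auto simp: measure_support_def sp)
    then obtain n where n: "x \<in> B n" "B n \<subseteq> U" using B by blast
    then have "emeasure M (B n) \<le> emeasure M U"
      using U by (intro emeasure_mono) (auto simp: assms openin_in_borel_of)
    then show "x \<in> ?N" using n U by auto
  qed
  moreover have "B n \<in> sets M" for n using B by (simp add: assms openin_in_borel_of)
  then have "?N \<in> null_sets M"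
    by (intro null_sets_UN') auto
  ultimately show ?thesis by (blast intro: AE_I')
qed

text \<open>Assumption \<open>O\<close> amounts to \<open>S\<close> being relatively open in the
  support; a merely closed part of the support may be null. Under it \<open>U\<close> has the same
  mass as an open set \<open>V\<close> that meets the support.\<close>

lemma fully_supported_restrict_support:
  assumes "second_countable T" "sets M = sets (borel_of T)"
    and S: "S \<in> sets (borel_of T)" "S \<subseteq> measure_support T M"
    and O: "\<And>U. openin (subtopology T S) U \<Longrightarrow> \<exists>V. openin T V \<and> V \<inter> measure_support T M = U"
  shows "fully_supported (subtopology T S) (restrict_space M S)"
  unfolding fully_supported_def
proof (intro allI impI)
  fix U assume U: "openin (subtopology T S) U \<and> U \<noteq> {}"
  then obtain V where V: "openin T V" "V \<inter> measure_support T M = U" using O by blast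
  have sub: "U \<subseteq> S" using U by (auto simp: openin_subtopology)
  then have "emeasure M V > 0"
    using U V S by (auto simp: measure_support_def)
  moreover have "measure_support T M \<in> sets M"
    using closedin_measure_support assms(2) by (auto intro: closedin_in_borel_of)
  then have "emeasure M V = emeasure M U"
    using AE_measure_support[OF assms(1,2)] V
    by (intro emeasure_eq_AE) (auto simp: assms openin_in_borel_of)
  ultimately show "0 < emeasure (restrict_space M S) U"
    using sub S assms sets.Int_space_eq2 by (subst emeasure_restrict_space) auto
qed

section \<open>Local finiteness, sigma-finiteness and inner regularity\<close>

text \<open>By the Lindelof property countably many of the open sets of finite mass already cover
  the space.\<close>

lemma sigma_finite_locally_finite:
  assumes "second_countable T" "sets M = sets (borel_of T)"
    and lf: "\<And>x. x \<in> topspace T \<Longrightarrow> \<exists>U. openin T U \<and> x \<in> U \<and> emeasure M U < \<infinity>"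
  shows "sigma_finite_measure M"
proof
  have sp: "space M = topspace T" using sets_eq_imp_space_eq[OF assms(2)] by simp
  have "Lindelof_space T" using assms(1) by (rule second_countable_imp_Lindelof_space)
  moreover have "\<Union>{U. openin T U \<and> emeasure M U < \<infinity>} = topspace T"
    using lf openin_subset by blast
  ultimately obtain V where "countable V" "V \<subseteq> {U. openin T U \<and> emeasure M U < \<infinity>}" "\<Union>V = topspace T"
    using Lindelof_spaceD[of T "{U. openin T U \<and> emeasure M U < \<infinity>}"] by auto
  then show "\<exists>A. countable A \<and> A \<subseteq> sets M \<and> \<Union>A = space M \<and> (\<forall>a\<in>A. emeasure M a \<noteq> \<infinity>)"
    using openin_in_borel_of[of T] sp assms(2)
    by (intro exI[of _ V]) (simp add: subset_eq less_top)
qed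

lemma sigma_finite_radon:
  assumes "second_countable T" "radon_measure_on T M"
  shows "sigma_finite_measure M"
  using assms by (intro sigma_finite_locally_finite[of T]) (auto simp: radon_measure_on_def borel_measure_on_def)

text \<open>The sets that can be enclosed between a closed and an open set up to small mass form a
  sigma-algebra. It contains the open sets because in a metrizable space each of them is an
  increasing union of closed sets.\<close>

lemma finite_borel_measure_regular:
  assumes "metrizable_space T" "sets M = sets (borel_of T)" "finite_measure M"
    and A: "A \<in> sets M" and "e > 0"
  shows "\<exists>C U. closedin T C \<and> openin T U \<and> C \<subseteq> A \<and> A \<subseteq> U \<and> emeasure M (U - C) < ennreal e"
proof -
  interpret finite_measure M by fact
  have o[simp, intro]: "openin T U \<Longrightarrow> U \<in> sets M" and c[simp, intro]: "closedin T U \<Longrightarrow> U \<in> sets M" for U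
    using assms by (auto intro: openin_in_borel_of closedin_in_borel_of)
  \<comment> \<open>Quantified over all tolerances, because the case of countable unions calls the
    induction hypothesis with smaller ones.\<close>
  have "\<forall>e>0. \<exists>C U. closedin T C \<and> openin T U \<and> C \<subseteq> A \<and> A \<subseteq> U \<and> emeasure M (U - C) < ennreal e"
    using A unfolding assms(2) sets_borel_of
  proof induction
    case (Basic a)
    show ?case
    proof (intro allI impI)
      fix e :: real assume "e > 0"
      have "fsigma_in T a" using Basic open_imp_fsigma_in[OF assms(1)] by simp
      then obtain C :: "nat \<Rightarrow> 'a set" where
        C: "\<And>n. closedin T (C n)" "\<And>n. C n \<subseteq> C (Suc n)" "(\<Union>n. C n) = a"
        unfolding fsigma_in_ascending by blast
      have "(\<lambda>n. emeasure M (a - C n)) \<longlonglongrightarrow> emeasure M (\<Inter>n. a - C n)"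
        using C Basic by (intro Lim_emeasure_decseq) (auto simp: decseq_Suc_iff)
      moreover have "(\<Inter>n. a - C n) = {}" using C by auto
      ultimately have "(\<lambda>n. emeasure M (a - C n)) \<longlonglongrightarrow> 0" by (metis emeasure_empty)
      then have "eventually (\<lambda>n. emeasure M (a - C n) < ennreal e) sequentially"
        using \<open>e > 0\<close> by (intro order_tendstoD(2)) auto
      then obtain n where "emeasure M (a - C n) < ennreal e"
        by (auto simp: eventually_sequentially)
      then show "\<exists>C U. closedin T C \<and> openin T U \<and> C \<subseteq> a \<and> a \<subseteq> U \<and> emeasure M (U - C) < ennreal e"
        using C Basic by (rule_tac exI[of _ "C n"], rule_tac exI[of _ a]) auto
    qed
  next
    case Empty
    show ?case
    proof (intro allI impI)
      fix e :: real assume "e > 0"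
      then show "\<exists>C U. closedin T C \<and> openin T U \<and> C \<subseteq> {} \<and> {} \<subseteq> U \<and> emeasure M (U - C) < ennreal e"
        by (rule_tac x="{}" in exI, rule_tac x="{}" in exI) simp
    qed
  next
    case (Compl a)
    show ?case
    proof (intro allI impI)
      fix e :: real assume "e > 0"
      with Compl(2) obtain C U where "closedin T C" "openin T U" "C \<subseteq> a" "a \<subseteq> U" "emeasure M (U - C) < ennreal e"
        by meson
      moreover have "(topspace T - C) - (topspace T - U) = U - C"
        using openin_subset[OF \<open>openin T U\<close>] by auto
      ultimately show "\<exists>C U. closedin T C \<and> openin T U \<and> C \<subseteq> topspace T - a \<and> topspace T - a \<subseteq> U
          \<and> emeasure M (U - C) < ennreal e"
        by (rule_tac exI[of _ "topspace T - U"], rule_tac exI[of _ "topspace T - C"]) auto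
    qed
  next
    case (Union a)
    show ?case
    proof (intro allI impI)
      fix e :: real assume e: "e > 0"
      \<comment> \<open>The tolerances add up to \<open>e / 2\<close>. The slack makes the bound by
        \<open>e\<close> strict, so that it survives replacing the union of all \<open>C i\<close>,
        which need not be closed, by a finite one.\<close>
      have "\<forall>i. \<exists>C U. closedin T C \<and> openin T U \<and> C \<subseteq> a i \<and> a i \<subseteq> U \<and>
          emeasure M (U - C) < ennreal (e / 2 * (1/2)^Suc i)"
        using Union e by simp
      then obtain C U where CU: "\<And>i. closedin T (C i)" "\<And>i. openin T (U i)" "\<And>i. C i \<subseteq> a i" "\<And>i. a i \<subseteq> U i"
        "\<And>i. emeasure M (U i - C i) < ennreal (e / 2 * (1/2)^Suc i)" by metis
      define D where "D n = (\<Union>i\<le>n. C i)" for n :: nat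
      have D: "closedin T (D n)" for n
        unfolding D_def using CU by (intro closedin_Union) auto
      have "emeasure M ((\<Union>i. U i) - (\<Union>i. C i)) \<le> emeasure M (\<Union>i. U i - C i)"
        using CU by (intro emeasure_mono sets.countable_UN') auto
      also have "\<dots> \<le> (\<Sum>i. emeasure M (U i - C i))"
        using CU(1,2) by (intro emeasure_subadditive_countably) blast
      also have "\<dots> \<le> (\<Sum>i. ennreal (e / 2 * (1/2)^Suc i))"
        using CU by (intro suminf_le) (auto intro: less_imp_le)
      also have "\<dots> = ennreal (e / 2)"
        using power_half_series[THEN sums_mult, of "e / 2"] e
        by (intro suminf_ennreal_eq) auto
      finally have 1: "emeasure M ((\<Union>i. U i) - (\<Union>i. C i)) \<le> ennreal (e / 2)" .
      have "(\<lambda>n. emeasure M ((\<Union>i. U i) - D n)) \<longlonglongrightarrow> emeasure M (\<Inter>n. (\<Union>i. U i) - D n)"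
      proof (rule Lim_emeasure_decseq)
        have "(\<Union>i. U i) \<in> sets M" using CU(2) by (intro o openin_Union) auto
        then show "range (\<lambda>n. (\<Union>i. U i) - D n) \<subseteq> sets M" using D by blast
        show "decseq (\<lambda>n. (\<Union>i. U i) - D n)"
          unfolding D_def by (intro antimonoI Diff_mono UN_mono) auto
      qed simp
      moreover have "(\<Inter>n. (\<Union>i. U i) - D n) = (\<Union>i. U i) - (\<Union>i. C i)" by (auto simp: D_def)
      ultimately have "(\<lambda>n. emeasure M ((\<Union>i. U i) - D n)) \<longlonglongrightarrow> emeasure M ((\<Union>i. U i) - (\<Union>i. C i))"
        by simp
      moreover have "emeasure M ((\<Union>i. U i) - (\<Union>i. C i)) < ennreal e"
        by (rule le_less_trans[OF 1]) (use e in \<open>auto simp: ennreal_lessI\<close>)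
      ultimately have "eventually (\<lambda>n. emeasure M ((\<Union>i. U i) - D n) < ennreal e) sequentially"
        by (rule order_tendstoD(2))
      then obtain n where "emeasure M ((\<Union>i. U i) - D n) < ennreal e"
        by (auto simp: eventually_sequentially)
      moreover have "D n \<subseteq> (\<Union>i. a i)" "(\<Union>i. a i) \<subseteq> (\<Union>i. U i)"
        unfolding D_def using CU(3,4) by blast+
      ultimately show "\<exists>C U. closedin T C \<and> openin T U \<and> C \<subseteq> \<Union> (range a) \<and> \<Union> (range a) \<subseteq> U
          \<and> emeasure M (U - C) < ennreal e"
        using D CU(2) by (rule_tac exI[of _ "D n"], rule_tac exI[of _ "\<Union>i. U i"]) blast
    qed
  qed
  with \<open>e > 0\<close> show ?thesis by blast
qed

lemma compactin_emeasure_finite: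
  assumes "compactin T K" "sets M = sets (borel_of T)"
    and lf: "\<And>x. x \<in> topspace T \<Longrightarrow> \<exists>U. openin T U \<and> x \<in> U \<and> emeasure M U < \<infinity>"
  shows "emeasure M K < \<infinity>"
proof -
  have "K \<subseteq> \<Union>{U. openin T U \<and> emeasure M U < \<infinity>}"
    using lf compactin_subset_topspace[OF assms(1)] by blast
  then obtain F where F: "finite F" "F \<subseteq> {U. openin T U \<and> emeasure M U < \<infinity>}" "K \<subseteq> \<Union>F"
    using compactinD[OF assms(1), of "{U. openin T U \<and> emeasure M U < \<infinity>}"] by auto
  have "emeasure M K \<le> emeasure M (\<Union>U\<in>F. U)"
    using F by (intro emeasure_mono sets.finite_UN) (auto simp: assms openin_in_borel_of)
  also have "\<dots> \<le> (\<Sum>U\<in>F. emeasure M U)"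
    using F by (intro emeasure_subadditive_finite) (auto simp: assms openin_in_borel_of)
  also have "\<dots> < \<infinity>"
    using F by auto
  finally show ?thesis .
qed

text \<open>Local compactness covers the space by open sets lying inside compact ones; a countable
  subcover exists by the Lindelof property, and finite unions of the compact sets make the sequence
  increasing.\<close>

lemma sigma_compact:
  assumes "second_countable T" "locally_compact_space T"
  obtains K :: "nat \<Rightarrow> 'a set" where "\<And>n. compactin T (K n)" "incseq K" "(\<Union>n. K n) = topspace T"
proof -
  have "Lindelof_space T" using assms(1) by (rule second_countable_imp_Lindelof_space)
  moreover have "\<Union>{U. openin T U \<and> (\<exists>K. compactin T K \<and> U \<subseteq> K)} = topspace T"
  proof
    show "topspace T \<subseteq> \<Union>{U. openin T U \<and> (\<exists>K. compactin T K \<and> U \<subseteq> K)}"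
    proof
      fix x assume "x \<in> topspace T"
      then obtain U K where "openin T U" "compactin T K" "x \<in> U" "U \<subseteq> K"
        using assms(2) unfolding locally_compact_space_def by meson
      then show "x \<in> \<Union>{U. openin T U \<and> (\<exists>K. compactin T K \<and> U \<subseteq> K)}" by blast
    qed
  qed (auto dest: openin_subset)
  ultimately obtain V where V: "countable V" "V \<subseteq> {U. openin T U \<and> (\<exists>K. compactin T K \<and> U \<subseteq> K)}" "\<Union>V = topspace T"
    using Lindelof_spaceD[of T "{U. openin T U \<and> (\<exists>K. compactin T K \<and> U \<subseteq> K)}"] by auto
  have "\<forall>U\<in>V. \<exists>K. compactin T K \<and> U \<subseteq> K" using V by blast
  then obtain k where k: "\<And>U. U \<in> V \<Longrightarrow> compactin T (k U) \<and> U \<subseteq> k U" by metis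
  define k' where "k' U = (if U \<in> V then k U else {})" for U
  define u where "u = from_nat_into (insert {} V)"
  have u: "range u = insert {} V"
    unfolding u_def using V by (intro range_from_nat_into) auto
  have k': "compactin T (k' U)" for U using k by (auto simp: k'_def)
  define K where "K n = (\<Union>i\<le>n. k' (u i))" for n :: nat
  show thesis
  proof
    show K: "compactin T (K n)" for n
      unfolding K_def using k' by (intro compactin_Union) auto
    show "incseq K" unfolding K_def by (intro monoI UN_mono) auto
    show "(\<Union>n. K n) = topspace T"
    proof
      show "(\<Union>n. K n) \<subseteq> topspace T" using K compactin_subset_topspace by blast
      show "topspace T \<subseteq> (\<Union>n. K n)"
      proof
        fix x assume "x \<in> topspace T"
        then obtain U where U: "U \<in> V" "x \<in> U" using V by blast
        then obtain n where "u n = U" using u by (metis imageE insertCI)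
        then have "x \<in> K n" using U k by (auto simp: K_def k'_def)
        then show "x \<in> (\<Union>n. K n)" by blast
      qed
    qed
  qed
qed

text \<open>Cutting by a compact exhaustion leaves finite measures, for which closed inner
  approximations exist; intersected with the compact piece these become compact. Local finiteness is
  thus the only property to be checked for a Borel measure on such a space.\<close>

lemma radon_measure_onI:
  assumes "polish_topology T" "locally_compact_space T" "borel_measure_on T M"
    and lf: "\<And>x. x \<in> topspace T \<Longrightarrow> \<exists>U. openin T U \<and> x \<in> U \<and> emeasure M U < \<infinity>"
  shows "radon_measure_on T M"
  unfolding radon_measure_on_def
proof (intro conjI ballI)
  fix A assume A: "A \<in> sets M"
  have M: "sets M = sets (borel_of T)" "space M = topspace T"
    using borel_measure_onD[OF assms(3)] by auto
  have met: "metrizable_space T"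
    using assms(1) completely_metrizable_imp_metrizable_space by (auto simp: polish_topology_def)
  then have haus: "Hausdorff_space T" by (rule metrizable_imp_Hausdorff_space)
  have comp[intro]: "compactin T K \<Longrightarrow> K \<in> sets M" for K
    using haus by (auto simp: M intro!: closedin_in_borel_of compactin_imp_closedin)
  obtain K :: "nat \<Rightarrow> 'a set" where K: "\<And>n. compactin T (K n)" "incseq K" "(\<Union>n. K n) = topspace T"
    using sigma_compact[OF polish_second_countable[OF assms(1)] assms(2)] by blast
  show "emeasure M A = (SUP K\<in>{K. compactin T K \<and> K \<subseteq> A}. emeasure M K)"
  proof (rule antisym)
    show "(SUP K\<in>{K. compactin T K \<and> K \<subseteq> A}. emeasure M K) \<le> emeasure M A"
      using A by (intro SUP_least emeasure_mono) auto
    have "(SUP n. emeasure M (A \<inter> K n)) = emeasure M (\<Union>n. A \<inter> K n)"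
      using A K by (intro SUP_emeasure_incseq) (auto simp: incseq_def)
    also have "(\<Union>n. A \<inter> K n) = A"
      using K(3) sets.sets_into_space[OF A] M(2) by auto
    finally have eq: "emeasure M A = (SUP n. emeasure M (A \<inter> K n))" by simp
    have "emeasure M (A \<inter> K n) \<le> (SUP K\<in>{K. compactin T K \<and> K \<subseteq> A}. emeasure M K)" for n
    proof (rule ennreal_le_epsilon)
      fix e :: real assume e: "0 < e"
      \<comment> \<open>The mass carried by \<open>K n\<close> is finite by local finiteness, so
        \<open>?R\<close> satisfies the hypothesis of the regularity lemma although \<open>M\<close>
        itself may be infinite.\<close>
      let ?R = "density M (indicator (K n))"
      have Kn: "K n \<in> sets M" using K by auto
      have em: "emeasure ?R B = emeasure M (K n \<inter> B)" if "B \<in> sets M" for B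
        using that Kn by (simp add: emeasure_restricted)
      have "finite_measure ?R"
        using em[of "space M"] compactin_emeasure_finite[OF K(1)[of n] M(1) lf] Kn sets.sets_into_space[OF Kn]
        by (intro finite_measureI) (auto simp: Int_absorb2)
      then obtain C U where C: "closedin T C" "openin T U" "C \<subseteq> A" "A \<subseteq> U" "emeasure ?R (U - C) < ennreal e"
        using finite_borel_measure_regular[OF met _ _ _ e, of ?R A] A M by auto
      have CU: "C \<in> sets M" "U \<in> sets M"
        using C by (auto simp: M openin_in_borel_of closedin_in_borel_of)
      have co: "compactin T (K n \<inter> C)"
        using K C by (simp add: compact_Int_closedin)
      have "emeasure M (A \<inter> K n) \<le> emeasure M ((K n \<inter> C) \<union> (K n \<inter> (U - C)))"
        using C CU Kn by (intro emeasure_mono) auto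
      also have "\<dots> \<le> emeasure M (K n \<inter> C) + emeasure M (K n \<inter> (U - C))"
        using CU Kn by (intro emeasure_subadditive) auto
      also have "\<dots> \<le> (SUP K\<in>{K. compactin T K \<and> K \<subseteq> A}. emeasure M K) + ennreal e"
      proof (rule add_mono)
        show "emeasure M (K n \<inter> C) \<le> (SUP K\<in>{K. compactin T K \<and> K \<subseteq> A}. emeasure M K)"
          using co C by (intro SUP_upper) auto
        show "emeasure M (K n \<inter> (U - C)) \<le> ennreal e"
          using C(5) em[of "U - C"] CU by auto
      qed
      finally show "emeasure M (A \<inter> K n) \<le> (SUP K\<in>{K. compactin T K \<and> K \<subseteq> A}. emeasure M K) + ennreal e" .
    qed
    then show "emeasure M A \<le> (SUP K\<in>{K. compactin T K \<and> K \<subseteq> A}. emeasure M K)"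
      unfolding eq by (rule SUP_least)
  qed
qed (use assms in auto)

text \<open>Compact sets of the subspace are the compact sets of \<open>T\<close> contained in
  \<open>S\<close>, so the same sets approximate from inside.\<close>

lemma radon_measure_on_restrict:
  assumes "radon_measure_on T M" "S \<in> sets M"
  shows "radon_measure_on (subtopology T S) (restrict_space M S)"
  unfolding radon_measure_on_def
proof (intro conjI ballI)
  have M: "sets M = sets (borel_of T)" "space M = topspace T"
    using borel_measure_onD[of T M] assms by (auto simp: radon_measure_on_def)
  have em: "emeasure (restrict_space M S) B = emeasure M B" if "B \<subseteq> S" for B
    using that assms(2) sets.Int_space_eq2 by (subst emeasure_restrict_space) auto
  show "borel_measure_on (subtopology T S) (restrict_space M S)"
    unfolding borel_measure_on_def sets_borel_of_subtopology
    using M by (simp add: sets_restrict_space)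
  show "\<exists>U. openin (subtopology T S) U \<and> x \<in> U \<and> emeasure (restrict_space M S) U < \<infinity>"
    if x: "x \<in> topspace (subtopology T S)" for x
  proof -
    obtain U where U: "openin T U" "x \<in> U" "emeasure M U < \<infinity>"
      using assms(1) x unfolding radon_measure_on_def topspace_subtopology by blast
    have "emeasure M (U \<inter> S) \<le> emeasure M U"
      using U by (intro emeasure_mono) (auto simp: M openin_in_borel_of)
    then show ?thesis using U x em[of "U \<inter> S"]
      by (intro exI[of _ "U \<inter> S"]) (auto simp: openin_subtopology_Int intro: le_less_trans)
  qed
  show "emeasure (restrict_space M S) A =
      (SUP K\<in>{K. compactin (subtopology T S) K \<and> K \<subseteq> A}. emeasure (restrict_space M S) K)"
    if A: "A \<in> sets (restrict_space M S)" for A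
  proof -
    have AS: "A \<subseteq> S" "A \<in> sets M"
      using A assms(2) by (auto simp: sets_restrict_space)
    then have "{K. compactin (subtopology T S) K \<and> K \<subseteq> A} = {K. compactin T K \<and> K \<subseteq> A}"
      by (auto simp: compactin_subtopology)
    then show ?thesis
      using AS assms(1) em by (auto simp: radon_measure_on_def intro!: SUP_cong dest: subset_trans)
  qed
qed

section \<open>Randomised disintegration\<close>

text \<open>On the part of \<open>{h < f}\<close> inside a set of finite \<open>N\<close>-mass the
  integral of \<open>h\<close> is finite by \<open>fin\<close>, so the integrals may be subtracted;
  the difference is zero, which makes that part null.\<close>

lemma emeasure_density_mono_AE:
  assumes "sigma_finite_measure N" and [measurable]: "f \<in> borel_measurable N" "h \<in> borel_measurable N"
    and le: "\<And>A. A \<in> sets N \<Longrightarrow> emeasure (density N f) A \<le> emeasure (density N h) A"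
    and fin: "\<And>A. A \<in> sets N \<Longrightarrow> emeasure (density N h) A \<le> emeasure N A"
  shows "AE x in N. f x \<le> h x"
proof -
  interpret sigma_finite_measure N by fact
  obtain A :: "nat \<Rightarrow> 'a set" where A: "range A \<subseteq> sets N" "(\<Union>i. A i) = space N"
    "\<And>i. emeasure N (A i) \<noteq> \<infinity>"
    using sigma_finite by blast
  have "AE x in N. x \<in> A i \<longrightarrow> f x \<le> h x" for i
  proof -
    define B where "B = {x \<in> space N. h x < f x} \<inter> A i"
    have Ai: "A i \<in> sets N" using A by auto
    have B[measurable]: "B \<in> sets N" unfolding B_def using Ai by measurable
    let ?f = "\<lambda>x. f x * indicator B x" and ?h = "\<lambda>x. h x * indicator B x"
    have eq: "(\<integral>\<^sup>+x. ?f x \<partial>N) = emeasure (density N f) B" "(\<integral>\<^sup>+x. ?h x \<partial>N) = emeasure (density N h) B"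
      by (simp_all add: emeasure_density)
    have "emeasure (density N h) B \<le> emeasure N (A i)"
      using fin[OF B] emeasure_mono[of B "A i" N] Ai by (auto simp: B_def intro: order_trans)
    then have h_fin: "(\<integral>\<^sup>+x. ?h x \<partial>N) \<noteq> \<infinity>"
      using A(3)[of i] by (auto simp: eq top_unique)
    have "(\<integral>\<^sup>+x. ?f x - ?h x \<partial>N) = (\<integral>\<^sup>+x. ?f x \<partial>N) - (\<integral>\<^sup>+x. ?h x \<partial>N)"
    proof (rule nn_integral_diff)
      show "AE x in N. ?h x \<le> ?f x" by (rule AE_I2) (auto simp: B_def split: split_indicator)
    qed (use h_fin in auto)
    also have "\<dots> = 0" using le[OF B] h_fin by (simp add: eq diff_eq_0_ennreal less_top)
    finally have "AE x in N. ?f x - ?h x = 0"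
      by (subst (asm) nn_integral_0_iff_AE) auto
    moreover have "AE x in N. ?h x \<noteq> \<infinity>"
      using h_fin by (intro nn_integral_noteq_infinite) auto
    ultimately show ?thesis using AE_space
    proof eventually_elim
      case (elim x)
      show ?case
      proof (intro impI leI notI)
        assume "x \<in> A i" "h x < f x"
        with elim show False
          by (auto simp: B_def diff_eq_0_iff_ennreal less_top split: split_indicator_asm)
      qed
    qed
  qed
  then have "AE x in N. \<forall>i. x \<in> A i \<longrightarrow> f x \<le> h x"
    by (intro AE_all_countable[THEN iffD2] allI)
  then show ?thesis using AE_space
    by eventually_elim (use A(2) in blast)
qed

section \<open>Uniform noise and sampling by quantiles\<close>

definition unit_noise :: "real measure" where
  "unit_noise = uniform_measure lborel {0<..<1}"

lemma prob_space_unit_noise: "prob_space unit_noise"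
  unfolding unit_noise_def by (rule prob_space_uniform_measure) auto

lemma sets_unit_noise [measurable_cong, simp]: "sets unit_noise = sets borel"
  by (simp add: unit_noise_def)

lemma space_unit_noise [simp]: "space unit_noise = UNIV"
  by (simp add: unit_noise_def)

text \<open>The threshold is an \<open>ennreal\<close> because it will be a Radon-Nikodym
  derivative, playing the part of a conditional distribution function.\<close>

lemma emeasure_unit_noise_le:
  assumes "c \<le> 1"
  shows "emeasure unit_noise {u. ennreal u \<le> c} = c"
proof -
  obtain r where r: "c = ennreal r" "0 \<le> r" "r \<le> 1"
    using assms by (cases c) (auto simp: ennreal_le_1 top_unique)
  have "{0<..<1} \<inter> {u. ennreal u \<le> c} = (if r < 1 then {0<..r} else {0<..<1})"
    using r by (auto simp: ennreal_le_iff)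
  then show ?thesis
    unfolding unit_noise_def using r by (simp add: emeasure_uniform_measure divide_ennreal_def)
qed

text \<open>Supplies a generator stable under intersection on which two laws can be compared.
  Complements in the second factor are taken inside the strip \<open>B \<times> UNIV\<close>, which
  is itself a countable union of generators.\<close>

lemma sigma_sets_times_lessThan:
  "sets (N \<Otimes>\<^sub>M borel) = sigma_sets (space N \<times> (UNIV :: real set)) {B \<times> {..<r} | B r. B \<in> sets N}"
    (is "_ = sigma_sets ?\<Omega> ?E")
proof
  have E: "?E \<subseteq> Pow ?\<Omega>" using sets.sets_into_space by fastforce
  have "B \<times> C \<in> sigma_sets ?\<Omega> ?E" if B: "B \<in> sets N" and "C \<in> sets borel" for B and C :: "real set"
  proof -
    have full: "B \<times> UNIV \<in> sigma_sets ?\<Omega> ?E"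
    proof -
      have "B \<times> (UNIV :: real set) = (\<Union>n. B \<times> {..<real n})"
        using reals_Archimedean2 by auto
      moreover have "B \<times> {..<real n} \<in> sigma_sets ?\<Omega> ?E" for n
        using B by (intro sigma_sets.Basic) blast
      ultimately show ?thesis by (simp add: sigma_sets.Union)
    qed
    have "C \<in> sigma_sets UNIV (range lessThan)"
      using \<open>C \<in> sets borel\<close> by (simp add: borel_Iio)
    then show ?thesis
    proof induction
      case (Basic a)
      then show ?case using B by (auto intro!: sigma_sets.Basic)
    next
      case Empty
      then show ?case by (simp add: sigma_sets.Empty)
    next
      case (Compl a)
      have "B \<times> (UNIV - a) = B \<times> UNIV - B \<times> a" by auto
      interpret sigma_algebra ?\<Omega> "sigma_sets ?\<Omega> ?E"
        by (rule sigma_algebra_sigma_sets[OF E])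
      show ?case unfolding \<open>B \<times> (UNIV - a) = _\<close> using full Compl(2) by (rule Diff)
    next
      case (Union a)
      have "B \<times> \<Union> (range a) = (\<Union>n. B \<times> a n)" by auto
      then show ?case using Union by (auto intro: sigma_sets.Union)
    qed
  qed
  then show "sets (N \<Otimes>\<^sub>M borel) \<subseteq> sigma_sets ?\<Omega> ?E"
    unfolding sets_pair_measure space_borel
    by (intro sigma_algebra.sigma_sets_subset[OF sigma_algebra_sigma_sets[OF E]]) auto
  show "sigma_sets ?\<Omega> ?E \<subseteq> sets (N \<Otimes>\<^sub>M borel)"
  proof -
    have "?E \<subseteq> sets (N \<Otimes>\<^sub>M borel)" by auto
    from sets.sigma_sets_subset[OF this] show ?thesis by (simp add: space_pair_measure)
  qed
qed

text \<open>The conditional law of \<open>e\<close> given \<open>g\<close> has the Radon--Nikodym derivatives \<open>F q\<close> as its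
  distribution function along the rationals; its quantile function, fed with uniform noise, samples
  from it.\<close>

lemma disintegration_real:
  fixes \<pi> :: "'z measure" and e :: "'z \<Rightarrow> real"
  assumes "sigma_finite_measure N" and g[measurable]: "g \<in> measurable \<pi> N" and N: "distr \<pi> N g = N"
    and e[measurable]: "e \<in> borel_measurable \<pi>" and e01: "\<And>z. z \<in> space \<pi> \<Longrightarrow> 0 \<le> e z \<and> e z \<le> 1"
  shows "\<exists>H \<in> borel_measurable (N \<Otimes>\<^sub>M unit_noise).
    distr (N \<Otimes>\<^sub>M unit_noise) (N \<Otimes>\<^sub>M borel) (\<lambda>(y, u). (y, H (y, u))) = distr \<pi> (N \<Otimes>\<^sub>M borel) (\<lambda>z. (g z, e z))"
proof -
  interpret sigma_finite_measure N by fact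
  interpret U: prob_space unit_noise by (rule prob_space_unit_noise)
  \<comment> \<open>\<open>m q\<close> gives \<open>A\<close> the mass of \<open>e \<le> q\<close>
    above \<open>A\<close>. It is dominated by \<open>N\<close>, and its density will be the
    conditional distribution function of \<open>e\<close> at \<open>q\<close>.\<close>
  define m where "m q = distr (density \<pi> (indicator {z \<in> space \<pi>. e z \<le> q})) N g" for q
  have m: "emeasure (m q) A = emeasure \<pi> ({z \<in> space \<pi>. e z \<le> q} \<inter> g -` A)" if [measurable]: "A \<in> sets N" for q A
    unfolding m_def by (subst emeasure_distr) (auto simp: emeasure_restricted intro!: arg_cong[where f = "emeasure \<pi>"])
  have [measurable]: "{z \<in> space \<pi>. e z \<le> q} \<inter> g -` A \<in> sets \<pi>" if "A \<in> sets N" for q A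
  proof -
    have "{z \<in> space \<pi>. e z \<le> q} \<inter> g -` A = {z \<in> space \<pi>. e z \<le> q} \<inter> (g -` A \<inter> space \<pi>)" by auto
    also have "\<dots> \<in> sets \<pi>" using that by measurable
    finally show ?thesis .
  qed
  have emN: "emeasure N A = emeasure \<pi> (g -` A \<inter> space \<pi>)" if "A \<in> sets N" for A
    using that g by (subst N[symmetric]) (simp add: emeasure_distr)
  have m_le: "emeasure (m q) A \<le> emeasure N A" if "A \<in> sets N" for q A
    using that by (auto simp: m emN intro!: emeasure_mono)
  have m_mono: "emeasure (m q) A \<le> emeasure (m q') A" if "A \<in> sets N" "q \<le> q'" for q q' A
    using that by (auto simp: m intro!: emeasure_mono)
  have "\<exists>f\<in>borel_measurable N. density N f = m q" for q
  proof (rule Radon_Nikodym)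
    show "absolutely_continuous N (m q)"
    proof (unfold absolutely_continuous_def, rule subsetI)
      fix A assume "A \<in> null_sets N"
      then show "A \<in> null_sets (m q)" using m_le[of A q] by (auto simp: null_sets_def) (simp add: m_def)
    qed
  qed (simp add: m_def)
  then obtain F where F[measurable]: "\<And>q. F q \<in> borel_measurable N" and dF: "\<And>q. density N (F q) = m q"
    by metis
  have "AE y in N. F q y \<le> 1" for q
  proof (rule emeasure_density_mono_AE)
    show "emeasure (density N (F q)) A \<le> emeasure (density N (\<lambda>_. 1)) A" if "A \<in> sets N" for A
      using that m_le by (simp add: dF density_1)
  qed (auto simp: density_1 sigma_finite_measure_axioms)
  moreover have "AE y in N. F q y \<le> F q' y" if "q \<le> q'" for q q'
    using that m_le m_mono by (intro emeasure_density_mono_AE) (auto simp: dF sigma_finite_measure_axioms)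
  ultimately have good: "AE y in N. (\<forall>q\<in>\<rat>. F q y \<le> 1) \<and> (\<forall>q\<in>\<rat>. \<forall>q'\<in>\<rat>. q \<le> q' \<longrightarrow> F q y \<le> F q' y)"
    by (simp add: AE_ball_countable countable_rat AE_conj_iff)
  \<comment> \<open>The quantile of \<open>u\<close> is the infimum of the rationals
    \<open>q\<close> with \<open>u \<le> F q y\<close>. Admitting every rational
    \<open>q \<ge> 1\<close> and no negative one keeps the set nonempty and bounded below for every
    \<open>y\<close>, also on the null set where the derivatives fail to be monotone.\<close>
  define S where "S y u = {q \<in> \<rat>. 1 \<le> q \<or> 0 \<le> q \<and> ennreal u \<le> F q y}" for y u
  define H where "H = (\<lambda>(y, u). Inf (S y u))"
  have S1: "1 \<in> S y u" and Sbd: "bdd_below (S y u)" for y u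
    by (auto simp: S_def intro!: bdd_belowI[of _ 0])
  \<comment> \<open>An infimum lies strictly below \<open>r\<close> exactly when some member does,
    which turns the event into a countable union over rationals.\<close>
  have H_less: "H (y, u) < r \<longleftrightarrow> (\<exists>q\<in>\<rat>. q < r \<and> (1 \<le> q \<or> 0 \<le> q \<and> ennreal u \<le> F q y))" for y u r
  proof -
    have "H (y, u) < r \<longleftrightarrow> (\<exists>q\<in>S y u. q < r)"
      unfolding H_def using S1[of y u] Sbd[of y u] by (auto intro!: cInf_less_iff)
    then show ?thesis by (auto simp: S_def)
  qed
  have H_range: "0 \<le> H (y, u)" "H (y, u) \<le> 1" for y u
    unfolding H_def using S1[of y u] Sbd[of y u]
    by (auto intro!: cInf_greatest cInf_lower) (auto simp: S_def)
  have H[measurable]: "H \<in> borel_measurable (N \<Otimes>\<^sub>M unit_noise)"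
  proof (rule borel_measurableI_less)
    fix r :: real
    have "{x \<in> space (N \<Otimes>\<^sub>M unit_noise). H x < r} =
      (\<Union>q\<in>{q\<in>\<rat>. q < r}. {x \<in> space (N \<Otimes>\<^sub>M unit_noise). 1 \<le> q \<or> 0 \<le> q \<and> ennreal (snd x) \<le> F q (fst x)})"
      using H_less by (auto simp: space_pair_measure)
    also have "\<dots> \<in> sets (N \<Otimes>\<^sub>M unit_noise)"
    proof (intro sets.countable_UN' image_subsetI)
      show "countable {q\<in>\<rat>. q < r}" using countable_rat by (rule countable_subset[rotated]) auto
      show "{x \<in> space (N \<Otimes>\<^sub>M unit_noise). 1 \<le> q \<or> 0 \<le> q \<and> ennreal (snd x) \<le> F q (fst x)} \<in> sets (N \<Otimes>\<^sub>M unit_noise)" for q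
        by measurable
    qed
    finally show "{x \<in> space (N \<Otimes>\<^sub>M unit_noise). H x < r} \<in> sets (N \<Otimes>\<^sub>M unit_noise)" .
  qed
  let ?L = "distr (N \<Otimes>\<^sub>M unit_noise) (N \<Otimes>\<^sub>M borel) (\<lambda>(y, u). (y, H (y, u)))"
  let ?R = "distr \<pi> (N \<Otimes>\<^sub>M borel) (\<lambda>z. (g z, e z))"
  have key: "emeasure ?L (B \<times> {..<r}) = emeasure ?R (B \<times> {..<r})" if B[measurable]: "B \<in> sets N" for B r
  proof -
    let ?X = "{x \<in> space (N \<Otimes>\<^sub>M unit_noise). fst x \<in> B \<and> H x < r}"
    have X[measurable]: "?X \<in> sets (N \<Otimes>\<^sub>M unit_noise)" by measurable
    have "emeasure ?L (B \<times> {..<r}) = emeasure (N \<Otimes>\<^sub>M unit_noise) ?X"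
      by (subst emeasure_distr)
         (auto intro!: arg_cong[where f = "emeasure (N \<Otimes>\<^sub>M unit_noise)"] simp: space_pair_measure)
    also have "\<dots> = (\<integral>\<^sup>+y. emeasure unit_noise (Pair y -` ?X) \<partial>N)"
      by (rule U.emeasure_pair_measure_alt[OF X])
    finally have L: "emeasure ?L (B \<times> {..<r}) = (\<integral>\<^sup>+y. emeasure unit_noise (Pair y -` ?X) \<partial>N)" .
    have R: "emeasure ?R (B \<times> {..<r}) = emeasure \<pi> {z \<in> space \<pi>. g z \<in> B \<and> e z < r}"
      by (subst emeasure_distr) (auto intro!: arg_cong[where f = "emeasure \<pi>"])
    \<comment> \<open>Both \<open>e\<close> and \<open>H\<close> take values in the unit interval,
      so only thresholds in \<open>(0, 1]\<close> involve the derivatives.\<close>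
    consider "r > 1" | "r \<le> 0" | "0 < r" "r \<le> 1" by linarith
    then show ?thesis
    proof cases
      case 1
      then have "Pair y -` ?X = (if y \<in> B then UNIV else {})" if "y \<in> space N" for y
        using that H_range(2)[of y] by (auto simp: space_pair_measure intro: le_less_trans)
      then have "(\<integral>\<^sup>+y. emeasure unit_noise (Pair y -` ?X) \<partial>N) = (\<integral>\<^sup>+y. indicator B y \<partial>N)"
        using U.emeasure_space_1 by (intro nn_integral_cong) (auto split: split_indicator)
      also have "\<dots> = emeasure N B" by simp
      also have "\<dots> = emeasure \<pi> {z \<in> space \<pi>. g z \<in> B \<and> e z < r}"
        using 1 e01 by (auto simp: emN intro!: arg_cong[where f = "emeasure \<pi>"] intro: le_less_trans)
      finally show ?thesis using L R by simp
    next
      case 2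
      then have "Pair y -` ?X = {}" for y
        using H_range(1)[of y] by (auto simp: not_less intro: order_trans)
      moreover have "{z \<in> space \<pi>. g z \<in> B \<and> e z < r} = {}" using 2 e01 by fastforce
      ultimately show ?thesis unfolding L R by (simp only: emeasure_empty nn_integral_0_iff_AE) simp
    next
      case 3
      \<comment> \<open>The windows are adjacent, the upper end of one being the lower end of the
        next, so the rationals picked from them increase to \<open>r\<close>. The first window
        starts at 0, which keeps all of them nonnegative.\<close>
      have "\<forall>n::nat. \<exists>q\<in>\<rat>. r - r / (n + 1) < q \<and> q < r - r / (n + 2)"
        using 3 by (intro allI Rats_dense_in_real) (simp add: divide_strict_left_mono)
      then obtain q where q: "\<And>n::nat. q n \<in> \<rat>" "\<And>n::nat. r - r / (real n + 1) < q n" "\<And>n::nat. q n < r - r / (real n + 2)"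
        by metis
      have q_Suc: "q n \<le> q (Suc n)" for n
        using q(3)[of n] q(2)[of "Suc n"] by (simp add: add.commute)
      then have q_mono: "mono q" by (simp add: mono_iff_le_Suc)
      have q_pos: "0 \<le> q n" for n
      proof -
        have "r / (real n + 1) \<le> r / 1" using 3 by (intro divide_left_mono) auto
        then show ?thesis using q(2)[of n] by simp
      qed
      have q_r: "q n < r" for n
      proof -
        have "r / (real n + 2) > 0" using 3 by (intro divide_pos_pos) auto
        then show ?thesis using q(3)[of n] by linarith
      qed
      have q_cofinal: "\<exists>n. s \<le> q n" if "s < r" for s
      proof -
        obtain n :: nat where "r / (r - s) < n" using reals_Archimedean2 by blast
        then have "r < (r - s) * (n + 1)" using that 3 by (simp add: field_simps)
        then have "r / (real n + 1) < r - s" by (simp add: field_simps)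
        then show ?thesis using q(2)[of n] by (intro exI[of _ n]) linarith
      qed
      have "AE y in N. emeasure unit_noise (Pair y -` ?X) = (SUP n. F (q n) y * indicator B y)"
        using good AE_space
      proof eventually_elim
        case (elim y)
        show ?case
        proof (cases "y \<in> B")
          case True
          have "Pair y -` ?X = (\<Union>n. {u. ennreal u \<le> F (q n) y})"
          proof (intro equalityI subsetI)
            fix u assume "u \<in> Pair y -` ?X"
            then obtain s where s: "s \<in> \<rat>" "s < r" "0 \<le> s" "ennreal u \<le> F s y"
              using H_less[of y u r] 3 by auto
            obtain n where "s \<le> q n" using q_cofinal s by blast
            then have "F s y \<le> F (q n) y" using elim s q by blast
            then show "u \<in> (\<Union>n. {u. ennreal u \<le> F (q n) y})" using s by (auto intro: order_trans)
          next
            fix u assume "u \<in> (\<Union>n. {u. ennreal u \<le> F (q n) y})"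
            then obtain n where "ennreal u \<le> F (q n) y" by auto
            then have "H (y, u) < r" using H_less q q_pos q_r by blast
            then show "u \<in> Pair y -` ?X" using elim True by (simp add: space_pair_measure)
          qed
          also have "emeasure unit_noise \<dots> = (SUP n. emeasure unit_noise {u. ennreal u \<le> F (q n) y})"
          proof (rule SUP_emeasure_incseq[symmetric])
            show "incseq (\<lambda>n. {u. ennreal u \<le> F (q n) y})"
              using elim q q_mono by (auto simp: incseq_def mono_def intro: order_trans)
          qed auto
          also have "\<dots> = (SUP n. F (q n) y)"
            using elim q by (simp add: emeasure_unit_noise_le)
          finally show ?thesis using True by simp
        qed (auto simp: space_pair_measure)
      qed
      then have "(\<integral>\<^sup>+y. emeasure unit_noise (Pair y -` ?X) \<partial>N) = (\<integral>\<^sup>+y. (SUP n. F (q n) y * indicator B y) \<partial>N)"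
        by (rule nn_integral_cong_AE)
      also have "\<dots> = (SUP n. \<integral>\<^sup>+y. F (q n) y * indicator B y \<partial>N)"
      proof (rule nn_integral_monotone_convergence_SUP_AE)
        show "AE y in N. F (q n) y * indicator B y \<le> F (q (Suc n)) y * indicator B y" for n
          using good by eventually_elim (use q q_Suc in \<open>auto split: split_indicator\<close>)
      qed measurable
      also have "\<dots> = (SUP n. emeasure \<pi> ({z \<in> space \<pi>. e z \<le> q n} \<inter> g -` B))"
        using dF by (simp add: emeasure_density[symmetric] m)
      also have "\<dots> = emeasure \<pi> (\<Union>n. {z \<in> space \<pi>. e z \<le> q n} \<inter> g -` B)"
        using q_mono by (intro SUP_emeasure_incseq) (auto simp: incseq_def mono_def intro: order_trans)
      also have "(\<Union>n. {z \<in> space \<pi>. e z \<le> q n} \<inter> g -` B) = {z \<in> space \<pi>. g z \<in> B \<and> e z < r}"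
        using q_r q_cofinal by (auto intro: le_less_trans)
      finally show ?thesis using L R by simp
    qed
  qed
  \<comment> \<open>An increasing exhaustion, because in the sets
    \<open>A i \<times> {..<real i}\<close> one index serves both factors: a point is caught at the
    larger of the two indices that it needs.\<close>
  obtain A :: "nat \<Rightarrow> 'a set" where A: "range A \<subseteq> sets N" "(\<Union>i. A i) = space N"
    "\<And>i. emeasure N (A i) \<noteq> \<infinity>" "incseq A"
    using sigma_finite_incseq by blast
  have "?L = ?R"
  proof (rule measure_eqI_generator_eq)
    let ?E = "{B \<times> {..<r} | B r. B \<in> sets N} :: ('a \<times> real) set set"
    show "Int_stable ?E"
    proof (rule Int_stableI)
      fix a b assume "a \<in> ?E" "b \<in> ?E"
      then obtain B r C s where "a = B \<times> {..<r}" "b = C \<times> {..<s}" "B \<in> sets N" "C \<in> sets N" by blast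
      then have "a \<inter> b = (B \<inter> C) \<times> {..<min r s}" "B \<inter> C \<in> sets N" by auto
      then show "a \<inter> b \<in> ?E" by blast
    qed
    show "?E \<subseteq> Pow (space N \<times> UNIV)" using sets.sets_into_space by fastforce
    show "emeasure ?L X = emeasure ?R X" if "X \<in> ?E" for X
      using that key by blast
    show "sets ?L = sigma_sets (space N \<times> UNIV) ?E" "sets ?R = sigma_sets (space N \<times> UNIV) ?E"
      by (simp_all add: sigma_sets_times_lessThan)
    show "range (\<lambda>i. A i \<times> {..<real i}) \<subseteq> ?E" using A by auto
    show "(\<Union>i. A i \<times> {..<real i}) = space N \<times> UNIV"
    proof (intro equalityI subsetI)
      fix x :: "'a \<times> real" assume "x \<in> space N \<times> UNIV"
      then obtain i where i: "fst x \<in> A i" using A(2) by (auto simp: mem_Times_iff)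
      obtain j :: nat where j: "snd x < j" using reals_Archimedean2 by blast
      have "fst x \<in> A (max i j)" using i A(4) unfolding incseq_def by (meson max.cobounded1 subsetD)
      moreover have "snd x < real (max i j)" using j by auto
      ultimately show "x \<in> (\<Union>i. A i \<times> {..<real i})" by (auto simp: mem_Times_iff)
    qed (use A in auto)
    show "emeasure ?L (A i \<times> {..<real i}) \<noteq> \<infinity>" for i
    proof -
      have [measurable]: "A i \<in> sets N" using A by auto
      have "emeasure ?R (A i \<times> {..<real i}) \<le> emeasure N (A i)"
        by (subst emeasure_distr) (auto simp: emN intro!: emeasure_mono)
      then show ?thesis using key[of "A i" "real i"] A(3)[of i] by (auto simp: top_unique)
    qed
  qed
  then show ?thesis using H by blast
qed

section \<open>Coding points of a Polish space by real numbers\<close>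

text \<open>Base 3 with digits 0 and 1 only: every tail is then at most one half of a unit, so
  digits can be recovered by rounding down, whereas binary expansions are ambiguous.\<close>

definition ternary :: "(nat \<Rightarrow> bool) \<Rightarrow> real" where
  "ternary b = (\<Sum>k. of_bool (b k) * (1 / 3) ^ Suc k)"

definition ternary_digit :: "nat \<Rightarrow> real \<Rightarrow> bool" where
  "ternary_digit k x \<longleftrightarrow> \<lfloor>3 ^ Suc k * x\<rfloor> - 3 * \<lfloor>3 ^ k * x\<rfloor> = 1"

lemma summable_ternary: "summable (\<lambda>k. of_bool (b k) * (1 / 3 :: real) ^ Suc k)"
proof (rule summable_comparison_test')
  show "summable (\<lambda>k. (1 / 3 :: real) ^ Suc k)"
    using summable_geometric[of "1 / 3 :: real"] by (simp add: summable_Suc_iff del: power_Suc)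
qed (auto simp: of_bool_def)

lemma ternary_bounds: "0 \<le> ternary b" "ternary b \<le> 1 / 2"
proof -
  show "0 \<le> ternary b"
    unfolding ternary_def by (intro suminf_nonneg summable_ternary) auto
  have s: "(\<lambda>k. (1 / 3 :: real) ^ Suc k) sums (1 / 2)"
    using sums_mult[OF geometric_sums[of "1 / 3 :: real"], of "1 / 3"] by simp
  have "ternary b \<le> (\<Sum>k. (1 / 3 :: real) ^ Suc k)"
    unfolding ternary_def using s
    by (intro suminf_le summable_ternary) (auto simp: of_bool_def sums_iff)
  then show "ternary b \<le> 1 / 2" using s by (simp add: sums_iff)
qed

lemma ternary_shift: "3 * ternary b = of_bool (b 0) + ternary (\<lambda>k. b (Suc k))"
proof -
  have "ternary b = of_bool (b 0) / 3 + (\<Sum>k. of_bool (b (Suc k)) * (1 / 3) ^ Suc (Suc k))"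
    unfolding ternary_def using suminf_split_head[OF summable_ternary[of b]] by simp
  also have "(\<Sum>k. of_bool (b (Suc k)) * (1 / 3 :: real) ^ Suc (Suc k)) = ternary (\<lambda>k. b (Suc k)) / 3"
    unfolding ternary_def using suminf_mult[OF summable_ternary[of "\<lambda>k. b (Suc k)"], of "1 / 3"]
    by (simp add: ac_simps)
  finally show ?thesis by simp
qed

text \<open>Multiplication by \<open>3 ^ k\<close> leaves an integer plus the code of the shifted
  sequence; the latter lies in \<open>[0, 1/2]\<close> and disappears under the floor.\<close>

lemma ternary_digit_ternary: "ternary_digit k (ternary b) = b k"
proof -
  have floor: "\<lfloor>3 ^ k * ternary b\<rfloor> = I" if "3 ^ k * ternary b = of_int I + ternary c" for k I c
    using that ternary_bounds[of c] by (intro floor_unique) auto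
  have "\<exists>I :: int. 3 ^ k * ternary b = of_int I + ternary (\<lambda>j. b (j + k))" for k
  proof (induction k)
    case (Suc k)
    then obtain I :: int where I: "3 ^ k * ternary b = of_int I + ternary (\<lambda>j. b (j + k))" by blast
    have "3 ^ Suc k * ternary b = 3 * of_int I + 3 * ternary (\<lambda>j. b (j + k))"
      using I by simp
    also have "\<dots> = of_int (3 * I + of_bool (b k)) + ternary (\<lambda>j. b (j + Suc k))"
      using ternary_shift[of "\<lambda>j. b (j + k)"] by simp
    finally show ?case by blast
  qed (simp add: exI[of _ 0])
  then obtain I :: int where I: "3 ^ k * ternary b = of_int I + ternary (\<lambda>j. b (j + k))" by blast
  have "3 ^ Suc k * ternary b = 3 * of_int I + 3 * ternary (\<lambda>j. b (j + k))"
    using I by simp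
  also have "\<dots> = of_int (3 * I + of_bool (b k)) + ternary (\<lambda>j. b (j + Suc k))"
    using ternary_shift[of "\<lambda>j. b (j + k)"] by simp
  finally have J: "3 ^ Suc k * ternary b = of_int (3 * I + of_bool (b k)) + ternary (\<lambda>j. b (j + Suc k))" .
  show ?thesis
    unfolding ternary_digit_def floor[OF I] floor[OF J] by (auto simp: of_bool_def)
qed

lemma measurable_ternary_digit [measurable]: "Measurable.pred borel (ternary_digit k)"
  unfolding ternary_digit_def by measurable

text \<open>A point is coded by the bits telling which balls of a countable family contain it, and decoded
  as the limit of the centres of the first ball of each radius.\<close>

lemma polish_real_code:
  assumes "polish_topology T" "topspace T \<noteq> {}"
  obtains e :: "'a \<Rightarrow> real" and r :: "real \<Rightarrow> 'a" where
    "e \<in> borel_measurable (borel_of T)" "r \<in> measurable borel (borel_of T)"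
    "\<And>x. x \<in> topspace T \<Longrightarrow> 0 \<le> e x \<and> e x \<le> 1 \<and> r (e x) = x"
proof -
  obtain M d where M: "Metric_space M d" "Metric_space.mcomplete M d" "T = Metric_space.mtopology M d"
    using assms by (auto simp: polish_topology_def completely_metrizable_space_def)
  interpret Metric_space M d by (rule M)
  have top: "topspace T = M" using M(3) by simp
  obtain C where C: "countable C" "C \<subseteq> M" "mtopology closure_of C = M"
    using assms M by (auto simp: polish_topology_def separable_space_def)
  then have "C \<noteq> {}" using assms top by auto
  define c where "c = from_nat_into C"
  have rc: "range c = C" using C \<open>C \<noteq> {}\<close> by (simp add: c_def range_from_nat_into)
  then have cM: "c n \<in> M" for n using C by auto
  define \<epsilon> where "\<epsilon> n = (1 / 2 :: real) ^ n" for n :: nat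
  have \<epsilon>: "\<epsilon> n > 0" for n by (simp add: \<epsilon>_def)
  define bit where "bit x k = (case prod_decode k of (n, m) \<Rightarrow> x \<in> mball (c m) (\<epsilon> n))" for x k
  define e where "e x = ternary (bit x)" for x
  define s where "s n y = (LEAST m. ternary_digit (prod_encode (n, m)) y)" for n y
  \<comment> \<open>For an arbitrary real \<open>y\<close> the decoded balls may be incompatible.
    This condition compares only centres, hence is a countable combination of conditions on the
    indices \<open>s n y\<close> and visibly measurable, yet it makes the centres a Cauchy
    sequence.\<close>
  define good where "good y \<longleftrightarrow> (\<forall>n m. d (c (s n y)) (c (s m y)) \<le> \<epsilon> n + \<epsilon> m)" for y
  define r where "r y = (if good y then (THE x. x \<in> M \<and> (\<forall>n. d (c (s n y)) x \<le> \<epsilon> n)) else c 0)" for y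
  have eps: "\<exists>n. \<epsilon> n < \<delta>" if "\<delta> > 0" for \<delta>
    using that unfolding \<epsilon>_def by (intro real_arch_pow_inv) auto
  have unique: "x = x'" if "x \<in> M" "x' \<in> M" "\<forall>n. d (c (s n y)) x \<le> \<epsilon> n" "\<forall>n. d (c (s n y)) x' \<le> \<epsilon> n" for x x' y
  proof (rule ccontr)
    assume "x \<noteq> x'"
    then have "d x x' / 2 > 0" using that by simp
    then obtain n where "\<epsilon> n < d x x' / 2" using eps by blast
    moreover have "d x x' \<le> d x (c (s n y)) + d (c (s n y)) x'" using that cM by (intro triangle) auto
    ultimately show False using that by (smt (verit) commute field_sum_of_halves)
  qed
  have limit: "\<exists>x\<in>M. \<forall>n. d (c (s n y)) x \<le> \<epsilon> n" if y: "good y" for y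
  proof -
    have "MCauchy (\<lambda>n. c (s n y))"
      unfolding MCauchy_def
    proof (intro conjI allI impI)
      fix \<delta> :: real assume "\<delta> > 0"
      then obtain N where N: "\<epsilon> N < \<delta> / 2" using eps[of "\<delta> / 2"] by auto
      have "d (c (s n y)) (c (s n' y)) < \<delta>" if "N \<le> n" "N \<le> n'" for n n'
      proof -
        have "\<epsilon> n \<le> \<epsilon> N" "\<epsilon> n' \<le> \<epsilon> N"
          using that by (auto simp: \<epsilon>_def intro!: power_decreasing)
        moreover have "d (c (s n y)) (c (s n' y)) \<le> \<epsilon> n + \<epsilon> n'" using y by (auto simp: good_def)
        ultimately show ?thesis using N by linarith
      qed
      then show "\<exists>N. \<forall>n n'. N \<le> n \<longrightarrow> N \<le> n' \<longrightarrow> d (c (s n y)) (c (s n' y)) < \<delta>" by blast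
    qed (use cM in auto)
    then obtain x where x: "limitin mtopology (\<lambda>n. c (s n y)) x sequentially"
      using M(2) by (auto simp: mcomplete_def)
    then have xM: "x \<in> M" using limitin_mspace by blast
    have "d (c (s n y)) x \<le> \<epsilon> n" for n
    proof (rule field_le_epsilon)
      fix \<delta> :: real assume \<delta>: "\<delta> > 0"
      obtain N1 where N1: "\<And>k. k \<ge> N1 \<Longrightarrow> d (c (s k y)) x < \<delta> / 2"
        using x \<delta> unfolding limit_metric_sequentially by (meson half_gt_zero)
      obtain N2 where N2: "\<epsilon> N2 < \<delta> / 2" using eps[of "\<delta> / 2"] \<delta> by auto
      let ?k = "max N1 N2"
      have "\<epsilon> ?k \<le> \<epsilon> N2" by (auto simp: \<epsilon>_def intro!: power_decreasing)
      moreover have "d (c (s n y)) x \<le> d (c (s n y)) (c (s ?k y)) + d (c (s ?k y)) x"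
        using xM cM by (intro triangle) auto
      moreover have "d (c (s n y)) (c (s ?k y)) \<le> \<epsilon> n + \<epsilon> ?k" using y by (auto simp: good_def)
      ultimately show "d (c (s n y)) x \<le> \<epsilon> n + \<delta>" using N1[of ?k] N2 by simp
    qed
    then show ?thesis using xM by blast
  qed
  have r_good: "r y \<in> M \<and> (\<forall>n. d (c (s n y)) (r y) \<le> \<epsilon> n)" if "good y" for y
  proof -
    have "\<exists>!x. x \<in> M \<and> (\<forall>n. d (c (s n y)) x \<le> \<epsilon> n)"
      using limit[OF that] unique by blast
    from theI'[OF this] show ?thesis using that by (simp add: r_def)
  qed
  have s_e: "d (c (s n (e x))) x < \<epsilon> n" if x: "x \<in> M" for n x
  proof -
    have dig: "ternary_digit (prod_encode (n, m)) (e x) \<longleftrightarrow> x \<in> mball (c m) (\<epsilon> n)" for m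
      by (simp add: e_def ternary_digit_ternary bit_def)
    have "x \<in> mtopology closure_of C" using C x by simp
    then obtain z where "z \<in> C" "z \<in> mball x (\<epsilon> n)"
      unfolding metric_closure_of using \<epsilon>[of n] by blast
    then obtain m where "x \<in> mball (c m) (\<epsilon> n)"
      using rc x by (metis in_mball commute imageE)
    then have "x \<in> mball (c (s n (e x))) (\<epsilon> n)"
      unfolding s_def dig by (rule LeastI)
    then show ?thesis by simp
  qed
  have re: "r (e x) = x" if x: "x \<in> M" for x
  proof -
    have "d (c (s n (e x))) (c (s m (e x))) \<le> \<epsilon> n + \<epsilon> m" for n m
    proof -
      have "d (c (s n (e x))) (c (s m (e x))) \<le> d (c (s n (e x))) x + d x (c (s m (e x)))"
        using x cM by (intro triangle) auto
      then show ?thesis using s_e[OF x, of n] s_e[OF x, of m] commute[of x] by simp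
    qed
    then have "good (e x)" by (simp add: good_def)
    then have "r (e x) \<in> M" "\<forall>n. d (c (s n (e x))) (r (e x)) \<le> \<epsilon> n" using r_good by auto
    moreover have "\<forall>n. d (c (s n (e x))) x \<le> \<epsilon> n" using s_e[OF x] by (auto intro: less_imp_le)
    ultimately show ?thesis using x unique by blast
  qed
  have s_meas[measurable]: "s n \<in> measurable borel (count_space UNIV)" for n
    unfolding s_def by measurable
  have s_sets: "{y. s n y = i} \<in> sets borel" for n i
    using measurable_sets[OF s_meas[of n], of "{i}"] by (simp add: vimage_def)
  have good_sets: "{y. good y} \<in> sets borel"
  proof -
    have "{y. good y} = (\<Inter>n. \<Inter>m. \<Union>(i, j)\<in>{(i, j). d (c i) (c j) \<le> \<epsilon> n + \<epsilon> m}. {y. s n y = i} \<inter> {y. s m y = j})"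
      by (auto simp: good_def)
    also have "\<dots> \<in> sets borel"
    proof (intro sets.countable_INT'' sets.countable_UN' image_subsetI)
      fix n m and ij :: "nat \<times> nat"
      show "(case ij of (i, j) \<Rightarrow> {y. s n y = i} \<inter> {y. s m y = j}) \<in> sets borel"
        by (cases ij) (simp add: s_sets sets.Int)
    qed auto
    finally show ?thesis .
  qed
  have r_meas: "r \<in> measurable borel (borel_of T)"
  proof (rule measurable_borel_ofI)
    show "r y \<in> topspace T" for y
      using r_good[of y] cM by (cases "good y") (auto simp: top r_def)
    fix U assume U: "openin T U"
    \<comment> \<open>The decoded point lies in each closed ball around a decoded centre, and these
      balls shrink to it. So it belongs to the open set \<open>U\<close> exactly when one of them is
      contained in \<open>U\<close>, a condition on the indices alone.\<close>
    define V where "V = (\<Union>n. \<Union>i\<in>{i. mcball (c i) (\<epsilon> n) \<subseteq> U}. {y. s n y = i})"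
    have iff: "r y \<in> U \<longleftrightarrow> y \<in> V" if y: "good y" for y
    proof
      assume "r y \<in> U"
      then obtain \<delta> where \<delta>: "\<delta> > 0" "mball (r y) \<delta> \<subseteq> U"
        using U unfolding M(3) openin_mtopology by blast
      obtain n where n: "\<epsilon> n < \<delta> / 2" using eps[of "\<delta> / 2"] \<delta> by auto
      have "mcball (c (s n y)) (\<epsilon> n) \<subseteq> U"
      proof
        fix z assume z: "z \<in> mcball (c (s n y)) (\<epsilon> n)"
        have "d (r y) z \<le> d (r y) (c (s n y)) + d (c (s n y)) z"
          using z r_good[OF y] cM by (intro triangle) auto
        moreover have "d (r y) (c (s n y)) \<le> \<epsilon> n" using r_good[OF y] by (metis commute)
        ultimately have "z \<in> mball (r y) \<delta>" using z n r_good[OF y] by auto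
        then show "z \<in> U" using \<delta> by blast
      qed
      then show "y \<in> V" by (auto simp: V_def)
    next
      assume "y \<in> V"
      then obtain n where "mcball (c (s n y)) (\<epsilon> n) \<subseteq> U" by (auto simp: V_def)
      then show "r y \<in> U" using r_good[OF y] cM by (auto simp: subset_eq)
    qed
    have bad: "r y = c 0" if "\<not> good y" for y using that by (simp add: r_def)
    have "r -` U \<inter> space borel = ({y. good y} \<inter> V) \<union> (if c 0 \<in> U then - {y. good y} else {})"
    proof (rule set_eqI)
      fix y show "y \<in> r -` U \<inter> space borel \<longleftrightarrow> y \<in> ({y. good y} \<inter> V) \<union> (if c 0 \<in> U then - {y. good y} else {})"
        using iff[of y] bad[of y] by (cases "good y") auto
    qed
    also have "\<dots> \<in> sets borel"
    proof -
      have "V \<in> sets borel"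
        unfolding V_def by (intro sets.countable_UN' image_subsetI s_sets) auto
      then show ?thesis using good_sets by auto
    qed
    finally show "r -` U \<inter> space borel \<in> sets borel" .
  qed
  have e_meas: "e \<in> borel_measurable (borel_of T)"
  proof -
    have [measurable]: "Measurable.pred (borel_of T) (\<lambda>x. bit x k)" for k
    proof -
      obtain n m where "prod_decode k = (n, m)" by (cases "prod_decode k")
      then have "{x \<in> space (borel_of T). bit x k} = mball (c m) (\<epsilon> n)"
        by (auto simp: bit_def top)
      also have "\<dots> \<in> sets (borel_of T)" using M(3) by (simp add: openin_in_borel_of)
      finally show ?thesis by (simp add: pred_def)
    qed
    show ?thesis unfolding e_def ternary_def of_bool_def by measurable
  qed
  show thesis
  proof (rule that[OF e_meas r_meas])
    fix x assume "x \<in> topspace T"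
    then show "0 \<le> e x \<and> e x \<le> 1 \<and> r (e x) = x"
      using re[of x] ternary_bounds[of "bit x"] by (simp add: top e_def)
  qed
qed

section \<open>Gluing\<close>

text \<open>\<open>G (y, u)\<close> samples from the conditional law of \<open>f\<close> given
  \<open>g = y\<close>. The code by reals reduces the claim to real-valued \<open>f\<close>, and the
  decoder undoes the code on all values of \<open>f\<close>.\<close>

lemma disintegration:
  fixes \<pi> :: "'z measure" and f :: "'z \<Rightarrow> 'a"
  assumes T: "polish_topology T" "topspace T \<noteq> {}" and N: "sigma_finite_measure N"
    and g[measurable]: "g \<in> measurable \<pi> N" "distr \<pi> N g = N"
    and f[measurable]: "f \<in> measurable \<pi> (borel_of T)"
  obtains G where "G \<in> measurable (N \<Otimes>\<^sub>M unit_noise) (borel_of T)"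
    "distr (N \<Otimes>\<^sub>M unit_noise) (N \<Otimes>\<^sub>M borel_of T) (\<lambda>z. (fst z, G z)) =
     distr \<pi> (N \<Otimes>\<^sub>M borel_of T) (\<lambda>z. (g z, f z))"
proof -
  obtain e :: "'a \<Rightarrow> real" and r where e[measurable]: "e \<in> borel_measurable (borel_of T)"
    and r[measurable]: "r \<in> measurable borel (borel_of T)"
    and re: "\<And>x. x \<in> topspace T \<Longrightarrow> 0 \<le> e x \<and> e x \<le> 1 \<and> r (e x) = x"
    using polish_real_code[OF T] by blast
  have fT: "f z \<in> topspace T" if "z \<in> space \<pi>" for z using measurable_space[OF f that] by simp
  obtain H where H[measurable]: "H \<in> borel_measurable (N \<Otimes>\<^sub>M unit_noise)"
    and eq: "distr (N \<Otimes>\<^sub>M unit_noise) (N \<Otimes>\<^sub>M borel) (\<lambda>(y, u). (y, H (y, u))) =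
      distr \<pi> (N \<Otimes>\<^sub>M borel) (\<lambda>z. (g z, e (f z)))"
    using disintegration_real[OF N g, of "\<lambda>z. e (f z)"] fT re by auto
  show thesis
  proof
    show "(\<lambda>z. r (H z)) \<in> measurable (N \<Otimes>\<^sub>M unit_noise) (borel_of T)" by measurable
    have R[measurable]: "(\<lambda>x. (fst x, r (snd x))) \<in> measurable (N \<Otimes>\<^sub>M borel) (N \<Otimes>\<^sub>M borel_of T)"
      by measurable
    have "distr (N \<Otimes>\<^sub>M unit_noise) (N \<Otimes>\<^sub>M borel_of T) (\<lambda>z. (fst z, r (H z))) =
      distr (distr (N \<Otimes>\<^sub>M unit_noise) (N \<Otimes>\<^sub>M borel) (\<lambda>(y, u). (y, H (y, u)))) (N \<Otimes>\<^sub>M borel_of T) (\<lambda>x. (fst x, r (snd x)))"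
      by (subst distr_distr) (auto simp: comp_def case_prod_beta)
    also have "\<dots> = distr \<pi> (N \<Otimes>\<^sub>M borel_of T) (\<lambda>z. (g z, r (e (f z))))"
      unfolding eq by (subst distr_distr) (auto simp: comp_def)
    also have "\<dots> = distr \<pi> (N \<Otimes>\<^sub>M borel_of T) (\<lambda>z. (g z, f z))"
      using fT re by (intro distr_cong) auto
    finally show "distr (N \<Otimes>\<^sub>M unit_noise) (N \<Otimes>\<^sub>M borel_of T) (\<lambda>z. (fst z, r (H z))) =
      distr \<pi> (N \<Otimes>\<^sub>M borel_of T) (\<lambda>z. (g z, f z))" .
  qed
qed

lemma distr_fst_pair_prob:
  assumes "prob_space U"
  shows "distr (N \<Otimes>\<^sub>M U) N fst = N"
proof (rule measure_eqI)
  interpret U: prob_space U by fact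
  fix A assume A: "A \<in> sets (distr (N \<Otimes>\<^sub>M U) N fst)"
  then have "fst -` A \<inter> space (N \<Otimes>\<^sub>M U) = A \<times> space U"
    using sets.sets_into_space[of A N] by (auto simp: space_pair_measure)
  then show "emeasure (distr (N \<Otimes>\<^sub>M U) N fst) A = emeasure N A"
    using A by (simp add: emeasure_distr U.emeasure_pair_measure_Times U.emeasure_space_1)
qed simp

text \<open>\<open>M\<close> is \<open>N\<close> with two independent noise coordinates, one for
  each conditional sample. Over a point of \<open>N\<close> the two samples are thus independent,
  and each of them has the prescribed joint law with the base point.\<close>

lemma glue_measures:
  fixes \<pi> :: "'z measure" and \<pi>' :: "'w measure" and N :: "'y measure"
  assumes S: "polish_topology S" "topspace S \<noteq> {}" and T: "polish_topology T" "topspace T \<noteq> {}"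
    and N: "sigma_finite_measure N"
    and g[measurable]: "g \<in> measurable \<pi> N" "distr \<pi> N g = N" and f[measurable]: "f \<in> measurable \<pi> (borel_of S)"
    and g'[measurable]: "g' \<in> measurable \<pi>' N" "distr \<pi>' N g' = N" and f'[measurable]: "f' \<in> measurable \<pi>' (borel_of T)"
  obtains M :: "(('y \<times> real) \<times> real) measure" and h G G'
  where "sigma_finite_measure M" "h \<in> measurable M N" "distr M N h = N"
    "G \<in> measurable M (borel_of S)" "G' \<in> measurable M (borel_of T)"
    "distr M (N \<Otimes>\<^sub>M borel_of S) (\<lambda>m. (h m, G m)) = distr \<pi> (N \<Otimes>\<^sub>M borel_of S) (\<lambda>z. (g z, f z))"
    "distr M (N \<Otimes>\<^sub>M borel_of T) (\<lambda>m. (h m, G' m)) = distr \<pi>' (N \<Otimes>\<^sub>M borel_of T) (\<lambda>z. (g' z, f' z))"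
proof -
  interpret N: sigma_finite_measure N by fact
  interpret U: prob_space unit_noise by (rule prob_space_unit_noise)
  interpret NU: pair_sigma_finite N unit_noise ..
  interpret NUU: pair_sigma_finite "N \<Otimes>\<^sub>M unit_noise" unit_noise ..
  obtain G where G[measurable]: "G \<in> measurable (N \<Otimes>\<^sub>M unit_noise) (borel_of S)"
    and eqG: "distr (N \<Otimes>\<^sub>M unit_noise) (N \<Otimes>\<^sub>M borel_of S) (\<lambda>z. (fst z, G z)) =
     distr \<pi> (N \<Otimes>\<^sub>M borel_of S) (\<lambda>z. (g z, f z))"
    using disintegration[OF S N g f] by blast
  obtain G' where G'[measurable]: "G' \<in> measurable (N \<Otimes>\<^sub>M unit_noise) (borel_of T)"
    and eqG': "distr (N \<Otimes>\<^sub>M unit_noise) (N \<Otimes>\<^sub>M borel_of T) (\<lambda>z. (fst z, G' z)) =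
     distr \<pi>' (N \<Otimes>\<^sub>M borel_of T) (\<lambda>z. (g' z, f' z))"
    using disintegration[OF T N g' f'] by blast
  let ?M = "(N \<Otimes>\<^sub>M unit_noise) \<Otimes>\<^sub>M unit_noise"
  have 1: "distr ?M (N \<Otimes>\<^sub>M unit_noise) fst = N \<Otimes>\<^sub>M unit_noise"
    by (rule distr_fst_pair_prob) (rule prob_space_unit_noise)
  have N1: "distr (N \<Otimes>\<^sub>M unit_noise) N fst = N"
    by (rule distr_fst_pair_prob) (rule prob_space_unit_noise)
  \<comment> \<open>Forgetting the first noise leaves the base point with the second noise, again of
    law \<open>N\<close> times noise; the second sample is driven by this pair.\<close>
  have 2: "distr ?M (N \<Otimes>\<^sub>M unit_noise) (\<lambda>(x, v). (fst x, v)) = N \<Otimes>\<^sub>M unit_noise"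
  proof -
    have "distr (N \<Otimes>\<^sub>M unit_noise) N fst \<Otimes>\<^sub>M distr unit_noise unit_noise (\<lambda>v. v) =
      distr ?M (N \<Otimes>\<^sub>M unit_noise) (\<lambda>(x, v). (fst x, v))"
      by (intro pair_measure_distr) (auto simp: distr_id2 U.sigma_finite_measure_axioms)
    then show ?thesis by (simp add: N1 distr_id2)
  qed
  show thesis
  proof
    show "sigma_finite_measure ?M" by (rule NUU.P.sigma_finite_measure_axioms)
    show "(\<lambda>m. fst (fst m)) \<in> measurable ?M N" by measurable
    have "distr ?M N (\<lambda>m. fst (fst m)) = distr (distr ?M (N \<Otimes>\<^sub>M unit_noise) fst) N fst"
      by (subst distr_distr) (auto simp: comp_def)
    then show "distr ?M N (\<lambda>m. fst (fst m)) = N" by (simp add: 1 N1)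
    show "(\<lambda>m. G (fst m)) \<in> measurable ?M (borel_of S)" by measurable
    show "(\<lambda>m. G' (fst (fst m), snd m)) \<in> measurable ?M (borel_of T)" by measurable
    have "distr ?M (N \<Otimes>\<^sub>M borel_of S) (\<lambda>m. (fst (fst m), G (fst m))) =
      distr (distr ?M (N \<Otimes>\<^sub>M unit_noise) fst) (N \<Otimes>\<^sub>M borel_of S) (\<lambda>z. (fst z, G z))"
      by (subst distr_distr) (auto simp: comp_def)
    then show "distr ?M (N \<Otimes>\<^sub>M borel_of S) (\<lambda>m. (fst (fst m), G (fst m))) =
      distr \<pi> (N \<Otimes>\<^sub>M borel_of S) (\<lambda>z. (g z, f z))" by (simp add: 1 eqG)
    have "distr ?M (N \<Otimes>\<^sub>M borel_of T) (\<lambda>m. (fst (fst m), G' (fst (fst m), snd m))) =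
      distr (distr ?M (N \<Otimes>\<^sub>M unit_noise) (\<lambda>(x, v). (fst x, v))) (N \<Otimes>\<^sub>M borel_of T) (\<lambda>z. (fst z, G' z))"
      by (subst distr_distr) (auto simp: comp_def case_prod_beta)
    then show "distr ?M (N \<Otimes>\<^sub>M borel_of T) (\<lambda>m. (fst (fst m), G' (fst (fst m), snd m))) =
      distr \<pi>' (N \<Otimes>\<^sub>M borel_of T) (\<lambda>z. (g' z, f' z))" by (simp add: 2 eqG')
  qed
qed

text \<open>Serves to assemble one edge measure from pieces lying over true and over virtual
  points.\<close>

definition plus_measure :: "'a measure \<Rightarrow> 'a measure \<Rightarrow> 'a measure" where
  "plus_measure M N = measure_of (space M) (sets M) (\<lambda>A. emeasure M A + emeasure N A)"

lemma sets_plus_measure [simp, measurable_cong]: "sets (plus_measure M N) = sets M"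
  and space_plus_measure [simp]: "space (plus_measure M N) = space M"
  by (simp_all add: plus_measure_def)

lemma emeasure_plus_measure:
  assumes "sets N = sets M" "A \<in> sets M"
  shows "emeasure (plus_measure M N) A = emeasure M A + emeasure N A"
  unfolding plus_measure_def
proof (rule emeasure_measure_of_sigma)
  show "countably_additive (sets M) (\<lambda>A. emeasure M A + emeasure N A)"
  proof (rule countably_additiveI)
    fix A :: "nat \<Rightarrow> 'a set" assume A: "range A \<subseteq> sets M" "disjoint_family A"
    then show "(\<Sum>i. emeasure M (A i) + emeasure N (A i)) = emeasure M (\<Union> (range A)) + emeasure N (\<Union> (range A))"
      using assms by (simp add: suminf_add[symmetric] suminf_emeasure)
  qed
qed (use assms in \<open>auto simp: positive_def sets.sigma_algebra_axioms\<close>)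

section \<open>Minkowski's inequality and the geometry of the half plane\<close>

text \<open>Convexity of the \<open>p\<close>-th power at the points \<open>a / \<alpha>\<close> and
  \<open>b / \<beta>\<close> with weights \<open>\<alpha> / (\<alpha> + \<beta>)\<close> and
  \<open>\<beta> / (\<alpha> + \<beta>)\<close>. For fixed \<open>\<alpha>\<close> and
  \<open>\<beta>\<close> the bound is linear in the two powers and hence can be integrated.\<close>

lemma powr_add_le_convex:
  fixes a b \<alpha> \<beta> p :: real
  assumes "p \<ge> 1" "a \<ge> 0" "b \<ge> 0" "\<alpha> > 0" "\<beta> > 0"
  shows "(a + b) powr p \<le> (\<alpha> + \<beta>) powr (p - 1) * (\<alpha> powr (1 - p) * a powr p + \<beta> powr (1 - p) * b powr p)"
proof -
  have scale: "b powr p \<le> (\<alpha> + \<beta>) powr (p - 1) * (\<beta> powr (1 - p) * b powr p)"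
    if "\<alpha> > 0" "\<beta> > 0" for \<alpha> \<beta> b :: real
  proof -
    have "1 = \<beta> powr (p - 1) * \<beta> powr (1 - p)"
      using that by (simp add: powr_add[symmetric])
    also have "\<dots> \<le> (\<alpha> + \<beta>) powr (p - 1) * \<beta> powr (1 - p)"
      using that assms by (intro mult_right_mono powr_mono2) auto
    finally have "1 * b powr p \<le> (\<alpha> + \<beta>) powr (p - 1) * \<beta> powr (1 - p) * b powr p"
      by (intro mult_right_mono) auto
    then show ?thesis by (simp add: mult.assoc)
  qed
  consider "a = 0" | "b = 0" | "a > 0" "b > 0" using assms by linarith
  then show ?thesis
  proof cases
    case 1
    then show ?thesis using scale[of \<alpha> \<beta> b] assms by simp
  next
    case 2
    then show ?thesis using scale[of \<beta> \<alpha> a] assms by (simp add: add.commute)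
  next
    case 3
    define s where "s = \<alpha> + \<beta>"
    have s: "s > 0" using assms by (simp add: s_def)
    have w: "\<alpha> / s + \<beta> / s = 1" using s by (simp add: s_def add_divide_distrib[symmetric])
    have "((1 - \<beta> / s) *\<^sub>R (a / \<alpha>) + (\<beta> / s) *\<^sub>R (b / \<beta>)) powr p
        \<le> (1 - \<beta> / s) * (a / \<alpha>) powr p + (\<beta> / s) * (b / \<beta>) powr p"
      using 3 assms s by (intro convex_onD[OF powr_convex]) (auto simp: s_def)
    also have "1 - \<beta> / s = \<alpha> / s" using w by simp
    also have "(\<alpha> / s) *\<^sub>R (a / \<alpha>) + (\<beta> / s) *\<^sub>R (b / \<beta>) = (a + b) / s"
      using assms by (simp add: add_divide_distrib)
    finally have "s powr p * ((a + b) / s) powr p \<le> s powr p * ((\<alpha> / s) * (a / \<alpha>) powr p + (\<beta> / s) * (b / \<beta>) powr p)"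
      by (intro mult_left_mono) auto
    moreover have "s powr p * ((a + b) / s) powr p = (a + b) powr p"
      using 3 s by (simp add: powr_mult[symmetric])
    moreover have "s powr p * ((\<alpha> / s) * (a / \<alpha>) powr p + (\<beta> / s) * (b / \<beta>) powr p) =
        s powr (p - 1) * (\<alpha> powr (1 - p) * a powr p + \<beta> powr (1 - p) * b powr p)"
      using 3 s assms by (simp add: powr_divide powr_diff field_simps)
    ultimately show ?thesis by (simp add: s_def)
  qed
qed

text \<open>The weights are left free on purpose: one choice has to serve several integrals over
  different measure spaces, whose bounds are added before optimising.\<close>

lemma nn_integral_powr_add_le:
  fixes a b c :: "'x \<Rightarrow> real"
  assumes [measurable]: "a \<in> borel_measurable M" "b \<in> borel_measurable M"
    and "p \<ge> 1" "\<alpha> > 0" "\<beta> > 0"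
    and le: "AE x in M. 0 \<le> a x \<and> 0 \<le> b x \<and> 0 \<le> c x \<and> c x \<le> a x + b x"
  shows "(\<integral>\<^sup>+x. ennreal (c x powr p) \<partial>M) \<le> ennreal ((\<alpha> + \<beta>) powr (p - 1)) *
    (ennreal (\<alpha> powr (1 - p)) * (\<integral>\<^sup>+x. ennreal (a x powr p) \<partial>M) +
     ennreal (\<beta> powr (1 - p)) * (\<integral>\<^sup>+x. ennreal (b x powr p) \<partial>M))"
proof -
  have "(\<integral>\<^sup>+x. ennreal (c x powr p) \<partial>M) \<le> (\<integral>\<^sup>+x. ennreal ((\<alpha> + \<beta>) powr (p - 1)) *
    (ennreal (\<alpha> powr (1 - p)) * ennreal (a x powr p) + ennreal (\<beta> powr (1 - p)) * ennreal (b x powr p)) \<partial>M)"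
  proof (rule nn_integral_mono_AE, use le in eventually_elim)
    case (elim x)
    have "c x powr p \<le> (a x + b x) powr p"
      using elim assms by (intro powr_mono2) auto
    also have "\<dots> \<le> (\<alpha> + \<beta>) powr (p - 1) * (\<alpha> powr (1 - p) * a x powr p + \<beta> powr (1 - p) * b x powr p)"
      using elim assms by (intro powr_add_le_convex) auto
    finally show ?case
      by (simp add: ennreal_mult[symmetric] ennreal_plus[symmetric] ennreal_leI del: ennreal_plus)
  qed
  then show ?thesis
    by (simp add: nn_integral_cmult nn_integral_add)
qed

lemma ennreal_powr_ennreal: "ennreal_powr (ennreal x) r = ennreal (x powr r)" if "x \<ge> 0"
  using that by (simp add: ennreal_powr_def)

lemma ennreal_powr_eq_0: "ennreal_powr x r = 0 \<longleftrightarrow> x = 0"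
  by (cases x) (auto simp: ennreal_powr_def)

lemma ennreal_powr_cmult:
  assumes "p \<ge> 1" "c \<ge> 0"
  shows "ennreal_powr (ennreal (c powr p) * x) (1 / p) = ennreal c * ennreal_powr x (1 / p)"
proof (cases x)
  case (real r)
  then show ?thesis using assms
    by (simp add: ennreal_mult[symmetric] ennreal_powr_ennreal powr_mult powr_powr)
next
  case top
  then show ?thesis using assms
    by (cases "c = 0") (auto simp: ennreal_powr_def ennreal_mult_top)
qed

text \<open>Taking the \<open>p\<close>-th roots of \<open>A\<close> and \<open>B\<close> as weights
  collapses the right-hand side to \<open>(\<alpha> + \<beta>) powr p\<close>. This recovers
  Minkowski's inequality from its linear form.\<close>

lemma ennreal_powr_triangle:
  assumes "p \<ge> 1"
    and le: "\<And>\<alpha> \<beta>. \<alpha> > 0 \<Longrightarrow> \<beta> > 0 \<Longrightarrow>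
      C \<le> ennreal ((\<alpha> + \<beta>) powr (p - 1)) * (ennreal (\<alpha> powr (1 - p)) * A + ennreal (\<beta> powr (1 - p)) * B)"
  shows "ennreal_powr C (1 / p) \<le> ennreal_powr A (1 / p) + ennreal_powr B (1 / p)"
proof (cases "A = \<infinity> \<or> B = \<infinity>")
  case True
  then show ?thesis by (auto simp: ennreal_powr_def)
next
  case False
  then obtain a b where ab: "A = ennreal a" "a \<ge> 0" "B = ennreal b" "b \<ge> 0"
    by (cases A; cases B) auto
  have bound: "C \<le> ennreal ((a powr (1 / p) + b powr (1 / p) + \<epsilon>) powr p)" if \<epsilon>: "\<epsilon> > 0" for \<epsilon>
  proof -
    \<comment> \<open>The added \<open>\<epsilon> / 2\<close> keeps the weight positive when the
      root is zero; it is removed by letting \<open>\<epsilon>\<close> vanish.\<close>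
    define \<alpha> where "\<alpha> = a powr (1 / p) + \<epsilon> / 2"
    define \<beta> where "\<beta> = b powr (1 / p) + \<epsilon> / 2"
    have pos: "\<alpha> > 0" "\<beta> > 0" using \<epsilon> by (auto simp: \<alpha>_def \<beta>_def intro: add_nonneg_pos)
    have aux: "x powr (1 - p) * y \<le> x" if "x > 0" "y \<ge> 0" "y powr (1 / p) \<le> x" for x y :: real
    proof -
      have "y = (y powr (1 / p)) powr p" using that assms by (simp add: powr_powr)
      also have "\<dots> \<le> x powr p" using that assms by (intro powr_mono2) auto
      finally have "x powr (1 - p) * y \<le> x powr (1 - p) * x powr p" by (intro mult_left_mono) auto
      also have "\<dots> = x" using that by (simp add: powr_add[symmetric])
      finally show ?thesis .
    qed
    have "C \<le> ennreal ((\<alpha> + \<beta>) powr (p - 1)) * (ennreal (\<alpha> powr (1 - p)) * A + ennreal (\<beta> powr (1 - p)) * B)"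
      by (rule le[OF pos])
    also have "\<dots> = ennreal ((\<alpha> + \<beta>) powr (p - 1) * (\<alpha> powr (1 - p) * a + \<beta> powr (1 - p) * b))"
      using ab by (simp add: ennreal_mult[symmetric] ennreal_plus[symmetric] del: ennreal_plus)
    also have "\<dots> \<le> ennreal ((\<alpha> + \<beta>) powr (p - 1) * (\<alpha> + \<beta>))"
      using aux[OF pos(1) ab(2)] aux[OF pos(2) ab(4)] \<epsilon>
      by (intro ennreal_leI mult_left_mono add_mono) (auto simp: \<alpha>_def \<beta>_def)
    also have "(\<alpha> + \<beta>) powr (p - 1) * (\<alpha> + \<beta>) = (\<alpha> + \<beta>) powr p"
      using pos by (simp add: powr_diff)
    also have "\<alpha> + \<beta> = a powr (1 / p) + b powr (1 / p) + \<epsilon>" by (simp add: \<alpha>_def \<beta>_def)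
    finally show ?thesis .
  qed
  have "C \<noteq> \<infinity>" using bound[OF zero_less_one] by (auto simp: top_unique)
  then obtain c where c: "C = ennreal c" "c \<ge> 0" by (cases C) auto
  have "c powr (1 / p) \<le> a powr (1 / p) + b powr (1 / p)"
  proof (rule field_le_epsilon)
    fix \<epsilon> :: real assume \<epsilon>: "0 < \<epsilon>"
    let ?s = "a powr (1 / p) + b powr (1 / p) + \<epsilon>"
    have "c \<le> ?s powr p" using bound[OF \<epsilon>] c by (simp add: ennreal_le_iff)
    then have "c powr (1 / p) \<le> (?s powr p) powr (1 / p)"
      using c assms by (intro powr_mono2) auto
    also have "\<dots> = ?s" using assms \<epsilon> by (simp add: powr_powr add_nonneg_nonneg)
    finally show "c powr (1 / p) \<le> ?s" .
  qed
  then show ?thesis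
    using ab c by (simp add: ennreal_powr_ennreal ennreal_plus[symmetric] ennreal_leI del: ennreal_plus)
qed

section \<open>The planar p-norm and the distance to the diagonal\<close>

lemma lp_norm_nonneg [simp]: "lp_norm p v \<ge> 0"
  by (simp add: lp_norm_def)

lemma lp_norm_powr: "p \<ge> 1 \<Longrightarrow> lp_norm p v powr p = \<bar>fst v\<bar> powr p + \<bar>snd v\<bar> powr p"
  by (simp add: lp_norm_def powr_powr)

lemma lp_norm_eq_0:
  assumes "p \<ge> 1" shows "lp_norm p v = 0 \<longleftrightarrow> v = 0"
  using assms by (auto simp: lp_norm_def prod_eq_iff add_nonneg_eq_0_iff)

lemma lp_norm_minus: "lp_norm p (- v) = lp_norm p v"
  by (simp add: lp_norm_def)

lemma lp_norm_scaleR: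
  assumes "p \<ge> 1" shows "lp_norm p (c *\<^sub>R v) = \<bar>c\<bar> * lp_norm p v"
proof -
  have "lp_norm p (c *\<^sub>R v) = (\<bar>c\<bar> powr p * (\<bar>fst v\<bar> powr p + \<bar>snd v\<bar> powr p)) powr (1 / p)"
    by (simp add: lp_norm_def abs_mult powr_mult distrib_left)
  also have "\<dots> = \<bar>c\<bar> * lp_norm p v"
    using assms by (simp add: lp_norm_def powr_mult powr_powr)
  finally show ?thesis .
qed

text \<open>The weighted convexity bound is applied to each coordinate with the two norms as
  weights; summed over the coordinates, the weighted powers add up to
  \<open>\<alpha> + \<beta>\<close>.\<close>

lemma lp_norm_triangle:
  assumes "p \<ge> 1" shows "lp_norm p (u + v) \<le> lp_norm p u + lp_norm p v"
proof (cases "u = 0 \<or> v = 0")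
  case False
  define \<alpha> \<beta> where "\<alpha> = lp_norm p u" and "\<beta> = lp_norm p v"
  have pos: "\<alpha> > 0" "\<beta> > 0"
    using False lp_norm_eq_0[OF assms, of u] lp_norm_eq_0[OF assms, of v] lp_norm_nonneg[of p u] lp_norm_nonneg[of p v]
    unfolding \<alpha>_def \<beta>_def by linarith+
  let ?B = "\<lambda>x y. (\<alpha> + \<beta>) powr (p - 1) * (\<alpha> powr (1 - p) * \<bar>x\<bar> powr p + \<beta> powr (1 - p) * \<bar>y\<bar> powr p)"
  have c: "\<bar>x + y\<bar> powr p \<le> ?B x y" for x y
  proof -
    have "\<bar>x + y\<bar> powr p \<le> (\<bar>x\<bar> + \<bar>y\<bar>) powr p"
      using assms by (intro powr_mono2) auto
    also have "\<dots> \<le> ?B x y" using pos assms by (intro powr_add_le_convex) auto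
    finally show ?thesis .
  qed
  have "lp_norm p (u + v) powr p \<le> ?B (fst u) (fst v) + ?B (snd u) (snd v)"
    using c[of "fst u" "fst v"] c[of "snd u" "snd v"] assms by (simp add: lp_norm_powr)
  also have "\<dots> = (\<alpha> + \<beta>) powr (p - 1) * (\<alpha> powr (1 - p) * \<alpha> powr p + \<beta> powr (1 - p) * \<beta> powr p)"
    unfolding \<alpha>_def \<beta>_def lp_norm_powr[OF assms] by (simp add: algebra_simps)
  also have "\<dots> = (\<alpha> + \<beta>) powr (p - 1) * (\<alpha> + \<beta>)"
    using pos by (simp add: powr_add[symmetric])
  also have "\<dots> = (\<alpha> + \<beta>) powr p"
    using pos by (simp add: powr_diff)
  finally have "(lp_norm p (u + v) powr p) powr (1 / p) \<le> ((\<alpha> + \<beta>) powr p) powr (1 / p)"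
    by (rule powr_mono2[rotated 2]) (use assms in auto)
  moreover have "(x powr p) powr (1 / p) = x" if "x \<ge> 0" for x :: real
    using assms that by (simp add: powr_powr)
  ultimately have "lp_norm p (u + v) \<le> \<alpha> + \<beta>" using pos by (metis add_nonneg_nonneg less_imp_le lp_norm_nonneg)
  then show ?thesis by (simp add: \<alpha>_def \<beta>_def)
qed auto

text \<open>\<open>w - Proj w\<close> is half of \<open>w\<close> minus its coordinate swap, and the
  swap preserves the norm.\<close>

lemma lp_norm_diff_Proj_le:
  assumes "p \<ge> 1" shows "lp_norm p (w - Proj w) \<le> lp_norm p w"
proof -
  have "w - Proj w = (1 / 2) *\<^sub>R (w + - (snd w, fst w))"
    by (auto simp: Proj_def prod_eq_iff field_simps)
  also have "lp_norm p \<dots> = lp_norm p (w + - (snd w, fst w)) / 2"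
    by (subst lp_norm_scaleR[OF assms]) simp
  also have "\<dots> \<le> (lp_norm p w + lp_norm p (- (snd w, fst w))) / 2"
    by (intro divide_right_mono lp_norm_triangle assms) simp
  also have "\<dots> = lp_norm p w"
    by (simp only: lp_norm_minus) (simp add: lp_norm_def add.commute)
  finally show ?thesis .
qed

text \<open>Subtracting a diagonal vector from \<open>l\<close> does not change
  \<open>l - Proj l\<close>, so \<open>Proj l\<close> is at least as close to \<open>l\<close> as
  the diagonal point \<open>Proj l'\<close>, for every exponent. The path through \<open>l'\<close>
  then bounds the latter distance.\<close>

lemma lp_norm_Proj_dist_le:
  assumes "p \<ge> 1"
  shows "lp_norm p (l - Proj l) \<le> lp_norm p (l - l') + lp_norm p (l' - Proj l')"
proof -
  have eq: "l - Proj l = (l - Proj l') - Proj (l - Proj l')"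
    by (auto simp: Proj_def prod_eq_iff field_simps)
  have "lp_norm p (l - Proj l) \<le> lp_norm p (l - Proj l')"
    by (subst eq) (rule lp_norm_diff_Proj_le[OF assms])
  also have "\<dots> \<le> lp_norm p (l - l') + lp_norm p (l' - Proj l')"
    using lp_norm_triangle[OF assms, of "l - l'" "l' - Proj l'"] by simp
  finally show ?thesis .
qed

lemma lp_norm_commute: "lp_norm p (u - v) = lp_norm p (v - u)"
  using lp_norm_minus[of p "u - v"] by simp

lemma lam_dist_nonneg [simp]: "lam_dist p x y \<ge> 0"
  by (cases x; cases y) auto

text \<open>Passing through the virtual point may shorten distances, so that case is excluded.\<close>

lemma lam_dist_triangle:
  assumes "p \<ge> 1" "x = None \<or> y \<noteq> None \<or> z = None"
  shows "lam_dist p x z \<le> lam_dist p x y + lam_dist p y z"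
proof -
  have tri: "lp_norm p (a - c) \<le> lp_norm p (a - b) + lp_norm p (b - c)" for a b c
    using lp_norm_triangle[OF assms(1), of "a - b" "b - c"] by simp
  have "lp_norm p (c - Proj c) \<le> lp_norm p (b - Proj b) + lp_norm p (b - c)" for b c
    using lp_norm_Proj_dist_le[OF assms(1), of c b] lp_norm_commute[of p b c] by simp
  then show ?thesis
    using assms lp_norm_Proj_dist_le[OF assms(1)] tri
    by (cases x; cases y; cases z) (auto intro: add_nonneg_nonneg)
qed

section \<open>Interpolation between points of the extended half plane\<close>

lemma Lam_convex:
  assumes "l \<in> Lam" "l' \<in> Lam" "0 \<le> t" "t \<le> 1"
  shows "(1 - t) *\<^sub>R l + t *\<^sub>R l' \<in> Lam"
proof -
  have "convex Lam"
  proof -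
    have *: "Lam = {x. (1, -1) \<bullet> x < 0} \<inter> {x. (1, 0) \<bullet> x > 0}"
      by (auto simp: Lam_def inner_prod_def)
    show ?thesis unfolding * by (intro convex_Int convex_halfspace_lt convex_halfspace_gt)
  qed
  then show ?thesis using assms by (intro convexD) auto
qed

lemma Lam_interp_Proj:
  assumes "l \<in> Lam" "0 \<le> t" "t < 1"
  shows "(1 - t) *\<^sub>R l + t *\<^sub>R Proj l \<in> Lam"
proof -
  obtain a b where l: "l = (a, b)" "0 < a" "a < b" using assms(1) by (auto simp: Lam_def)
  have 1: "((1 - t) * b + t * ((a + b) / 2)) - ((1 - t) * a + t * ((a + b) / 2)) = (1 - t) * (b - a)"
    by (simp add: algebra_simps)
  have "(1 - t) * (b - a) > 0" using l assms by simp
  moreover have "(1 - t) * a > 0" "t * ((a + b) / 2) \<ge> 0" using l assms by auto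
  ultimately show ?thesis using 1 by (auto simp: Lam_def l Proj_def)
qed

lemma lam_point_Lam: "l \<in> Lam \<Longrightarrow> lam_point l = Some l"
  by (auto simp: lam_point_def Lam_def)

lemma lam_point_Proj: "lam_point (Proj l) = None"
  by (simp add: lam_point_def Proj_def)

lemma lam_interp_Some_None:
  assumes "l \<in> Lam" "0 \<le> t" "t \<le> 1"
  shows "lam_interp t (Some l) None = (if t = 1 then None else Some ((1 - t) *\<^sub>R l + t *\<^sub>R Proj l))"
  using assms Lam_interp_Proj[of l t] by (auto simp: lam_point_Proj lam_point_Lam)

lemma lam_interp_None_Some:
  assumes "l \<in> Lam" "0 \<le> t" "t \<le> 1"
  shows "lam_interp t None (Some l) = (if t = 0 then None else Some ((1 - t) *\<^sub>R Proj l + t *\<^sub>R l))"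
  using assms Lam_interp_Proj[of l "1 - t"] by (auto simp: lam_point_Proj lam_point_Lam add.commute)

lemma lam_interp_Some_Some:
  assumes "l \<in> Lam" "l' \<in> Lam" "0 \<le> t" "t \<le> 1"
  shows "lam_interp t (Some l) (Some l') = Some ((1 - t) *\<^sub>R l + t *\<^sub>R l')"
  using Lam_convex[OF assms] by (simp add: lam_point_Lam)

lemma lam_interp_in_Lam:
  assumes "0 \<le> t" "t \<le> 1" "\<And>l. x = Some l \<Longrightarrow> l \<in> Lam" "\<And>l. y = Some l \<Longrightarrow> l \<in> Lam"
    "lam_interp t x y = Some v"
  shows "v \<in> Lam"
proof (cases x; cases y)
  fix l l' assume "x = Some l" "y = Some l'"
  then show ?thesis using assms Lam_convex lam_interp_Some_Some by (metis option.inject)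
next
  fix l assume "x = Some l" "y = None"
  then show ?thesis using assms Lam_interp_Proj[of l t] lam_interp_Some_None[of l t]
    by (auto simp del: lam_interp.simps split: if_splits)
next
  fix l assume "x = None" "y = Some l"
  then show ?thesis using assms Lam_interp_Proj[of l "1 - t"] lam_interp_None_Some[of l t]
    by (auto simp: add.commute simp del: lam_interp.simps split: if_splits)
qed (use assms in auto)

text \<open>On straight segments the norm scales with \<open>t - s\<close>. A point moving to or
  from the diagonal keeps its projection, so the same rule persists when one of the two positions
  has already been replaced by \<open>None\<close>.\<close>

lemma lam_dist_interp:
  assumes "p \<ge> 1" and x: "\<And>l. x = Some l \<Longrightarrow> l \<in> Lam" and y: "\<And>l. y = Some l \<Longrightarrow> l \<in> Lam"
    and st: "0 \<le> s" "s \<le> t" "t \<le> 1"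
  shows "lam_dist p (lam_interp s x y) (lam_interp t x y) = (t - s) * lam_dist p x y"
proof -
  have key: "lp_norm p (((1 - s) *\<^sub>R u + s *\<^sub>R v) - ((1 - t) *\<^sub>R u + t *\<^sub>R v)) = (t - s) * lp_norm p (u - v)" for u v
  proof -
    have "((1 - s) *\<^sub>R u + s *\<^sub>R v) - ((1 - t) *\<^sub>R u + t *\<^sub>R v) = (t - s) *\<^sub>R (u - v)"
      by (simp add: algebra_simps)
    then show ?thesis using st by (simp add: lp_norm_scaleR[OF assms(1)])
  qed
  have P: "Proj ((1 - t) *\<^sub>R l + t *\<^sub>R Proj l) = Proj l" "Proj ((1 - t) *\<^sub>R Proj l + t *\<^sub>R l) = Proj l" for t l
    by (auto simp: Proj_def field_simps)
  show ?thesis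
  proof (cases x; cases y)
    fix l l' assume "x = Some l" "y = Some l'"
    then show ?thesis using assms key[of l l'] by (simp add: lam_interp_Some_Some del: lam_interp.simps(1))
  next
    fix l assume *: "x = Some l" "y = None"
    have "lp_norm p ((1 - s) *\<^sub>R l + s *\<^sub>R Proj l - Proj l) = (1 - s) * lp_norm p (l - Proj l)" if "t = 1"
      using key[of l "Proj l"] that by simp
    then show ?thesis using * assms key[of l "Proj l"]
      by (simp add: lam_interp_Some_None P lp_norm_eq_0 del: lam_interp.simps(2))
  next
    fix l assume *: "x = None" "y = Some l"
    have "lp_norm p (Proj l - ((1 - t) *\<^sub>R Proj l + t *\<^sub>R l)) = t * lp_norm p (l - Proj l)" if "s = 0"
      using key[of "Proj l" l] that lp_norm_commute[of p "Proj l" l] by simp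
    then show ?thesis using * assms key[of "Proj l" l]
        lp_norm_commute[of p "Proj l" l] lp_norm_commute[of p "Proj l" "(1 - t) *\<^sub>R Proj l + t *\<^sub>R l"]
      by (simp add: lam_interp_None_Some P lp_norm_eq_0 del: lam_interp.simps(3))
  qed (use assms in auto)
qed

lemma measurable_lp_norm [measurable]: "lp_norm p \<in> borel_measurable borel"
  unfolding lp_norm_def by (simp add: borel_prod[symmetric])

lemma measurable_Proj [measurable]: "Proj \<in> borel_measurable borel"
  unfolding Proj_def by (simp add: borel_prod[symmetric])

section \<open>Measurability of network data\<close>

abbreviation vertex_borel :: "('a, 'b) network \<Rightarrow> 'a measure" where
  "vertex_borel P \<equiv> borel_of (net_X P)"

abbreviation edge_borel :: "('a, 'b) network \<Rightarrow> 'b option measure" where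
  "edge_borel P \<equiv> borel_of (add_point (net_Y P))"

lemma topological_networkD:
  assumes "topological_network P"
  shows "polish_topology (net_X P)" "polish_topology (net_Y P)" "locally_compact_space (net_Y P)"
    "sets (net_mu P) = sets (vertex_borel P)" "space (net_mu P) = topspace (net_X P)"
    "sets (net_nu P) = sets (borel_of (net_Y P))" "space (net_nu P) = topspace (net_Y P)"
    "prob_space (net_mu P)" "radon_measure_on (net_Y P) (net_nu P)" "sigma_finite_measure (net_nu P)"
    "topspace (net_X P) \<noteq> {}" "continuous_map (net_Y P) (top_of_set Lam) (net_iota P)"
    "second_countable (net_X P)" "second_countable (net_Y P)"
proof -
  show "topspace (net_X P) \<noteq> {}"
    using assms borel_measure_onD(2) prob_space.not_empty unfolding topological_network_def by metis
  show "sigma_finite_measure (net_nu P)"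
    using assms sigma_finite_radon polish_second_countable unfolding topological_network_def by blast
qed (use assms in \<open>auto simp: topological_network_def radon_measure_on_def dest: borel_measure_onD polish_second_countable\<close>)

lemma measurable_net_k:
  assumes "topological_network P"
  shows "(\<lambda>z. net_k P (fst z) (snd z)) \<in> borel_measurable (vertex_borel P \<Otimes>\<^sub>M vertex_borel P)"
proof -
  have "(\<lambda>z. net_k P (fst z) (snd z)) \<in> borel_measurable (net_mu P \<Otimes>\<^sub>M net_mu P)"
    using assms by (simp add: topological_network_def case_prod_unfold)
  also have "sets (net_mu P \<Otimes>\<^sub>M net_mu P) = sets (vertex_borel P \<Otimes>\<^sub>M vertex_borel P)"
    using topological_networkD(4)[OF assms] by (intro sets_pair_measure_cong)
  then have "borel_measurable (net_mu P \<Otimes>\<^sub>M net_mu P) = borel_measurable (vertex_borel P \<Otimes>\<^sub>M vertex_borel P)"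
    by (intro measurable_cong_sets) auto
  finally show ?thesis .
qed

lemma measurable_net_omega:
  assumes "topological_network P"
  shows "(\<lambda>z. net_omega P (fst z) (snd z)) \<in> borel_measurable (vertex_borel P \<Otimes>\<^sub>M borel_of (net_Y P))"
proof -
  have "(\<lambda>z. net_omega P (fst z) (snd z)) \<in> borel_measurable (net_mu P \<Otimes>\<^sub>M net_nu P)"
    using assms by (simp add: topological_network_def case_prod_unfold)
  also have "sets (net_mu P \<Otimes>\<^sub>M net_nu P) = sets (vertex_borel P \<Otimes>\<^sub>M borel_of (net_Y P))"
    using topological_networkD(4,6)[OF assms] by (intro sets_pair_measure_cong)
  then have "borel_measurable (net_mu P \<Otimes>\<^sub>M net_nu P) = borel_measurable (vertex_borel P \<Otimes>\<^sub>M borel_of (net_Y P))"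
    by (intro measurable_cong_sets) auto
  finally show ?thesis .
qed

lemma measurable_ext_omega:
  assumes P: "topological_network P"
  shows "(\<lambda>z. ext_omega P (fst z) (snd z)) \<in> borel_measurable (vertex_borel P \<Otimes>\<^sub>M edge_borel P)"
proof (cases "topspace (net_Y P) = {}")
  case True
  then have "ext_omega P (fst z) (snd z) = 0" if "z \<in> space (vertex_borel P \<Otimes>\<^sub>M edge_borel P)" for z
    using that by (auto simp: space_pair_measure topspace_add_point)
  then show ?thesis by (subst measurable_cong) auto
next
  case False
  \<comment> \<open>A filler for the virtual point: \<open>net_omega\<close> is evaluated only at
    true edges, and the case distinction discards the value at the filler.\<close>
  then obtain y0 where y0: "y0 \<in> topspace (net_Y P)" by blast
  have [measurable]: "case_option y0 (\<lambda>y. y) \<in> measurable (edge_borel P) (borel_of (net_Y P))"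
    using y0 by (intro measurable_case_option_add_point) auto
  have [measurable]: "Measurable.pred (edge_borel P) (\<lambda>y. y = None)"
  proof -
    have "{y \<in> space (edge_borel P). y = None} = {None}" by (auto simp: topspace_add_point)
    then show ?thesis using None_in_sets by (simp add: pred_def)
  qed
  note [measurable] = measurable_compose[OF measurable_Pair measurable_net_omega[OF P], of _ _ _, simplified]
  have "(\<lambda>z. if snd z = None then 0 else net_omega P (fst z) (case_option y0 (\<lambda>y. y) (snd z)))
      \<in> borel_measurable (vertex_borel P \<Otimes>\<^sub>M edge_borel P)"
    by measurable
  also have "(\<lambda>z. if snd z = None then 0 else net_omega P (fst z) (case_option y0 (\<lambda>y. y) (snd z))) =
      (\<lambda>z. ext_omega P (fst z) (snd z))"
    by (auto simp: fun_eq_iff split: option.splits)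
  finally show ?thesis .
qed

lemma measurable_net_iota:
  assumes "topological_network P"
  shows "net_iota P \<in> borel_measurable (borel_of (net_Y P))"
proof -
  have "continuous_map (net_Y P) euclidean (net_iota P)"
    using topological_networkD(12)[OF assms] continuous_map_into_fulltopology by blast
  then have "net_iota P \<in> measurable (borel_of (net_Y P)) (borel_of euclidean)"
    by (rule continuous_map_measurable)
  then show ?thesis using measurable_cong_sets[OF refl sets_borel_of_euclidean] by blast
qed

lemma net_iota_Lam:
  assumes "topological_network P" "y \<in> topspace (net_Y P)"
  shows "net_iota P y \<in> Lam"
  using topological_networkD(12)[OF assms(1)] assms(2) by (auto simp: continuous_map_def)

lemma ext_iota_Lam:
  assumes "topological_network P" "y \<in> topspace (add_point (net_Y P))" "ext_iota P y = Some l"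
  shows "l \<in> Lam"
  using assms net_iota_Lam by (auto simp: ext_iota_def topspace_add_point)

lemma pred_None [measurable]: "Measurable.pred (borel_of (add_point T)) (\<lambda>y. y = None)"
proof -
  have "{y \<in> space (borel_of (add_point T)). y = None} = {None}" by (auto simp: topspace_add_point)
  then show ?thesis using None_in_sets by (simp add: pred_def)
qed

lemma measurable_lam_dist:
  assumes P: "topological_network P" and P': "topological_network P'"
  shows "(\<lambda>z. lam_dist p (ext_iota P (fst z)) (ext_iota P' (snd z))) \<in> borel_measurable (edge_borel P \<Otimes>\<^sub>M edge_borel P')"
proof -
  let ?i = "case_option (0, 0) (net_iota P)" and ?j = "case_option (0, 0) (net_iota P')"
  have [measurable]: "?i \<in> borel_measurable (edge_borel P)"
    by (intro measurable_case_option_add_point measurable_net_iota P) auto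
  have [measurable]: "?j \<in> borel_measurable (edge_borel P')"
    by (intro measurable_case_option_add_point measurable_net_iota P') auto
  have "(\<lambda>z. if fst z = None then if snd z = None then 0 else lp_norm p (?j (snd z) - Proj (?j (snd z)))
      else if snd z = None then lp_norm p (?i (fst z) - Proj (?i (fst z))) else lp_norm p (?i (fst z) - ?j (snd z)))
      \<in> borel_measurable (edge_borel P \<Otimes>\<^sub>M edge_borel P')"
    by measurable
  also have "(\<lambda>z. if fst z = None then if snd z = None then 0 else lp_norm p (?j (snd z) - Proj (?j (snd z)))
      else if snd z = None then lp_norm p (?i (fst z) - Proj (?i (fst z))) else lp_norm p (?i (fst z) - ?j (snd z))) =
      (\<lambda>z. lam_dist p (ext_iota P (fst z)) (ext_iota P' (snd z)))"
    by (auto simp: fun_eq_iff ext_iota_def split: option.splits)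
  finally show ?thesis .
qed

section \<open>Parametrised couplings\<close>

text \<open>Couplings of several networks are handled through maps from common measure spaces \<open>M\<close>
  (vertices) and \<open>N\<close> (edges); \<open>N\<close> may put arbitrary mass on the virtual points.\<close>

definition parametrizes :: "('a, 'b) network \<Rightarrow> 'm measure \<Rightarrow> 'n measure \<Rightarrow> ('m \<Rightarrow> 'a) \<Rightarrow> ('n \<Rightarrow> 'b option) \<Rightarrow> bool" where
  "parametrizes P M N f F \<longleftrightarrow> prob_space M \<and> sigma_finite_measure N \<and>
     f \<in> measurable M (vertex_borel P) \<and> distr M (vertex_borel P) f = net_mu P \<and>
     F \<in> measurable N (edge_borel P) \<and>
     (\<forall>A\<in>sets (borel_of (net_Y P)). emeasure N (F -` (Some ` A) \<inter> space N) = emeasure (net_nu P) A)"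

definition dist_cost :: "real \<Rightarrow> ('a, 'b) network \<Rightarrow> ('c, 'd) network \<Rightarrow> 'n measure \<Rightarrow>
    ('n \<Rightarrow> 'b option) \<Rightarrow> ('n \<Rightarrow> 'd option) \<Rightarrow> ennreal" where
  "dist_cost p P P' N F G = (\<integral>\<^sup>+z. ennreal (lam_dist p (ext_iota P (F z)) (ext_iota P' (G z)) powr p) \<partial>N)"

definition k_cost :: "real \<Rightarrow> ('a, 'b) network \<Rightarrow> ('c, 'd) network \<Rightarrow> 'm measure \<Rightarrow> ('m \<Rightarrow> 'a) \<Rightarrow> ('m \<Rightarrow> 'c) \<Rightarrow> ennreal" where
  "k_cost p P P' M f g =
    (\<integral>\<^sup>+z. ennreal (\<bar>net_k P (f (fst z)) (f (snd z)) - net_k P' (g (fst z)) (g (snd z))\<bar> powr p) \<partial>(M \<Otimes>\<^sub>M M))"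

definition omega_cost :: "real \<Rightarrow> ('a, 'b) network \<Rightarrow> ('c, 'd) network \<Rightarrow> 'm measure \<Rightarrow> 'n measure \<Rightarrow>
    ('m \<Rightarrow> 'a) \<Rightarrow> ('m \<Rightarrow> 'c) \<Rightarrow> ('n \<Rightarrow> 'b option) \<Rightarrow> ('n \<Rightarrow> 'd option) \<Rightarrow> ennreal" where
  "omega_cost p P P' M N f g F G =
    (\<integral>\<^sup>+z. ennreal (\<bar>ext_omega P (f (fst z)) (F (snd z)) - ext_omega P' (g (fst z)) (G (snd z))\<bar> powr p) \<partial>(M \<Otimes>\<^sub>M N))"

definition total_cost :: "real \<Rightarrow> ('a, 'b) network \<Rightarrow> ('c, 'd) network \<Rightarrow> 'm measure \<Rightarrow> 'n measure \<Rightarrow>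
    ('m \<Rightarrow> 'a) \<Rightarrow> ('m \<Rightarrow> 'c) \<Rightarrow> ('n \<Rightarrow> 'b option) \<Rightarrow> ('n \<Rightarrow> 'd option) \<Rightarrow> ennreal" where
  "total_cost p P P' M N f g F G =
     dist_cost p P P' N F G + k_cost p P P' M f g + omega_cost p P P' M N f g F G"

text \<open>A pair of couplings is regarded as parametrised by its own coordinate
  projections.\<close>

lemma TpOT_cost_eq_total_cost:
  "TpOT_cost p P P' \<pi>v \<pi>e = ennreal_powr (total_cost p P P' \<pi>v \<pi>e fst snd fst snd) (1 / p)"
  by (simp add: TpOT_cost_def total_cost_def dist_cost_def k_cost_def omega_cost_def case_prod_unfold)

lemma measurable_dist_integrand:
  assumes "topological_network P" "topological_network P'"
    and [measurable]: "F \<in> measurable N (edge_borel P)" "G \<in> measurable N (edge_borel P')"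
  shows "(\<lambda>z. lam_dist p (ext_iota P (F z)) (ext_iota P' (G z))) \<in> borel_measurable N"
  using measurable_compose[OF measurable_Pair[OF assms(3,4)] measurable_lam_dist[OF assms(1,2)]] by simp

lemma measurable_k_integrand:
  assumes "topological_network P" "topological_network P'"
    and [measurable]: "f \<in> measurable M (vertex_borel P)" "g \<in> measurable M (vertex_borel P')"
  shows "(\<lambda>z. \<bar>net_k P (f (fst z)) (f (snd z)) - net_k P' (g (fst z)) (g (snd z))\<bar>) \<in> borel_measurable (M \<Otimes>\<^sub>M M)"
proof -
  have "(\<lambda>z. (f (fst z), f (snd z))) \<in> measurable (M \<Otimes>\<^sub>M M) (vertex_borel P \<Otimes>\<^sub>M vertex_borel P)"
    "(\<lambda>z. (g (fst z), g (snd z))) \<in> measurable (M \<Otimes>\<^sub>M M) (vertex_borel P' \<Otimes>\<^sub>M vertex_borel P')"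
    by measurable
  from measurable_compose[OF this(1) measurable_net_k[OF assms(1)]] measurable_compose[OF this(2) measurable_net_k[OF assms(2)]]
  show ?thesis by simp
qed

lemma measurable_omega_integrand:
  assumes "topological_network P" "topological_network P'"
    and [measurable]: "f \<in> measurable M (vertex_borel P)" "g \<in> measurable M (vertex_borel P')"
      "F \<in> measurable N (edge_borel P)" "G \<in> measurable N (edge_borel P')"
  shows "(\<lambda>z. \<bar>ext_omega P (f (fst z)) (F (snd z)) - ext_omega P' (g (fst z)) (G (snd z))\<bar>) \<in> borel_measurable (M \<Otimes>\<^sub>M N)"
proof -
  have "(\<lambda>z. (f (fst z), F (snd z))) \<in> measurable (M \<Otimes>\<^sub>M N) (vertex_borel P \<Otimes>\<^sub>M edge_borel P)"
    "(\<lambda>z. (g (fst z), G (snd z))) \<in> measurable (M \<Otimes>\<^sub>M N) (vertex_borel P' \<Otimes>\<^sub>M edge_borel P')"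
    by measurable
  from measurable_compose[OF this(1) measurable_ext_omega[OF assms(1)]] measurable_compose[OF this(2) measurable_ext_omega[OF assms(2)]]
  show ?thesis by simp
qed

text \<open>All three terms admit the same pair of weights, so their bounds add up to the linear
  form of Minkowski's inequality. The almost everywhere condition forbids two true points matched
  through a virtual point of \<open>P2\<close>, the one configuration where \<open>lam_dist\<close>
  may violate the triangle inequality.\<close>

lemma total_cost_triangle:
  assumes p: "p \<ge> 1" and P: "topological_network P1" "topological_network P2" "topological_network P3"
    and f: "parametrizes P1 M N f1 F1" "parametrizes P2 M N f2 F2" "parametrizes P3 M N f3 F3"
    and AE: "AE z in N. F1 z = None \<or> F2 z \<noteq> None \<or> F3 z = None"
  shows "ennreal_powr (total_cost p P1 P3 M N f1 f3 F1 F3) (1 / p) \<le>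
    ennreal_powr (total_cost p P1 P2 M N f1 f2 F1 F2) (1 / p) + ennreal_powr (total_cost p P2 P3 M N f2 f3 F2 F3) (1 / p)"
proof (rule ennreal_powr_triangle[OF p])
  fix \<alpha> \<beta> :: real assume pos: "\<alpha> > 0" "\<beta> > 0"
  let ?c = "ennreal ((\<alpha> + \<beta>) powr (p - 1))" and ?a = "ennreal (\<alpha> powr (1 - p))" and ?b = "ennreal (\<beta> powr (1 - p))"
  have m: "f1 \<in> measurable M (vertex_borel P1)" "f2 \<in> measurable M (vertex_borel P2)" "f3 \<in> measurable M (vertex_borel P3)"
    "F1 \<in> measurable N (edge_borel P1)" "F2 \<in> measurable N (edge_borel P2)" "F3 \<in> measurable N (edge_borel P3)"
    using f by (auto simp: parametrizes_def)
  have "AE z in N. 0 \<le> lam_dist p (ext_iota P1 (F1 z)) (ext_iota P2 (F2 z)) \<and> 0 \<le> lam_dist p (ext_iota P2 (F2 z)) (ext_iota P3 (F3 z))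
      \<and> 0 \<le> lam_dist p (ext_iota P1 (F1 z)) (ext_iota P3 (F3 z)) \<and> lam_dist p (ext_iota P1 (F1 z)) (ext_iota P3 (F3 z)) \<le>
      lam_dist p (ext_iota P1 (F1 z)) (ext_iota P2 (F2 z)) + lam_dist p (ext_iota P2 (F2 z)) (ext_iota P3 (F3 z))"
    using AE by eventually_elim (use p in \<open>auto intro!: lam_dist_triangle simp: ext_iota_def\<close>)
  then have 1: "dist_cost p P1 P3 N F1 F3 \<le> ?c * (?a * dist_cost p P1 P2 N F1 F2 + ?b * dist_cost p P2 P3 N F2 F3)"
    unfolding dist_cost_def
    by (intro nn_integral_powr_add_le measurable_dist_integrand P m p pos)
  have 2: "k_cost p P1 P3 M f1 f3 \<le> ?c * (?a * k_cost p P1 P2 M f1 f2 + ?b * k_cost p P2 P3 M f2 f3)"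
    unfolding k_cost_def
    by (intro nn_integral_powr_add_le measurable_k_integrand P m p pos AE_I2) auto
  have 3: "omega_cost p P1 P3 M N f1 f3 F1 F3 \<le> ?c * (?a * omega_cost p P1 P2 M N f1 f2 F1 F2 + ?b * omega_cost p P2 P3 M N f2 f3 F2 F3)"
    unfolding omega_cost_def
    by (intro nn_integral_powr_add_le measurable_omega_integrand P m p pos AE_I2) auto
  have "total_cost p P1 P3 M N f1 f3 F1 F3 \<le>
    ?c * (?a * dist_cost p P1 P2 N F1 F2 + ?b * dist_cost p P2 P3 N F2 F3) +
    ?c * (?a * k_cost p P1 P2 M f1 f2 + ?b * k_cost p P2 P3 M f2 f3) +
    ?c * (?a * omega_cost p P1 P2 M N f1 f2 F1 F2 + ?b * omega_cost p P2 P3 M N f2 f3 F2 F3)"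
    unfolding total_cost_def by (intro add_mono 1 2 3)
  also have "\<dots> = ?c * (?a * total_cost p P1 P2 M N f1 f2 F1 F2 + ?b * total_cost p P2 P3 M N f2 f3 F2 F3)"
    unfolding total_cost_def by (simp add: distrib_left ac_simps)
  finally show "total_cost p P1 P3 M N f1 f3 F1 F3 \<le>
    ?c * (?a * total_cost p P1 P2 M N f1 f2 F1 F2 + ?b * total_cost p P2 P3 M N f2 f3 F2 F3)" .
qed

text \<open>\<open>N\<close> induces \<open>\<pi>\<close> up to mass at the pair of virtual points, where every cost vanishes.\<close>

definition induces_off_virtual :: "('a, 'b) network \<Rightarrow> ('c, 'd) network \<Rightarrow> 'n measure \<Rightarrow>
    ('n \<Rightarrow> 'b option) \<Rightarrow> ('n \<Rightarrow> 'd option) \<Rightarrow> ('b option \<times> 'd option) measure \<Rightarrow> bool" where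
  "induces_off_virtual P P' N F G \<pi> \<longleftrightarrow>
    F \<in> measurable N (edge_borel P) \<and> G \<in> measurable N (edge_borel P') \<and>
    sets \<pi> = sets (edge_borel P \<Otimes>\<^sub>M edge_borel P') \<and>
    (\<forall>A\<in>sets (edge_borel P \<Otimes>\<^sub>M edge_borel P'). (None, None) \<notin> A \<longrightarrow>
      emeasure N ((\<lambda>z. (F z, G z)) -` A \<inter> space N) = emeasure \<pi> A)"

lemma sets_virtual_pair:
  "{(None, None)} \<in> sets (edge_borel P \<Otimes>\<^sub>M edge_borel P')"
  by (intro sets_Pair None_in_sets)

text \<open>Away from the pair of virtual points the image of \<open>N\<close> and
  \<open>\<pi>\<close> are the same measure. Mass on that pair, possibly infinite, is invisible to
  an integrand vanishing there.\<close>

lemma nn_integral_induces_off_virtual: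
  assumes "induces_off_virtual P P' N F G \<pi>"
    and h: "h \<in> borel_measurable (edge_borel P \<Otimes>\<^sub>M edge_borel P')" "h (None, None) = 0"
  shows "(\<integral>\<^sup>+z. h (F z, G z) \<partial>N) = (\<integral>\<^sup>+w. h w \<partial>\<pi>)"
proof -
  let ?K = "edge_borel P \<Otimes>\<^sub>M edge_borel P'" and ?S = "space (edge_borel P \<Otimes>\<^sub>M edge_borel P') - {(None, None)}"
  have FG[measurable]: "(\<lambda>z. (F z, G z)) \<in> measurable N ?K"
    using assms(1) by (intro measurable_Pair) (auto simp: induces_off_virtual_def)
  have S[measurable]: "?S \<in> sets ?K" using sets_virtual_pair by (intro sets.Diff sets.top)
  have s: "sets \<pi> = sets ?K" using assms(1) by (simp add: induces_off_virtual_def)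
  have ind: "emeasure N ((\<lambda>z. (F z, G z)) -` A \<inter> space N) = emeasure \<pi> A" if "A \<in> sets ?K" "(None, None) \<notin> A" for A
    using assms(1) that by (simp add: induces_off_virtual_def)
  have sp: "space \<pi> = space ?K" by (rule sets_eq_imp_space_eq[OF s])
  have h\<pi>: "h \<in> borel_measurable \<pi>" using h(1) s by (simp cong: measurable_cong_sets)
  have "density (distr N ?K (\<lambda>z. (F z, G z))) (indicator ?S) = density \<pi> (indicator ?S)"
  proof (rule measure_eqI)
    fix A assume A: "A \<in> sets (density (distr N ?K (\<lambda>z. (F z, G z))) (indicator ?S))"
    then have AK: "A \<in> sets ?K" by simp
    then have "?S \<inter> A \<in> sets ?K" using S by (intro sets.Int)
    then have "emeasure N ((\<lambda>z. (F z, G z)) -` (?S \<inter> A) \<inter> space N) = emeasure \<pi> (?S \<inter> A)"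
      by (rule ind) simp
    then show "emeasure (density (distr N ?K (\<lambda>z. (F z, G z))) (indicator ?S)) A = emeasure (density \<pi> (indicator ?S)) A"
      using AK S s \<open>?S \<inter> A \<in> sets ?K\<close> by (simp add: emeasure_restricted emeasure_distr[OF FG] del: vimage_Int)
  qed (simp add: s)
  then have "(\<integral>\<^sup>+w. h w \<partial>density (distr N ?K (\<lambda>z. (F z, G z))) (indicator ?S)) = (\<integral>\<^sup>+w. h w \<partial>density \<pi> (indicator ?S))"
    by simp
  then have "(\<integral>\<^sup>+w. indicator ?S w * h w \<partial>distr N ?K (\<lambda>z. (F z, G z))) = (\<integral>\<^sup>+w. indicator ?S w * h w \<partial>\<pi>)"
    using h(1) h\<pi> S s by (simp add: nn_integral_density)
  moreover have "(\<integral>\<^sup>+w. indicator ?S w * h w \<partial>L) = (\<integral>\<^sup>+w. h w \<partial>L)" if "space L = space ?K" for L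
    using h(2) that by (intro nn_integral_cong) (auto split: split_indicator)
  ultimately have "(\<integral>\<^sup>+w. h w \<partial>distr N ?K (\<lambda>z. (F z, G z))) = (\<integral>\<^sup>+w. h w \<partial>\<pi>)"
    using sp by simp
  then show ?thesis using h(1) by (simp add: nn_integral_distr)
qed

text \<open>The edge coupling need not be the image of \<open>N\<close>, which may have more mass on
  the pair of virtual points. In the omega term the edge variable is therefore replaced first, for a
  fixed vertex pair, and only then is the vertex variable pushed forward.\<close>

lemma total_cost_induced:
  assumes p: "p \<ge> 1" and P: "topological_network P" "topological_network P'"
    and M: "prob_space M" and N: "sigma_finite_measure N" "sigma_finite_measure \<pi>e"
    and f[measurable]: "f \<in> measurable M (vertex_borel P)" and g[measurable]: "g \<in> measurable M (vertex_borel P')"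
    and \<pi>v: "\<pi>v = distr M (vertex_borel P \<Otimes>\<^sub>M vertex_borel P') (\<lambda>m. (f m, g m))"
    and \<pi>e: "induces_off_virtual P P' N F G \<pi>e"
  shows "total_cost p P P' M N f g F G = total_cost p P P' \<pi>v \<pi>e fst snd fst snd"
proof -
  interpret M: prob_space M by fact
  interpret N: sigma_finite_measure N by fact
  interpret E: sigma_finite_measure \<pi>e by fact
  let ?V = "vertex_borel P \<Otimes>\<^sub>M vertex_borel P'" and ?K = "edge_borel P \<Otimes>\<^sub>M edge_borel P'"
  have fg[measurable]: "(\<lambda>m. (f m, g m)) \<in> measurable M ?V" by measurable
  interpret V: prob_space \<pi>v unfolding \<pi>v by (rule M.prob_space_distr) (rule fg)
  have sv: "sets \<pi>v = sets ?V" by (simp add: \<pi>v)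
  have se: "sets \<pi>e = sets ?K" and FG[measurable]: "F \<in> measurable N (edge_borel P)" "G \<in> measurable N (edge_borel P')"
    using \<pi>e by (auto simp: induces_off_virtual_def)
  have mv[measurable]: "fst \<in> measurable ?V (vertex_borel P)" "snd \<in> measurable ?V (vertex_borel P')" by measurable
  have me[measurable]: "fst \<in> measurable ?K (edge_borel P)" "snd \<in> measurable ?K (edge_borel P')" by measurable
  have "dist_cost p P P' N F G = dist_cost p P P' \<pi>e fst snd"
    unfolding dist_cost_def
    using nn_integral_induces_off_virtual[OF \<pi>e, of "\<lambda>w. ennreal (lam_dist p (ext_iota P (fst w)) (ext_iota P' (snd w)) powr p)"]
      measurable_lam_dist[OF P, of p] by (simp add: ext_iota_def)
  moreover have "k_cost p P P' M f g = k_cost p P P' \<pi>v fst snd"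
  proof -
    have "\<pi>v \<Otimes>\<^sub>M \<pi>v = distr (M \<Otimes>\<^sub>M M) (?V \<Otimes>\<^sub>M ?V) (\<lambda>(x, y). ((f x, g x), (f y, g y)))"
      unfolding \<pi>v
      by (rule pair_measure_distr[OF fg fg]) (use V.sigma_finite_measure_axioms in \<open>simp add: \<pi>v\<close>)
    then show ?thesis
      unfolding k_cost_def using measurable_k_integrand[OF P mv]
      by (simp add: nn_integral_distr case_prod_beta)
  qed
  moreover have "omega_cost p P P' M N f g F G = omega_cost p P P' \<pi>v \<pi>e fst snd fst snd"
  proof -
    let ?h = "\<lambda>v w. ennreal (\<bar>ext_omega P (fst v) (fst w) - ext_omega P' (snd v) (snd w)\<bar> powr p)"
    have h[measurable]: "(\<lambda>z. ?h (fst z) (snd z)) \<in> borel_measurable (?V \<Otimes>\<^sub>M ?K)"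
      using measurable_omega_integrand[OF P mv me] by simp
    have hE: "(\<lambda>z. ?h (fst z) (snd z)) \<in> borel_measurable (?V \<Otimes>\<^sub>M \<pi>e)"
      using h se by (simp cong: measurable_cong_sets sets_pair_measure_cong)
    have hVE: "(\<lambda>z. ?h (fst z) (snd z)) \<in> borel_measurable (\<pi>v \<Otimes>\<^sub>M \<pi>e)"
      using h se sv by (simp cong: measurable_cong_sets sets_pair_measure_cong)
    have "omega_cost p P P' M N f g F G = (\<integral>\<^sup>+m. \<integral>\<^sup>+z. ?h (f m, g m) (F z, G z) \<partial>N \<partial>M)"
      unfolding omega_cost_def using measurable_omega_integrand[OF P f g FG]
      by (subst N.nn_integral_fst[symmetric]) auto
    also have "\<dots> = (\<integral>\<^sup>+m. \<integral>\<^sup>+w. ?h (f m, g m) w \<partial>\<pi>e \<partial>M)"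
    proof (rule nn_integral_cong)
      fix m assume m: "m \<in> space M"
      have "?h (f m, g m) \<in> borel_measurable ?K"
        using measurable_compose[OF measurable_Pair1'[of "(f m, g m)" ?V ?K] h] measurable_space[OF fg m] by simp
      then show "(\<integral>\<^sup>+z. ?h (f m, g m) (F z, G z) \<partial>N) = (\<integral>\<^sup>+w. ?h (f m, g m) w \<partial>\<pi>e)"
        using nn_integral_induces_off_virtual[OF \<pi>e, of "?h (f m, g m)"] by simp
    qed
    also have "\<dots> = (\<integral>\<^sup>+v. \<integral>\<^sup>+w. ?h v w \<partial>\<pi>e \<partial>\<pi>v)"
    proof -
      have "(\<lambda>v. \<integral>\<^sup>+w. ?h v w \<partial>\<pi>e) \<in> borel_measurable ?V"
        using E.borel_measurable_nn_integral_fst[OF hE] by simp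
      then show ?thesis unfolding \<pi>v by (subst nn_integral_distr) auto
    qed
    also have "\<dots> = omega_cost p P P' \<pi>v \<pi>e fst snd fst snd"
      unfolding omega_cost_def using hVE by (subst E.nn_integral_fst[symmetric]) auto
    finally show ?thesis .
  qed
  ultimately show ?thesis by (simp add: total_cost_def)
qed

section \<open>From parametrisations to couplings and back\<close>

lemma sets_prod_vertex:
  assumes "topological_network P" "topological_network P'"
  shows "sets (borel_of (prod_topology (net_X P) (net_X P'))) = sets (vertex_borel P \<Otimes>\<^sub>M vertex_borel P')"
  using topological_networkD(13)[OF assms(1)] topological_networkD(13)[OF assms(2)] by (rule sets_borel_of_prod)

lemma second_countable_add_point:
  "polish_topology T \<Longrightarrow> second_countable (add_point T)"
  by (intro polish_second_countable polish_topology_add_point)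

lemma sets_ext_prod:
  assumes "topological_network P" "topological_network P'"
  shows "sets (borel_of (ext_prod P P')) = sets (edge_borel P \<Otimes>\<^sub>M edge_borel P')"
  unfolding ext_prod_def using topological_networkD(2)[OF assms(1)] topological_networkD(2)[OF assms(2)]
  by (intro sets_borel_of_prod second_countable_add_point)

lemma polish_ext_prod:
  assumes "topological_network P" "topological_network P'"
  shows "polish_topology (ext_prod P P')" "locally_compact_space (ext_prod P P')"
  unfolding ext_prod_def
  using topological_networkD(2,3)[OF assms(1)] topological_networkD(2,3)[OF assms(2)]
  by (auto intro: polish_topology_prod polish_topology_add_point
      simp: locally_compact_space_prod_topology locally_compact_space_add_point)

lemma couplings_distr:
  assumes P: "topological_network P" "topological_network P'"
    and M: "parametrizes P M N f F" "parametrizes P' M N g G"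
  shows "distr M (vertex_borel P \<Otimes>\<^sub>M vertex_borel P') (\<lambda>m. (f m, g m)) \<in> couplings P P'"
proof -
  let ?V = "vertex_borel P \<Otimes>\<^sub>M vertex_borel P'"
  interpret prob_space M using M by (simp add: parametrizes_def)
  have f[measurable]: "f \<in> measurable M (vertex_borel P)" and g[measurable]: "g \<in> measurable M (vertex_borel P')"
    and df: "distr M (vertex_borel P) f = net_mu P" and dg: "distr M (vertex_borel P') g = net_mu P'"
    using M by (auto simp: parametrizes_def)
  have fg[measurable]: "(\<lambda>m. (f m, g m)) \<in> measurable M ?V" by measurable
  have 1: "emeasure (distr M ?V (\<lambda>m. (f m, g m))) (A \<times> topspace (net_X P')) = emeasure (net_mu P) A"
    if "A \<in> sets (net_mu P)" for A
  proof -
    have A: "A \<in> sets (vertex_borel P)" using that topological_networkD(4)[OF P(1)] by simp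
    moreover have "A \<times> topspace (net_X P') \<in> sets ?V"
      using A sets.top[of "vertex_borel P'"] by (intro pair_measureI) auto
    moreover have "(\<lambda>m. (f m, g m)) -` (A \<times> topspace (net_X P')) \<inter> space M = f -` A \<inter> space M"
      using measurable_space[OF g] by auto
    ultimately show ?thesis by (simp add: df[symmetric] emeasure_distr del: vimage_Times)
  qed
  have 2: "emeasure (distr M ?V (\<lambda>m. (f m, g m))) (topspace (net_X P) \<times> B) = emeasure (net_mu P') B"
    if "B \<in> sets (net_mu P')" for B
  proof -
    have A: "B \<in> sets (vertex_borel P')" using that topological_networkD(4)[OF P(2)] by simp
    moreover have "topspace (net_X P) \<times> B \<in> sets ?V"
      using A sets.top[of "vertex_borel P"] by (intro pair_measureI) auto
    moreover have "(\<lambda>m. (f m, g m)) -` (topspace (net_X P) \<times> B) \<inter> space M = g -` B \<inter> space M"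
      using measurable_space[OF f] by auto
    ultimately show ?thesis by (simp add: dg[symmetric] emeasure_distr)
  qed
  have "prob_space (distr M ?V (\<lambda>m. (f m, g m)))" by (rule prob_space_distr) (rule fg)
  then show ?thesis
    unfolding couplings_def borel_measure_on_def using 1 2 sets_prod_vertex[OF P] by simp
qed

text \<open>The coupling is the image of \<open>N\<close> with the pair of virtual points deprived
  of its mass. That pair is open, and near any other point one coordinate is true, so a
  neighbourhood of finite \<open>net_nu\<close>-mass gives a strip of finite mass; local finiteness
  then yields the Radon property.\<close>

lemma adm_couplings_of_parametrization:
  assumes P: "topological_network P" "topological_network P'"
    and M: "parametrizes P M N f F" "parametrizes P' M N g G"
  obtains \<pi>e where "\<pi>e \<in> adm_couplings P P'" "sigma_finite_measure \<pi>e" "induces_off_virtual P P' N F G \<pi>e"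
proof -
  let ?K = "edge_borel P \<Otimes>\<^sub>M edge_borel P'" and ?S = "space (edge_borel P \<Otimes>\<^sub>M edge_borel P') - {(None, None)}"
  have F[measurable]: "F \<in> measurable N (edge_borel P)" and G[measurable]: "G \<in> measurable N (edge_borel P')"
    and mF: "\<And>A. A \<in> sets (borel_of (net_Y P)) \<Longrightarrow> emeasure N (F -` (Some ` A) \<inter> space N) = emeasure (net_nu P) A"
    and mG: "\<And>A. A \<in> sets (borel_of (net_Y P')) \<Longrightarrow> emeasure N (G -` (Some ` A) \<inter> space N) = emeasure (net_nu P') A"
    using M by (auto simp: parametrizes_def)
  have FG[measurable]: "(\<lambda>z. (F z, G z)) \<in> measurable N ?K" by measurable
  have S[measurable]: "?S \<in> sets ?K" using sets_virtual_pair by (intro sets.Diff sets.top)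
  define \<pi>e where "\<pi>e = density (distr N ?K (\<lambda>z. (F z, G z))) (indicator ?S)"
  have s: "sets \<pi>e = sets ?K" by (simp add: \<pi>e_def)
  have em: "emeasure \<pi>e A = emeasure N ((\<lambda>z. (F z, G z)) -` (?S \<inter> A) \<inter> space N)" if "A \<in> sets ?K" for A
  proof -
    have "?S \<inter> A \<in> sets ?K" using that S by (intro sets.Int)
    then show ?thesis unfolding \<pi>e_def using that S
      by (simp add: emeasure_restricted emeasure_distr[OF FG] del: vimage_Int)
  qed
  have ind: "induces_off_virtual P P' N F G \<pi>e"
    unfolding induces_off_virtual_def
  proof (intro conjI ballI impI F G s)
    fix A assume A: "A \<in> sets ?K" "(None, None) \<notin> A"
    then have "?S \<inter> A = A" using sets.sets_into_space by blast
    then show "emeasure N ((\<lambda>z. (F z, G z)) -` A \<inter> space N) = emeasure \<pi>e A" using em[OF A(1)] by simp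
  qed
  have null: "emeasure \<pi>e {(None, None)} = 0"
    using em[OF sets_virtual_pair] by simp
  have spK: "space ?K = topspace (add_point (net_Y P)) \<times> topspace (add_point (net_Y P'))"
    by (simp add: space_pair_measure)
  have marg1: "emeasure \<pi>e (Some ` A \<times> topspace (add_point (net_Y P'))) = emeasure (net_nu P) A"
    if A: "A \<in> sets (borel_of (net_Y P))" for A
  proof -
    have SA: "Some v \<in> topspace (add_point (net_Y P))" if "v \<in> A" for v
      using that sets.sets_into_space[OF A] by (auto simp: topspace_add_point)
    have B: "Some ` A \<times> topspace (add_point (net_Y P')) \<in> sets ?K"
      using Some_image_in_sets[OF A] sets.top[of "edge_borel P'"] by (intro pair_measureI) auto
    have "(\<lambda>z. (F z, G z)) -` (?S \<inter> (Some ` A \<times> topspace (add_point (net_Y P')))) \<inter> space N = F -` (Some ` A) \<inter> space N"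
      using SA measurable_space[OF G] by (auto simp: spK)
    then show ?thesis using em[OF B] mF[OF A] by simp
  qed
  have marg2: "emeasure \<pi>e (topspace (add_point (net_Y P)) \<times> Some ` A) = emeasure (net_nu P') A"
    if A: "A \<in> sets (borel_of (net_Y P'))" for A
  proof -
    have SA: "Some v \<in> topspace (add_point (net_Y P'))" if "v \<in> A" for v
      using that sets.sets_into_space[OF A] by (auto simp: topspace_add_point)
    have B: "topspace (add_point (net_Y P)) \<times> Some ` A \<in> sets ?K"
      using Some_image_in_sets[OF A] sets.top[of "edge_borel P"] by (intro pair_measureI) auto
    have "(\<lambda>z. (F z, G z)) -` (?S \<inter> (topspace (add_point (net_Y P)) \<times> Some ` A)) \<inter> space N = G -` (Some ` A) \<inter> space N"
      using SA measurable_space[OF F] by (auto simp: spK)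
    then show ?thesis using em[OF B] mG[OF A] by simp
  qed
  have radon: "radon_measure_on (ext_prod P P') \<pi>e"
  proof (rule radon_measure_onI[OF polish_ext_prod[OF P]])
    show "borel_measure_on (ext_prod P P') \<pi>e"
      unfolding borel_measure_on_def using s sets_ext_prod[OF P] by simp
    fix x assume x: "x \<in> topspace (ext_prod P P')"
    obtain y y' where yy: "x = (y, y')" by (cases x)
    show "\<exists>U. openin (ext_prod P P') U \<and> x \<in> U \<and> emeasure \<pi>e U < \<infinity>"
    proof -
      \<comment> \<open>At the pair of virtual points local finiteness holds because its mass was
        removed, elsewhere because of a marginal.\<close>
      consider "y = None" "y' = None" | v where "y = Some v" | v where "y' = Some v" by fastforce
      then show ?thesis
      proof cases
        case 1
        moreover have "openin (ext_prod P P') {(None, None)}"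
          using openin_prod_Times_iff[of "add_point (net_Y P)" "add_point (net_Y P')" "{None}" "{None}"]
          by (simp add: ext_prod_def openin_add_point)
        ultimately show ?thesis using null yy by (intro exI[of _ "{(None, None)}"]) simp
      next
        case v: (2 v)
        then have "v \<in> topspace (net_Y P)" using x yy by (auto simp: ext_prod_def topspace_add_point)
        then obtain U where U: "openin (net_Y P) U" "v \<in> U" "emeasure (net_nu P) U < \<infinity>"
          using topological_networkD(9)[OF P(1)] unfolding radon_measure_on_def by meson
        have "openin (add_point (net_Y P)) (Some ` U)"
          using U(1) openin_subset[OF U(1)] by (auto simp: openin_add_point inj_image_mem_iff)
        then have "openin (ext_prod P P') (Some ` U \<times> topspace (add_point (net_Y P')))"
          by (simp add: ext_prod_def openin_prod_Times_iff)
        then show ?thesis using marg1[OF openin_in_borel_of[OF U(1)]] U x yy v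
          by (intro exI[of _ "Some ` U \<times> topspace (add_point (net_Y P'))"]) (auto simp: ext_prod_def)
      next
        case v: (3 v)
        then have "v \<in> topspace (net_Y P')" using x yy by (auto simp: ext_prod_def topspace_add_point)
        then obtain U where U: "openin (net_Y P') U" "v \<in> U" "emeasure (net_nu P') U < \<infinity>"
          using topological_networkD(9)[OF P(2)] unfolding radon_measure_on_def by meson
        have "openin (add_point (net_Y P')) (Some ` U)"
          using U(1) openin_subset[OF U(1)] by (auto simp: openin_add_point inj_image_mem_iff)
        then have "openin (ext_prod P P') (topspace (add_point (net_Y P)) \<times> Some ` U)"
          by (simp add: ext_prod_def openin_prod_Times_iff)
        then show ?thesis using marg2[OF openin_in_borel_of[OF U(1)]] U x yy v
          by (intro exI[of _ "topspace (add_point (net_Y P)) \<times> Some ` U"]) (auto simp: ext_prod_def)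
      qed
    qed
  qed
  have "\<pi>e \<in> adm_couplings P P'"
    unfolding adm_couplings_def
    using radon marg1 marg2 null topological_networkD(6)[OF P(1)] topological_networkD(6)[OF P(2)] by simp
  moreover have "sigma_finite_measure \<pi>e"
    by (rule sigma_finite_radon[OF polish_second_countable[OF polish_ext_prod(1)[OF P]] radon])
  ultimately show thesis using ind by (rule that)
qed

lemma couplings_of_parametrizations:
  assumes p: "p \<ge> 1" and P: "topological_network P" "topological_network P'"
    and M: "parametrizes P M N f F" "parametrizes P' M N g G"
  obtains \<pi>v \<pi>e where "\<pi>v \<in> couplings P P'" "\<pi>e \<in> adm_couplings P P'"
    "TpOT_cost p P P' \<pi>v \<pi>e = ennreal_powr (total_cost p P P' M N f g F G) (1 / p)"
proof -
  obtain \<pi>e where e: "\<pi>e \<in> adm_couplings P P'" "sigma_finite_measure \<pi>e" "induces_off_virtual P P' N F G \<pi>e"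
    using adm_couplings_of_parametrization[OF P M] by blast
  have eq: "total_cost p P P' M N f g F G = total_cost p P P' (distr M (vertex_borel P \<Otimes>\<^sub>M vertex_borel P') (\<lambda>m. (f m, g m))) \<pi>e fst snd fst snd"
    using M by (intro total_cost_induced[OF p P _ _ e(2) _ _ refl e(3)]) (auto simp: parametrizes_def)
  show thesis
    by (rule that[OF couplings_distr[OF P M] e(1)]) (simp add: TpOT_cost_eq_total_cost eq)
qed

lemma couplingsD:
  assumes P: "topological_network P" "topological_network P'" and "\<pi>v \<in> couplings P P'"
  shows "prob_space \<pi>v" "sets \<pi>v = sets (vertex_borel P \<Otimes>\<^sub>M vertex_borel P')"
    "fst \<in> measurable \<pi>v (vertex_borel P)" "snd \<in> measurable \<pi>v (vertex_borel P')"
    "distr \<pi>v (vertex_borel P) fst = net_mu P" "distr \<pi>v (vertex_borel P') snd = net_mu P'"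
proof -
  let ?V = "vertex_borel P \<Otimes>\<^sub>M vertex_borel P'"
  show "prob_space \<pi>v" using assms by (simp add: couplings_def)
  show s: "sets \<pi>v = sets ?V"
    using assms sets_prod_vertex[OF P] by (simp add: couplings_def borel_measure_on_def)
  have sp: "space \<pi>v = topspace (net_X P) \<times> topspace (net_X P')"
    using sets_eq_imp_space_eq[OF s] by (simp add: space_pair_measure)
  show f: "fst \<in> measurable \<pi>v (vertex_borel P)" "snd \<in> measurable \<pi>v (vertex_borel P')"
    using measurable_cong_sets[OF s refl] measurable_fst measurable_snd by blast+
  show "distr \<pi>v (vertex_borel P) fst = net_mu P"
  proof (rule measure_eqI)
    fix A assume "A \<in> sets (distr \<pi>v (vertex_borel P) fst)"
    then have A: "A \<in> sets (vertex_borel P)" by simp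
    then have "fst -` A \<inter> space \<pi>v = A \<times> topspace (net_X P')"
      using sets.sets_into_space[OF A] by (auto simp: sp)
    then show "emeasure (distr \<pi>v (vertex_borel P) fst) A = emeasure (net_mu P) A"
      using A assms topological_networkD(4)[OF P(1)] by (simp add: emeasure_distr[OF f(1)] couplings_def)
  qed (use topological_networkD(4)[OF P(1)] in simp)
  show "distr \<pi>v (vertex_borel P') snd = net_mu P'"
  proof (rule measure_eqI)
    fix A assume "A \<in> sets (distr \<pi>v (vertex_borel P') snd)"
    then have A: "A \<in> sets (vertex_borel P')" by simp
    then have "snd -` A \<inter> space \<pi>v = topspace (net_X P) \<times> A"
      using sets.sets_into_space[OF A] by (auto simp: sp)
    then show "emeasure (distr \<pi>v (vertex_borel P') snd) A = emeasure (net_mu P') A"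
      using A assms topological_networkD(4)[OF P(2)] by (simp add: emeasure_distr[OF f(2)] couplings_def)
  qed (use topological_networkD(4)[OF P(2)] in simp)
qed

lemma adm_couplingsD:
  assumes P: "topological_network P" "topological_network P'" and "\<pi>e \<in> adm_couplings P P'"
  shows "sets \<pi>e = sets (edge_borel P \<Otimes>\<^sub>M edge_borel P')"
    "space \<pi>e = topspace (add_point (net_Y P)) \<times> topspace (add_point (net_Y P'))"
    "sigma_finite_measure \<pi>e"
    "fst \<in> measurable \<pi>e (edge_borel P)" "snd \<in> measurable \<pi>e (edge_borel P')"
    "\<And>A. A \<in> sets (borel_of (net_Y P)) \<Longrightarrow> emeasure \<pi>e (fst -` (Some ` A) \<inter> space \<pi>e) = emeasure (net_nu P) A"
    "\<And>A. A \<in> sets (borel_of (net_Y P')) \<Longrightarrow> emeasure \<pi>e (snd -` (Some ` A) \<inter> space \<pi>e) = emeasure (net_nu P') A"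
    "emeasure \<pi>e {(None, None)} = 0"
proof -
  let ?K = "edge_borel P \<Otimes>\<^sub>M edge_borel P'"
  show s: "sets \<pi>e = sets ?K"
    using assms sets_ext_prod[OF P] by (simp add: adm_couplings_def radon_measure_on_def borel_measure_on_def)
  show sp: "space \<pi>e = topspace (add_point (net_Y P)) \<times> topspace (add_point (net_Y P'))"
    using sets_eq_imp_space_eq[OF s] by (simp add: space_pair_measure)
  show "sigma_finite_measure \<pi>e"
    using assms(3) sigma_finite_radon[OF polish_second_countable[OF polish_ext_prod(1)[OF P]]]
    by (simp add: adm_couplings_def)
  show "fst \<in> measurable \<pi>e (edge_borel P)" "snd \<in> measurable \<pi>e (edge_borel P')"
    using measurable_cong_sets[OF s refl] measurable_fst measurable_snd by blast+
  show "emeasure \<pi>e {(None, None)} = 0" using assms(3) by (simp add: adm_couplings_def)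
  fix A
  show "emeasure \<pi>e (fst -` (Some ` A) \<inter> space \<pi>e) = emeasure (net_nu P) A" if A: "A \<in> sets (borel_of (net_Y P))"
  proof -
    have "fst -` (Some ` A) \<inter> space \<pi>e = Some ` A \<times> topspace (add_point (net_Y P'))"
      using sets.sets_into_space[OF A] by (auto simp: sp topspace_add_point)
    then show ?thesis using assms(3) A topological_networkD(6)[OF P(1)] by (simp add: adm_couplings_def)
  qed
next
  fix A
  have s: "sets \<pi>e = sets (edge_borel P \<Otimes>\<^sub>M edge_borel P')"
    using assms sets_ext_prod[OF P] by (simp add: adm_couplings_def radon_measure_on_def borel_measure_on_def)
  have sp: "space \<pi>e = topspace (add_point (net_Y P)) \<times> topspace (add_point (net_Y P'))"
    using sets_eq_imp_space_eq[OF s] by (simp add: space_pair_measure)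
  show "emeasure \<pi>e (snd -` (Some ` A) \<inter> space \<pi>e) = emeasure (net_nu P') A" if A: "A \<in> sets (borel_of (net_Y P'))"
  proof -
    have "snd -` (Some ` A) \<inter> space \<pi>e = topspace (add_point (net_Y P)) \<times> Some ` A"
      using sets.sets_into_space[OF A] by (auto simp: sp topspace_add_point)
    then show ?thesis using assms(3) A topological_networkD(6)[OF P(2)] by (simp add: adm_couplings_def)
  qed
qed

lemma parametrizes_couplings:
  assumes "topological_network P" "topological_network P'" "\<pi>v \<in> couplings P P'" "\<pi>e \<in> adm_couplings P P'"
  shows "parametrizes P \<pi>v \<pi>e fst fst" "parametrizes P' \<pi>v \<pi>e snd snd"
  using couplingsD[OF assms(1-3)] adm_couplingsD[OF assms(1,2,4)] by (auto simp: parametrizes_def)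

lemma d_TpOT_le:
  assumes "p \<ge> 1" "topological_network P" "topological_network P'"
    "parametrizes P M N f F" "parametrizes P' M N g G"
  shows "d_TpOT p P P' \<le> ennreal_powr (total_cost p P P' M N f g F G) (1 / p)"
proof -
  obtain \<pi>v \<pi>e where "\<pi>v \<in> couplings P P'" "\<pi>e \<in> adm_couplings P P'"
    "TpOT_cost p P P' \<pi>v \<pi>e = ennreal_powr (total_cost p P P' M N f g F G) (1 / p)"
    using couplings_of_parametrizations[OF assms] by blast
  then show ?thesis unfolding d_TpOT_def by (intro INF_lower2[of "(\<pi>v, \<pi>e)"]) auto
qed

section \<open>Gluing couplings of networks\<close>

lemma None_in_topspace_add_point [simp]: "None \<in> topspace (add_point T)"
  by (simp add: topspace_add_point)

lemma measurable_the_restrict: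
  "the \<in> measurable (restrict_space (borel_of (add_point T)) (- {None})) (borel_of T)"
proof (rule measurableI)
  fix A assume A: "A \<in> sets (borel_of T)"
  have "the -` A \<inter> space (restrict_space (borel_of (add_point T)) (- {None})) = Some ` A"
    using sets.sets_into_space[OF A] by (auto simp: space_restrict_space topspace_add_point)
  moreover have "Some ` A \<in> sets (restrict_space (borel_of (add_point T)) (- {None}))"
    using Some_image_in_sets[OF A] by (auto simp: sets_restrict_space)
  ultimately show "the -` A \<inter> space (restrict_space (borel_of (add_point T)) (- {None}))
      \<in> sets (restrict_space (borel_of (add_point T)) (- {None}))" by simp
qed (auto simp: space_restrict_space topspace_add_point)

text \<open>Edge couplings prescribe marginals on true points only. Restricted to the part lying
  over true points, the coordinate becomes a measure preserving map onto \<open>net_nu P\<close>,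
  the form in which gluing over a sigma-finite base applies.\<close>

lemma distr_the_restrict:
  assumes F[measurable]: "F \<in> measurable N (edge_borel P)" and P: "topological_network P"
    and mF: "\<And>A. A \<in> sets (borel_of (net_Y P)) \<Longrightarrow> emeasure N (F -` (Some ` A) \<inter> space N) = emeasure (net_nu P) A"
  defines "S \<equiv> {z \<in> space N. F z \<noteq> None}"
  shows "S \<in> sets N" "(\<lambda>z. the (F z)) \<in> measurable (restrict_space N S) (net_nu P)"
    "distr (restrict_space N S) (net_nu P) (\<lambda>z. the (F z)) = net_nu P"
proof -
  show S: "S \<in> sets N" unfolding S_def by measurable
  have "F \<in> measurable (restrict_space N S) (restrict_space (edge_borel P) (- {None}))"
    by (intro measurable_restrict_space3 F) (auto simp: S_def)
  then have "(\<lambda>z. the (F z)) \<in> measurable (restrict_space N S) (borel_of (net_Y P))"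
    using measurable_the_restrict by (rule measurable_compose)
  then show m: "(\<lambda>z. the (F z)) \<in> measurable (restrict_space N S) (net_nu P)"
    using measurable_cong_sets[OF refl topological_networkD(6)[OF P]] by blast
  show "distr (restrict_space N S) (net_nu P) (\<lambda>z. the (F z)) = net_nu P"
  proof (rule measure_eqI)
    fix A assume "A \<in> sets (distr (restrict_space N S) (net_nu P) (\<lambda>z. the (F z)))"
    then have A: "A \<in> sets (net_nu P)" by simp
    then have A': "A \<in> sets (borel_of (net_Y P))" using topological_networkD(6)[OF P] by simp
    have "(\<lambda>z. the (F z)) -` A \<inter> space (restrict_space N S) = F -` (Some ` A) \<inter> space N"
      using S by (auto simp: space_restrict_space S_def)
    then have "emeasure (distr (restrict_space N S) (net_nu P) (\<lambda>z. the (F z))) A =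
        emeasure (restrict_space N S) (F -` (Some ` A) \<inter> space N)"
      using A m by (simp add: emeasure_distr)
    also have "\<dots> = emeasure N (F -` (Some ` A) \<inter> space N)"
      using S sets.Int_space_eq2[OF S] by (intro emeasure_restrict_space) (auto simp: S_def)
    finally show "emeasure (distr (restrict_space N S) (net_nu P) (\<lambda>z. the (F z))) A = emeasure (net_nu P) A"
      using mF[OF A'] by simp
  qed simp
qed

text \<open>Conditionally independent gluing over \<open>net_mu P2\<close>; the glued measure is a
  probability because \<open>h\<close> carries it to one.\<close>

lemma glue_vertices:
  fixes P1 :: "('a, 'b) network" and P2 :: "('c, 'd) network" and P3 :: "('e, 'f) network"
  assumes P: "topological_network P1" "topological_network P2" "topological_network P3"
    and v: "\<pi> \<in> couplings P1 P2" "\<rho> \<in> couplings P2 P3"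
  obtains M :: "(('c \<times> real) \<times> real) measure" and f1 f2 f3
  where "prob_space M" "f1 \<in> measurable M (vertex_borel P1)" "f2 \<in> measurable M (vertex_borel P2)"
    "f3 \<in> measurable M (vertex_borel P3)"
    "distr M (vertex_borel P1 \<Otimes>\<^sub>M vertex_borel P2) (\<lambda>m. (f1 m, f2 m)) = \<pi>"
    "distr M (vertex_borel P2 \<Otimes>\<^sub>M vertex_borel P3) (\<lambda>m. (f2 m, f3 m)) = \<rho>"
proof -
  let ?V1 = "vertex_borel P1" and ?V2 = "vertex_borel P2" and ?V3 = "vertex_borel P3" and ?N = "net_mu P2"
  note D = couplingsD[OF P(1,2) v(1)] couplingsD[OF P(2,3) v(2)]
  have N: "sets ?N = sets ?V2" using topological_networkD(4)[OF P(2)] .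
  interpret N: prob_space ?N using topological_networkD(8)[OF P(2)] .
  have N2: "distr L ?N h = distr L ?V2 h" for L h using N by (intro distr_cong) auto
  have g: "snd \<in> measurable \<pi> ?N" "distr \<pi> ?N snd = ?N" "fst \<in> measurable \<rho> ?N" "distr \<rho> ?N fst = ?N"
    unfolding N2 measurable_cong_sets[OF refl N] by (rule D)+
  obtain M :: "(('c \<times> real) \<times> real) measure" and h G G' where M: "sigma_finite_measure M" "h \<in> measurable M ?N" "distr M ?N h = ?N"
    and G[measurable]: "G \<in> measurable M ?V1" "G' \<in> measurable M ?V3"
    and dG: "distr M (?N \<Otimes>\<^sub>M ?V1) (\<lambda>m. (h m, G m)) = distr \<pi> (?N \<Otimes>\<^sub>M ?V1) (\<lambda>z. (snd z, fst z))"
    and dG': "distr M (?N \<Otimes>\<^sub>M ?V3) (\<lambda>m. (h m, G' m)) = distr \<rho> (?N \<Otimes>\<^sub>M ?V3) (\<lambda>z. (fst z, snd z))"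
    using glue_measures[OF topological_networkD(1,11)[OF P(1)] topological_networkD(1,11)[OF P(3)]
        N.sigma_finite_measure_axioms g(1,2) D(3) g(3,4) D(10)] by blast
  have h: "h \<in> measurable M ?V2" using M(2) measurable_cong_sets[OF refl N] by blast
  have prob: "prob_space M"
  proof
    have "emeasure ?N (space ?N) = emeasure M (h -` space ?N \<inter> space M)"
      using M(2,3) by (metis emeasure_distr sets.top)
    also have "h -` space ?N \<inter> space M = space M" using measurable_space[OF M(2)] by auto
    finally show "emeasure M (space M) = 1" using N.emeasure_space_1 by simp
  qed
  show thesis
  proof (rule that[OF prob G(1) h G(2)])
    have hm[measurable]: "h \<in> measurable M ?N" by (rule M(2))
    have fs[measurable]: "fst \<in> measurable \<pi> ?V1" "snd \<in> measurable \<pi> ?N" "fst \<in> measurable \<rho> ?N" "snd \<in> measurable \<rho> ?V3"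
      using D g by auto
    have sw: "(\<lambda>x. (snd x, fst x)) \<in> measurable (?N \<Otimes>\<^sub>M ?V1) (?V1 \<Otimes>\<^sub>M ?V2)"
    proof -
      have "(\<lambda>x. (snd x, fst x)) \<in> measurable (?N \<Otimes>\<^sub>M ?V1) (?V1 \<Otimes>\<^sub>M ?N)" by measurable
      then show ?thesis using measurable_cong_sets[OF refl sets_pair_measure_cong[OF refl N]] by blast
    qed
    have "distr M (?V1 \<Otimes>\<^sub>M ?V2) (\<lambda>m. (G m, h m)) =
      distr (distr M (?N \<Otimes>\<^sub>M ?V1) (\<lambda>m. (h m, G m))) (?V1 \<Otimes>\<^sub>M ?V2) (\<lambda>x. (snd x, fst x))"
      by (subst distr_distr[OF sw]) (auto simp: comp_def)
    also have "\<dots> = distr \<pi> (?V1 \<Otimes>\<^sub>M ?V2) (\<lambda>z. z)"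
      unfolding dG by (subst distr_distr[OF sw]) (auto simp: comp_def)
    also have "\<dots> = \<pi>" using D(2) by (intro distr_id2) simp
    finally show "distr M (?V1 \<Otimes>\<^sub>M ?V2) (\<lambda>m. (G m, h m)) = \<pi>" .
    have "distr M (?V2 \<Otimes>\<^sub>M ?V3) (\<lambda>m. (h m, G' m)) = distr M (?N \<Otimes>\<^sub>M ?V3) (\<lambda>m. (h m, G' m))"
      using N by (intro distr_cong sets_pair_measure_cong) auto
    also have "\<dots> = distr \<rho> (?N \<Otimes>\<^sub>M ?V3) (\<lambda>z. z)" using dG' by simp
    also have "\<dots> = distr \<rho> (?V2 \<Otimes>\<^sub>M ?V3) (\<lambda>z. z)"
      using N by (intro distr_cong sets_pair_measure_cong) auto
    also have "\<dots> = \<rho>" using D(8) by (intro distr_id2) simp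
    finally show "distr M (?V2 \<Otimes>\<^sub>M ?V3) (\<lambda>m. (h m, G' m)) = \<rho>" .
  qed
qed

text \<open>Over true points of \<open>P2\<close> the couplings are glued by disintegration; mass sent to the virtual
  point of \<open>P2\<close> stays matched to virtual points, so that no two true points meet there.\<close>

lemma glue_edges:
  fixes P1 :: "('a, 'b) network" and P2 :: "('c, 'd) network" and P3 :: "('e, 'f) network"
  assumes P: "topological_network P1" "topological_network P2" "topological_network P3"
    and e: "\<pi> \<in> adm_couplings P1 P2" "\<rho> \<in> adm_couplings P2 P3"
  obtains N :: "('b option \<times> 'd option \<times> 'f option) measure"
  where "sigma_finite_measure N"
    "induces_off_virtual P1 P2 N fst (\<lambda>z. fst (snd z)) \<pi>"
    "induces_off_virtual P2 P3 N (\<lambda>z. fst (snd z)) (\<lambda>z. snd (snd z)) \<rho>"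
    "AE z in N. fst z = None \<or> fst (snd z) \<noteq> None \<or> snd (snd z) = None"
proof -
  let ?E1 = "edge_borel P1" and ?E2 = "edge_borel P2" and ?E3 = "edge_borel P3" and ?n = "net_nu P2"
  let ?K = "?E1 \<Otimes>\<^sub>M ?E2 \<Otimes>\<^sub>M ?E3"
  note D = adm_couplingsD[OF P(1,2) e(1)] and D' = adm_couplingsD[OF P(2,3) e(2)]
  have N2: "sets ?n = sets (borel_of (net_Y P2))" using topological_networkD(6)[OF P(2)] .
  define S where "S = {z \<in> space \<pi>. snd z \<noteq> None}"
  define S' where "S' = {z \<in> space \<rho>. fst z \<noteq> None}"
  note R = distr_the_restrict[OF D(5) P(2) D(7), folded S_def]
  note R' = distr_the_restrict[OF D'(4) P(2) D'(6), folded S'_def]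
  have fR: "fst \<in> measurable (restrict_space \<pi> S) ?E1" "snd \<in> measurable (restrict_space \<rho> S') ?E3"
    using D(4) D'(5) by (auto intro: measurable_restrict_space1)
  have pol: "polish_topology (add_point (net_Y P1))" "topspace (add_point (net_Y P1)) \<noteq> {}"
    "polish_topology (add_point (net_Y P3))" "topspace (add_point (net_Y P3)) \<noteq> {}"
    using topological_networkD(2) P by (auto intro: polish_topology_add_point simp: topspace_add_point)
  obtain M :: "(('d \<times> real) \<times> real) measure" and h G G' where M: "sigma_finite_measure M" "h \<in> measurable M ?n" "distr M ?n h = ?n"
    and G[measurable]: "G \<in> measurable M ?E1" "G' \<in> measurable M ?E3"
    and dG: "distr M (?n \<Otimes>\<^sub>M ?E1) (\<lambda>m. (h m, G m)) = distr (restrict_space \<pi> S) (?n \<Otimes>\<^sub>M ?E1) (\<lambda>z. (the (snd z), fst z))"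
    and dG': "distr M (?n \<Otimes>\<^sub>M ?E3) (\<lambda>m. (h m, G' m)) = distr (restrict_space \<rho> S') (?n \<Otimes>\<^sub>M ?E3) (\<lambda>z. (the (fst z), snd z))"
    using glue_measures[OF pol(1,2) pol(3,4) topological_networkD(10)[OF P(2)] R(2,3) fR(1) R'(2,3) fR(2)] by blast
  have "Some \<in> measurable ?n ?E2" using measurable_Some measurable_cong_sets[OF N2 refl] by blast
  then have Sm[measurable]: "(\<lambda>m. Some (h m)) \<in> measurable M ?E2" using M(2) by (rule measurable_compose[rotated])
  have [measurable]: "fst \<in> measurable \<pi> ?E1" "snd \<in> measurable \<pi> ?E2" "fst \<in> measurable \<rho> ?E2" "snd \<in> measurable \<rho> ?E3"
    using D D' by auto
  \<comment> \<open>Three kinds of triples: glued ones over a true edge of \<open>P2\<close>, and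
    the pairs of \<open>\<pi>\<close> or of \<open>\<rho>\<close> that meet the virtual point of
    \<open>P2\<close>, each completed by a virtual point on the other side.\<close>
  let ?g0 = "\<lambda>m. (G m, Some (h m), G' m)" and ?g1 = "\<lambda>z. (fst z, None, None)" and ?g2 = "\<lambda>z. (None, None, snd z)"
  have g: "?g0 \<in> measurable M ?K" "?g1 \<in> measurable \<pi> ?K" "?g2 \<in> measurable \<rho> ?K"
    by (auto intro!: measurable_Pair measurable_const simp: space_pair_measure)
  define \<pi>0 where "\<pi>0 = density \<pi> (indicator (space \<pi> - S))"
  define \<rho>0 where "\<rho>0 = density \<rho> (indicator (space \<rho> - S'))"
  have s0: "sets \<pi>0 = sets \<pi>" "sets \<rho>0 = sets \<rho>" by (simp_all add: \<pi>0_def \<rho>0_def)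
  have sp0: "space \<pi>0 = space \<pi>" "space \<rho>0 = space \<rho>" by (simp_all add: \<pi>0_def \<rho>0_def)
  have g': "?g1 \<in> measurable \<pi>0 ?K" "?g2 \<in> measurable \<rho>0 ?K"
    unfolding measurable_cong_sets[OF s0(1) refl] measurable_cong_sets[OF s0(2) refl] by (rule g)+
  define N where "N = plus_measure (distr M ?K ?g0) (plus_measure (distr \<pi>0 ?K ?g1) (distr \<rho>0 ?K ?g2))"
  have sN: "sets N = sets ?K" and spN: "space N = space ?K"
    by (simp_all add: N_def)
  have emN: "emeasure N A = emeasure M (?g0 -` A \<inter> space M) + (emeasure \<pi> ((space \<pi> - S) \<inter> (?g1 -` A)) + emeasure \<rho> ((space \<rho> - S') \<inter> (?g2 -` A)))"
    if A: "A \<in> sets ?K" for A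
  proof -
    have "emeasure N A = emeasure M (?g0 -` A \<inter> space M) + (emeasure \<pi>0 (?g1 -` A \<inter> space \<pi>) + emeasure \<rho>0 (?g2 -` A \<inter> space \<rho>))"
      unfolding N_def using A
      by (simp add: emeasure_plus_measure emeasure_distr[OF g(1)] emeasure_distr[OF g'(1)] emeasure_distr[OF g'(2)] sp0)
    moreover have "emeasure \<pi>0 (?g1 -` A \<inter> space \<pi>) = emeasure \<pi> ((space \<pi> - S) \<inter> (?g1 -` A))"
      unfolding \<pi>0_def using measurable_sets[OF g(2) A] R(1)
      by (subst emeasure_restricted) (auto intro!: arg_cong[where f = "emeasure \<pi>"])
    moreover have "emeasure \<rho>0 (?g2 -` A \<inter> space \<rho>) = emeasure \<rho> ((space \<rho> - S') \<inter> (?g2 -` A))"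
      unfolding \<rho>0_def using measurable_sets[OF g(3) A] R'(1)
      by (subst emeasure_restricted) (auto intro!: arg_cong[where f = "emeasure \<rho>"])
    ultimately show ?thesis by simp
  qed
  have F1[measurable]: "fst \<in> measurable N ?E1" and F2[measurable]: "(\<lambda>z. fst (snd z)) \<in> measurable N ?E2"
    and F3[measurable]: "(\<lambda>z. snd (snd z)) \<in> measurable N ?E3"
    unfolding measurable_cong_sets[OF sN refl] by measurable
  have i1: "induces_off_virtual P1 P2 N fst (\<lambda>z. fst (snd z)) \<pi>"
    unfolding induces_off_virtual_def
  proof (intro conjI ballI impI F1 F2 D(1))
    fix A assume A: "A \<in> sets (?E1 \<Otimes>\<^sub>M ?E2)" "(None, None) \<notin> A"
    have A\<pi>: "A \<in> sets \<pi>" using A D(1) by simp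
    have Asub: "A \<subseteq> space \<pi>" using sets.sets_into_space[OF A\<pi>] .
    have FF: "(\<lambda>z. (fst z, fst (snd z))) \<in> measurable N (?E1 \<Otimes>\<^sub>M ?E2)" by measurable
    let ?B = "(\<lambda>z. (fst z, fst (snd z))) -` A \<inter> space N"
    have B: "?B \<in> sets ?K" using measurable_sets[OF FF A(1)] sN by simp
    have 0: "emeasure M (?g0 -` ?B \<inter> space M) = emeasure \<pi> (S \<inter> A)"
    proof -
      have sw: "(\<lambda>x. (snd x, Some (fst x))) \<in> measurable (?n \<Otimes>\<^sub>M ?E1) (?E1 \<Otimes>\<^sub>M ?E2)"
        using \<open>Some \<in> measurable ?n ?E2\<close> by measurable
      let ?C = "(\<lambda>x. (snd x, Some (fst x))) -` A \<inter> space (?n \<Otimes>\<^sub>M ?E1)"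
      have C: "?C \<in> sets (?n \<Otimes>\<^sub>M ?E1)" using measurable_sets[OF sw A(1)] .
      have hG: "(\<lambda>m. (h m, G m)) \<in> measurable M (?n \<Otimes>\<^sub>M ?E1)" using M(2) G(1) by (rule measurable_Pair)
      have sG: "(\<lambda>z. (the (snd z), fst z)) \<in> measurable (restrict_space \<pi> S) (?n \<Otimes>\<^sub>M ?E1)" using R(2) fR(1) by (rule measurable_Pair)
      have "?g0 -` ?B \<inter> space M = (\<lambda>m. (h m, G m)) -` ?C \<inter> space M"
        using measurable_space[OF g(1)] measurable_space[OF hG] by (auto simp: spN)
      then have "emeasure M (?g0 -` ?B \<inter> space M) = emeasure (distr M (?n \<Otimes>\<^sub>M ?E1) (\<lambda>m. (h m, G m))) ?C"
        using C hG by (simp add: emeasure_distr)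
      also have "\<dots> = emeasure (restrict_space \<pi> S) ((\<lambda>z. (the (snd z), fst z)) -` ?C \<inter> space (restrict_space \<pi> S))"
        unfolding dG using C sG by (simp add: emeasure_distr)
      also have "(\<lambda>z. (the (snd z), fst z)) -` ?C \<inter> space (restrict_space \<pi> S) = S \<inter> A"
      proof (rule set_eqI)
        fix z show "z \<in> (\<lambda>z. (the (snd z), fst z)) -` ?C \<inter> space (restrict_space \<pi> S) \<longleftrightarrow> z \<in> S \<inter> A"
        proof (cases "z \<in> S")
          case True
          then obtain a b where z: "z = (a, Some b)" by (cases z) (auto simp: S_def)
          have "z \<in> space (restrict_space \<pi> S)" using True R(1) by simp
          then have "(the (snd z), fst z) \<in> space (?n \<Otimes>\<^sub>M ?E1)" by (rule measurable_space[OF sG])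
          then show ?thesis using True R(1) z by simp
        qed (use R(1) in simp)
      qed
      also have "emeasure (restrict_space \<pi> S) (S \<inter> A) = emeasure \<pi> (S \<inter> A)"
        using R(1) sets.Int_space_eq2[OF R(1)] by (intro emeasure_restrict_space) auto
      finally show ?thesis .
    qed
    have 1: "(space \<pi> - S) \<inter> (?g1 -` ?B) = (space \<pi> - S) \<inter> A"
    proof (rule set_eqI)
      fix z show "z \<in> (space \<pi> - S) \<inter> (?g1 -` ?B) \<longleftrightarrow> z \<in> (space \<pi> - S) \<inter> A"
      proof (cases "z \<in> space \<pi> - S")
        case True
        then obtain a where "z = (a, None)" by (cases z) (auto simp: S_def)
        moreover have "?g1 z \<in> space N" unfolding spN using True by (intro measurable_space[OF g(2)]) simp
        ultimately show ?thesis using True by simp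
      qed auto
    qed
    \<comment> \<open>Triples coming from \<open>\<rho>\<close> project to the pair of virtual
      points of \<open>P1\<close> and \<open>P2\<close>, which \<open>A\<close> excludes; this is
      the surplus mass that the weaker notion of inducing tolerates.\<close>
    have 2: "(space \<rho> - S') \<inter> (?g2 -` ?B) = {}" using A(2) by auto
    have "emeasure N ?B = emeasure \<pi> (S \<inter> A) + emeasure \<pi> ((space \<pi> - S) \<inter> A)"
      unfolding emN[OF B] 0 1 2 by simp
    also have "\<dots> = emeasure \<pi> ((S \<inter> A) \<union> ((space \<pi> - S) \<inter> A))"
      using A\<pi> R(1) by (intro plus_emeasure) auto
    also have "(S \<inter> A) \<union> ((space \<pi> - S) \<inter> A) = A" using Asub by auto
    finally show "emeasure N ?B = emeasure \<pi> A" .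
  qed
  have i2: "induces_off_virtual P2 P3 N (\<lambda>z. fst (snd z)) (\<lambda>z. snd (snd z)) \<rho>"
    unfolding induces_off_virtual_def
  proof (intro conjI ballI impI F2 F3 D'(1))
    fix A assume A: "A \<in> sets (?E2 \<Otimes>\<^sub>M ?E3)" "(None, None) \<notin> A"
    have A\<rho>: "A \<in> sets \<rho>" using A D'(1) by simp
    have Asub: "A \<subseteq> space \<rho>" using sets.sets_into_space[OF A\<rho>] .
    have FF: "(\<lambda>z. (fst (snd z), snd (snd z))) \<in> measurable N (?E2 \<Otimes>\<^sub>M ?E3)" by measurable
    let ?B = "(\<lambda>z. (fst (snd z), snd (snd z))) -` A \<inter> space N"
    have B: "?B \<in> sets ?K" using measurable_sets[OF FF A(1)] sN by simp
    have 0: "emeasure M (?g0 -` ?B \<inter> space M) = emeasure \<rho> (S' \<inter> A)"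
    proof -
      have sw: "(\<lambda>x. (Some (fst x), snd x)) \<in> measurable (?n \<Otimes>\<^sub>M ?E3) (?E2 \<Otimes>\<^sub>M ?E3)"
        using \<open>Some \<in> measurable ?n ?E2\<close> by measurable
      let ?C = "(\<lambda>x. (Some (fst x), snd x)) -` A \<inter> space (?n \<Otimes>\<^sub>M ?E3)"
      have C: "?C \<in> sets (?n \<Otimes>\<^sub>M ?E3)" using measurable_sets[OF sw A(1)] .
      have hG: "(\<lambda>m. (h m, G' m)) \<in> measurable M (?n \<Otimes>\<^sub>M ?E3)" using M(2) G(2) by (rule measurable_Pair)
      have sG: "(\<lambda>z. (the (fst z), snd z)) \<in> measurable (restrict_space \<rho> S') (?n \<Otimes>\<^sub>M ?E3)" using R'(2) fR(2) by (rule measurable_Pair)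
      have "?g0 -` ?B \<inter> space M = (\<lambda>m. (h m, G' m)) -` ?C \<inter> space M"
        using measurable_space[OF g(1)] measurable_space[OF hG] by (auto simp: spN)
      then have "emeasure M (?g0 -` ?B \<inter> space M) = emeasure (distr M (?n \<Otimes>\<^sub>M ?E3) (\<lambda>m. (h m, G' m))) ?C"
        using C hG by (simp add: emeasure_distr)
      also have "\<dots> = emeasure (restrict_space \<rho> S') ((\<lambda>z. (the (fst z), snd z)) -` ?C \<inter> space (restrict_space \<rho> S'))"
        unfolding dG' using C sG by (simp add: emeasure_distr)
      also have "(\<lambda>z. (the (fst z), snd z)) -` ?C \<inter> space (restrict_space \<rho> S') = S' \<inter> A"
      proof (rule set_eqI)
        fix z show "z \<in> (\<lambda>z. (the (fst z), snd z)) -` ?C \<inter> space (restrict_space \<rho> S') \<longleftrightarrow> z \<in> S' \<inter> A"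
        proof (cases "z \<in> S'")
          case True
          then obtain a b where z: "z = (Some a, b)" by (cases z) (auto simp: S'_def)
          have "z \<in> space (restrict_space \<rho> S')" using True R'(1) by simp
          then have "(the (fst z), snd z) \<in> space (?n \<Otimes>\<^sub>M ?E3)" by (rule measurable_space[OF sG])
          then show ?thesis using True R'(1) z by simp
        qed (use R'(1) in simp)
      qed
      also have "emeasure (restrict_space \<rho> S') (S' \<inter> A) = emeasure \<rho> (S' \<inter> A)"
        using R'(1) sets.Int_space_eq2[OF R'(1)] by (intro emeasure_restrict_space) auto
      finally show ?thesis .
    qed
    have 1: "(space \<rho> - S') \<inter> (?g2 -` ?B) = (space \<rho> - S') \<inter> A"
    proof (rule set_eqI)
      fix z show "z \<in> (space \<rho> - S') \<inter> (?g2 -` ?B) \<longleftrightarrow> z \<in> (space \<rho> - S') \<inter> A"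
      proof (cases "z \<in> space \<rho> - S'")
        case True
        then obtain a where "z = (None, a)" by (cases z) (auto simp: S'_def)
        moreover have "?g2 z \<in> space N" unfolding spN using True by (intro measurable_space[OF g(3)]) simp
        ultimately show ?thesis using True by simp
      qed auto
    qed
    have 2: "(space \<pi> - S) \<inter> (?g1 -` ?B) = {}" using A(2) by auto
    have "emeasure N ?B = emeasure \<rho> (S' \<inter> A) + emeasure \<rho> ((space \<rho> - S') \<inter> A)"
      unfolding emN[OF B] 0 1 2 by simp
    also have "\<dots> = emeasure \<rho> ((S' \<inter> A) \<union> ((space \<rho> - S') \<inter> A))"
      using A\<rho> R'(1) by (intro plus_emeasure) auto
    also have "(S' \<inter> A) \<union> ((space \<rho> - S') \<inter> A) = A" using Asub by auto
    finally show "emeasure N ?B = emeasure \<rho> A" .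
  qed
  have AE: "AE z in N. fst z = None \<or> fst (snd z) \<noteq> None \<or> snd (snd z) = None"
  proof (rule AE_I')
    let ?B = "{z \<in> space N. fst z \<noteq> None \<and> fst (snd z) = None \<and> snd (snd z) \<noteq> None}"
    have B: "?B \<in> sets N" by measurable
    moreover have "emeasure N ?B = 0"
      using emN[of ?B] B sN by (simp add: vimage_def)
    ultimately show "?B \<in> null_sets N" by (simp add: null_setsI)
  qed auto
  have "sigma_finite_measure N"
  proof
    interpret n: sigma_finite_measure ?n by (rule topological_networkD(10)[OF P(2)])
    interpret \<pi>: sigma_finite_measure \<pi> by (rule D(3))
    interpret \<rho>: sigma_finite_measure \<rho> by (rule D'(3))
    obtain A where A: "countable A" "A \<subseteq> sets \<pi>" "\<Union>A = space \<pi>" "\<forall>a\<in>A. emeasure \<pi> a \<noteq> \<infinity>"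
      using \<pi>.sigma_finite_countable by blast
    obtain B where B: "countable B" "B \<subseteq> sets \<rho>" "\<Union>B = space \<rho>" "\<forall>a\<in>B. emeasure \<rho> a \<noteq> \<infinity>"
      using \<rho>.sigma_finite_countable by blast
    \<comment> \<open>A countable cover by sets of finite mass: preimages of such sets for the two
      couplings. They are deprived of the pair of virtual points because only off it does
      \<open>N\<close> reproduce the couplings; the remaining triple of virtual points turns out to
      be null.\<close>
    let ?o = "{(None, None)}"
    let ?a = "\<lambda>a. (\<lambda>z. (fst z, fst (snd z))) -` (a - ?o) \<inter> space N"
    let ?b = "\<lambda>a. (\<lambda>z. (fst (snd z), snd (snd z))) -` (a - ?o) \<inter> space N"
    let ?c = "{z \<in> space N. fst z = None \<and> fst (snd z) = None \<and> snd (snd z) = None}"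
    have FF: "(\<lambda>z. (fst z, fst (snd z))) \<in> measurable N (?E1 \<Otimes>\<^sub>M ?E2)" "(\<lambda>z. (fst (snd z), snd (snd z))) \<in> measurable N (?E2 \<Otimes>\<^sub>M ?E3)"
      by measurable
    have a: "?a a \<in> sets N \<and> emeasure N (?a a) \<noteq> \<infinity>" if "a \<in> A" for a
    proof -
      have a: "a - ?o \<in> sets (?E1 \<Otimes>\<^sub>M ?E2)" using that A D(1) sets_virtual_pair by (intro sets.Diff) auto
      then have "emeasure N (?a a) = emeasure \<pi> (a - ?o)" using i1 by (simp add: induces_off_virtual_def)
      also have "\<dots> \<le> emeasure \<pi> a" using that A by (intro emeasure_mono) auto
      finally show ?thesis using that A measurable_sets[OF FF(1) a] by (auto simp: top_unique)
    qed
    have b: "?b a \<in> sets N \<and> emeasure N (?b a) \<noteq> \<infinity>" if "a \<in> B" for a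
    proof -
      have a: "a - ?o \<in> sets (?E2 \<Otimes>\<^sub>M ?E3)" using that B D'(1) sets_virtual_pair by (intro sets.Diff) auto
      then have "emeasure N (?b a) = emeasure \<rho> (a - ?o)" using i2 by (simp add: induces_off_virtual_def)
      also have "\<dots> \<le> emeasure \<rho> a" using that B by (intro emeasure_mono) auto
      finally show ?thesis using that B measurable_sets[OF FF(2) a] by (auto simp: top_unique)
    qed
    have c: "?c \<in> sets N \<and> emeasure N ?c \<noteq> \<infinity>"
    proof -
      have c: "?c \<in> sets N" by measurable
      have "(space \<pi> - S) \<inter> (?g1 -` ?c) \<subseteq> {(None, None)}" "(space \<rho> - S') \<inter> (?g2 -` ?c) \<subseteq> {(None, None)}"
        by (auto simp: S_def S'_def)
      moreover have "{(None, None)} \<in> sets \<pi>" "{(None, None)} \<in> sets \<rho>" using D(1) D'(1) sets_virtual_pair by auto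
      ultimately have "emeasure \<pi> ((space \<pi> - S) \<inter> (?g1 -` ?c)) = 0" "emeasure \<rho> ((space \<rho> - S') \<inter> (?g2 -` ?c)) = 0"
        using D(8) D'(8) by (auto intro: emeasure_eq_0)
      then show ?thesis using emN[of ?c] c sN by (simp add: vimage_def)
    qed
    have cover: "space N \<subseteq> \<Union>(insert ?c (?a ` A \<union> ?b ` B))"
    proof
      fix z assume z: "z \<in> space N"
      have "(fst z, fst (snd z)) \<in> space \<pi>" "(fst (snd z), snd (snd z)) \<in> space \<rho>"
        using z sets_eq_imp_space_eq[OF D(1)] sets_eq_imp_space_eq[OF D'(1)] by (auto simp: spN space_pair_measure)
      then obtain a b where "a \<in> A" "(fst z, fst (snd z)) \<in> a" "b \<in> B" "(fst (snd z), snd (snd z)) \<in> b"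
        using A(3) B(3) by blast
      then show "z \<in> \<Union>(insert ?c (?a ` A \<union> ?b ` B))"
        using z by (cases z) auto
    qed
    show "\<exists>A. countable A \<and> A \<subseteq> sets N \<and> \<Union>A = space N \<and> (\<forall>a\<in>A. emeasure N a \<noteq> \<infinity>)"
    proof (intro exI conjI)
      show "countable (insert ?c (?a ` A \<union> ?b ` B))" using A B by simp
      show "\<Union>(insert ?c (?a ` A \<union> ?b ` B)) = space N" using cover by auto
    qed (use a b c in auto)
  qed
  then show thesis using i1 i2 AE by (rule that)
qed

text \<open>A cylinder over true points avoids the pair of virtual points, so its mass is the same
  for \<open>N\<close> and for the coupling.\<close>

lemma induces_off_virtual_marginals:
  assumes P: "topological_network P" "topological_network P'" and e: "\<pi>e \<in> adm_couplings P P'"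
    and ind: "induces_off_virtual P P' N F G \<pi>e"
  shows "\<And>A. A \<in> sets (borel_of (net_Y P)) \<Longrightarrow> emeasure N (F -` (Some ` A) \<inter> space N) = emeasure (net_nu P) A"
    "\<And>A. A \<in> sets (borel_of (net_Y P')) \<Longrightarrow> emeasure N (G -` (Some ` A) \<inter> space N) = emeasure (net_nu P') A"
proof -
  let ?K = "edge_borel P \<Otimes>\<^sub>M edge_borel P'"
  note D = adm_couplingsD[OF P e]
  have FG: "F \<in> measurable N (edge_borel P)" "G \<in> measurable N (edge_borel P')"
    and em: "\<And>A. A \<in> sets ?K \<Longrightarrow> (None, None) \<notin> A \<Longrightarrow> emeasure N ((\<lambda>z. (F z, G z)) -` A \<inter> space N) = emeasure \<pi>e A"
    using ind by (auto simp: induces_off_virtual_def)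
  show "emeasure N (F -` (Some ` A) \<inter> space N) = emeasure (net_nu P) A" if A: "A \<in> sets (borel_of (net_Y P))" for A
  proof -
    have S: "Some ` A \<subseteq> topspace (add_point (net_Y P))"
      using sets.sets_into_space[OF A] by (auto simp: topspace_add_point)
    have B: "Some ` A \<times> topspace (add_point (net_Y P')) \<in> sets ?K"
      using Some_image_in_sets[OF A] sets.top[of "edge_borel P'"] by (intro pair_measureI) auto
    have "(\<lambda>z. (F z, G z)) -` (Some ` A \<times> topspace (add_point (net_Y P'))) \<inter> space N = F -` (Some ` A) \<inter> space N"
      using measurable_space[OF FG(2)] by auto
    then have "emeasure N (F -` (Some ` A) \<inter> space N) = emeasure \<pi>e (Some ` A \<times> topspace (add_point (net_Y P')))"
      using em[OF B] by auto
    also have "Some ` A \<times> topspace (add_point (net_Y P')) = fst -` (Some ` A) \<inter> space \<pi>e"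
      using S by (auto simp: D(2))
    finally show ?thesis using D(6)[OF A] by simp
  qed
  show "emeasure N (G -` (Some ` A) \<inter> space N) = emeasure (net_nu P') A" if A: "A \<in> sets (borel_of (net_Y P'))" for A
  proof -
    have S: "Some ` A \<subseteq> topspace (add_point (net_Y P'))"
      using sets.sets_into_space[OF A] by (auto simp: topspace_add_point)
    have B: "topspace (add_point (net_Y P)) \<times> Some ` A \<in> sets ?K"
      using Some_image_in_sets[OF A] sets.top[of "edge_borel P"] by (intro pair_measureI) auto
    have "(\<lambda>z. (F z, G z)) -` (topspace (add_point (net_Y P)) \<times> Some ` A) \<inter> space N = G -` (Some ` A) \<inter> space N"
      using measurable_space[OF FG(1)] by auto
    then have "emeasure N (G -` (Some ` A) \<inter> space N) = emeasure \<pi>e (topspace (add_point (net_Y P)) \<times> Some ` A)"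
      using em[OF B] by auto
    also have "topspace (add_point (net_Y P)) \<times> Some ` A = snd -` (Some ` A) \<inter> space \<pi>e"
      using S by (auto simp: D(2))
    finally show ?thesis using D(7)[OF A] by simp
  qed
qed

lemma distr_marginals:
  assumes P: "topological_network P" "topological_network P'" and v: "\<pi> \<in> couplings P P'"
    and f: "f \<in> measurable M (vertex_borel P)" "g \<in> measurable M (vertex_borel P')"
    and eq: "distr M (vertex_borel P \<Otimes>\<^sub>M vertex_borel P') (\<lambda>m. (f m, g m)) = \<pi>"
  shows "distr M (vertex_borel P) f = net_mu P" "distr M (vertex_borel P') g = net_mu P'"
proof -
  have fg: "(\<lambda>m. (f m, g m)) \<in> measurable M (vertex_borel P \<Otimes>\<^sub>M vertex_borel P')" using f by (rule measurable_Pair)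
  have "distr \<pi> (vertex_borel P) fst = distr M (vertex_borel P) f"
    unfolding eq[symmetric] by (subst distr_distr[OF measurable_fst fg]) (simp add: comp_def)
  then show "distr M (vertex_borel P) f = net_mu P" using couplingsD(5)[OF P v] by simp
  have "distr \<pi> (vertex_borel P') snd = distr M (vertex_borel P') g"
    unfolding eq[symmetric] by (subst distr_distr[OF measurable_snd fg]) (simp add: comp_def)
  then show "distr M (vertex_borel P') g = net_mu P'" using couplingsD(6)[OF P v] by simp
qed

text \<open>Stated for individual couplings and not for infima, so that two couplings of cost zero
  yield a third one of cost zero.\<close>

lemma TpOT_cost_triangle:
  fixes P1 :: "('a, 'b) network" and P2 :: "('c, 'd) network" and P3 :: "('e, 'f) network"
  assumes p: "p \<ge> 1" and P: "topological_network P1" "topological_network P2" "topological_network P3"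
    and v: "\<pi>v \<in> couplings P1 P2" "\<rho>v \<in> couplings P2 P3"
    and e: "\<pi>e \<in> adm_couplings P1 P2" "\<rho>e \<in> adm_couplings P2 P3"
  obtains \<sigma>v \<sigma>e where "\<sigma>v \<in> couplings P1 P3" "\<sigma>e \<in> adm_couplings P1 P3"
    "TpOT_cost p P1 P3 \<sigma>v \<sigma>e \<le> TpOT_cost p P1 P2 \<pi>v \<pi>e + TpOT_cost p P2 P3 \<rho>v \<rho>e"
proof -
  obtain M :: "(('c \<times> real) \<times> real) measure" and f1 f2 f3 where M: "prob_space M" "f1 \<in> measurable M (vertex_borel P1)" "f2 \<in> measurable M (vertex_borel P2)"
    "f3 \<in> measurable M (vertex_borel P3)"
    and 12: "distr M (vertex_borel P1 \<Otimes>\<^sub>M vertex_borel P2) (\<lambda>m. (f1 m, f2 m)) = \<pi>v"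
    and 23: "distr M (vertex_borel P2 \<Otimes>\<^sub>M vertex_borel P3) (\<lambda>m. (f2 m, f3 m)) = \<rho>v"
    by (rule glue_vertices[OF P v])
  obtain N :: "('b option \<times> 'd option \<times> 'f option) measure" where N: "sigma_finite_measure N"
    "induces_off_virtual P1 P2 N fst (\<lambda>z. fst (snd z)) \<pi>e"
    "induces_off_virtual P2 P3 N (\<lambda>z. fst (snd z)) (\<lambda>z. snd (snd z)) \<rho>e"
    "AE z in N. fst z = None \<or> fst (snd z) \<noteq> None \<or> snd (snd z) = None"
    by (rule glue_edges[OF P e])
  have F: "fst \<in> measurable N (edge_borel P1)" "(\<lambda>z. fst (snd z)) \<in> measurable N (edge_borel P2)"
    "(\<lambda>z. snd (snd z)) \<in> measurable N (edge_borel P3)"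
    using N by (auto simp: induces_off_virtual_def)
  have par: "parametrizes P1 M N f1 fst" "parametrizes P2 M N f2 (\<lambda>z. fst (snd z))" "parametrizes P3 M N f3 (\<lambda>z. snd (snd z))"
    unfolding parametrizes_def
    using M F N(1) distr_marginals[OF P(1,2) v(1) M(2,3) 12] distr_marginals[OF P(2,3) v(2) M(3,4) 23]
      induces_off_virtual_marginals[OF P(1,2) e(1) N(2)] induces_off_virtual_marginals[OF P(2,3) e(2) N(3)]
    by blast+
  obtain \<sigma>v \<sigma>e where s: "\<sigma>v \<in> couplings P1 P3" "\<sigma>e \<in> adm_couplings P1 P3"
    "TpOT_cost p P1 P3 \<sigma>v \<sigma>e = ennreal_powr (total_cost p P1 P3 M N f1 f3 fst (\<lambda>z. snd (snd z))) (1 / p)"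
    by (rule couplings_of_parametrizations[OF p P(1,3) par(1,3)])
  have c12: "TpOT_cost p P1 P2 \<pi>v \<pi>e = ennreal_powr (total_cost p P1 P2 M N f1 f2 fst (\<lambda>z. fst (snd z))) (1 / p)"
    unfolding TpOT_cost_eq_total_cost
    by (subst total_cost_induced[OF p P(1,2) M(1) N(1) adm_couplingsD(3)[OF P(1,2) e(1)] M(2,3) 12[symmetric] N(2)]) (rule refl)
  have c23: "TpOT_cost p P2 P3 \<rho>v \<rho>e = ennreal_powr (total_cost p P2 P3 M N f2 f3 (\<lambda>z. fst (snd z)) (\<lambda>z. snd (snd z))) (1 / p)"
    unfolding TpOT_cost_eq_total_cost
    by (subst total_cost_induced[OF p P(2,3) M(1) N(1) adm_couplingsD(3)[OF P(2,3) e(2)] M(3,4) 23[symmetric] N(3)]) (rule refl)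
  show thesis
    using total_cost_triangle[OF p P par N(4)] by (intro that[OF s(1,2)]) (simp add: s(3) c12 c23)
qed

text \<open>When both infima are finite, near-minimisers within \<open>e / 2\<close> exist; an
  infinite infimum makes the bound trivial.\<close>

lemma ennreal_le_INF_add_INF:
  fixes f :: "'a \<Rightarrow> ennreal" and g :: "'b \<Rightarrow> ennreal"
  assumes "\<And>a b. a \<in> A \<Longrightarrow> b \<in> B \<Longrightarrow> c \<le> f a + g b"
  shows "c \<le> (INF a\<in>A. f a) + (INF b\<in>B. g b)"
proof (cases "(INF a\<in>A. f a) = top \<or> (INF b\<in>B. g b) = top")
  case False
  show ?thesis
  proof (rule ennreal_le_epsilon)
    fix e :: real assume "0 < e"
    then have e: "0 < ennreal (e / 2)" by simp
    have "(INF a\<in>A. f a) < (INF a\<in>A. f a) + ennreal (e / 2)" "(INF b\<in>B. g b) < (INF b\<in>B. g b) + ennreal (e / 2)"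
      using False e by (auto simp: ennreal_add_left_cancel_less less_top intro!: ennreal_add_less_top)
    then obtain a b where ab: "a \<in> A" "f a < (INF a\<in>A. f a) + ennreal (e / 2)" "b \<in> B" "g b < (INF b\<in>B. g b) + ennreal (e / 2)"
      by (auto simp: INF_less_iff)
    have "c \<le> f a + g b" using assms ab by simp
    also have "\<dots> \<le> ((INF a\<in>A. f a) + ennreal (e / 2)) + ((INF b\<in>B. g b) + ennreal (e / 2))"
      using ab by (intro add_mono) auto
    also have "\<dots> = (INF a\<in>A. f a) + (INF b\<in>B. g b) + (ennreal (e / 2) + ennreal (e / 2))"
      by (simp only: ac_simps)
    also have "ennreal (e / 2) + ennreal (e / 2) = ennreal e"
      using \<open>0 < e\<close> by (simp flip: ennreal_plus)
    finally show "c \<le> (INF a\<in>A. f a) + (INF b\<in>B. g b) + ennreal e" .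
  qed
qed auto

lemma d_TpOT_triangle:
  assumes p: "p \<ge> 1" and P: "topological_network P1" "topological_network P2" "topological_network P3"
  shows "d_TpOT p P1 P3 \<le> d_TpOT p P1 P2 + d_TpOT p P2 P3"
proof -
  let ?A = "couplings P1 P2 \<times> adm_couplings P1 P2" and ?B = "couplings P2 P3 \<times> adm_couplings P2 P3"
  let ?c = "case_prod (TpOT_cost p P1 P2)" and ?c' = "case_prod (TpOT_cost p P2 P3)"
  have le: "d_TpOT p P1 P3 \<le> ?c a + ?c' b" if "a \<in> ?A" "b \<in> ?B" for a b
  proof -
    obtain \<pi>v \<pi>e \<rho>v \<rho>e where ab: "a = (\<pi>v, \<pi>e)" "b = (\<rho>v, \<rho>e)" by (cases a; cases b)
    then have m: "\<pi>v \<in> couplings P1 P2" "\<rho>v \<in> couplings P2 P3" "\<pi>e \<in> adm_couplings P1 P2" "\<rho>e \<in> adm_couplings P2 P3"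
      using that by auto
    obtain \<sigma>v \<sigma>e where s: "\<sigma>v \<in> couplings P1 P3" "\<sigma>e \<in> adm_couplings P1 P3"
      "TpOT_cost p P1 P3 \<sigma>v \<sigma>e \<le> TpOT_cost p P1 P2 \<pi>v \<pi>e + TpOT_cost p P2 P3 \<rho>v \<rho>e"
      by (rule TpOT_cost_triangle[OF p P m])
    then have "d_TpOT p P1 P3 \<le> TpOT_cost p P1 P3 \<sigma>v \<sigma>e"
      unfolding d_TpOT_def by (intro INF_lower2[of "(\<sigma>v, \<sigma>e)"]) auto
    with s(3) show ?thesis unfolding ab by simp
  qed
  then have "d_TpOT p P1 P3 \<le> (INF a\<in>?A. ?c a) + (INF b\<in>?B. ?c' b)"
    by (rule ennreal_le_INF_add_INF)
  then show ?thesis by (simp add: d_TpOT_def)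
qed

section \<open>Weak isomorphism and vanishing cost\<close>

text \<open>The source of a weak isomorphism can play the role of parameter space, with edge maps
  that never reach the virtual point.\<close>

lemma parametrizes_weak_isomorphism:
  assumes Q: "topological_network Q" and P: "topological_network P" and w: "weak_isomorphism Q P \<phi> \<psi>"
  shows "parametrizes P (net_mu Q) (net_nu Q) \<phi> (\<lambda>y. Some (\<psi> y))"
proof -
  have m: "\<phi> \<in> measurable (net_mu Q) (net_mu P)" "distr (net_mu Q) (net_mu P) \<phi> = net_mu P"
    "\<psi> \<in> measurable (net_nu Q) (net_nu P)" "distr (net_nu Q) (net_nu P) \<psi> = net_nu P"
    using w by (auto simp: weak_isomorphism_def measure_preserving_def)
  note s = topological_networkD(4,6)[OF P]
  have 1: "\<phi> \<in> measurable (net_mu Q) (vertex_borel P)" using m(1) measurable_cong_sets[OF refl s(1)] by blast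
  have 2: "distr (net_mu Q) (vertex_borel P) \<phi> = net_mu P"
    using m(2) distr_cong[OF refl s(1), of "net_mu Q" \<phi> \<phi>] by simp
  have 3: "(\<lambda>y. Some (\<psi> y)) \<in> measurable (net_nu Q) (edge_borel P)"
    using m(3) measurable_cong_sets[OF refl s(2)] by (intro measurable_compose[OF _ measurable_Some]) blast
  have 4: "emeasure (net_nu Q) ((\<lambda>y. Some (\<psi> y)) -` (Some ` A) \<inter> space (net_nu Q)) = emeasure (net_nu P) A"
    if A: "A \<in> sets (borel_of (net_Y P))" for A
  proof -
    have "(\<lambda>y. Some (\<psi> y)) -` (Some ` A) \<inter> space (net_nu Q) = \<psi> -` A \<inter> space (net_nu Q)" by auto
    then show ?thesis using A s(2) m(3,4) by (metis emeasure_distr)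
  qed
  show ?thesis unfolding parametrizes_def
    using 1 2 3 4 topological_networkD(8,10)[OF Q] by blast
qed

text \<open>The common source \<open>Q\<close> parametrises both networks at once, and each
  integrand vanishes almost everywhere because both values equal the one in
  \<open>Q\<close>.\<close>

lemma weakly_isomorphic_imp_zero_cost:
  assumes p: "p \<ge> 1" and w: "weakly_isomorphic P P'"
  obtains \<pi>v \<pi>e where "\<pi>v \<in> couplings P P'" "\<pi>e \<in> adm_couplings P P'" "TpOT_cost p P P' \<pi>v \<pi>e = 0"
proof -
  have P: "topological_network P" "topological_network P'" using w by (auto simp: weakly_isomorphic_def)
  obtain Q :: small_network and \<phi> \<psi> \<phi>' \<psi>' where Q: "topological_network Q"
    and w: "weak_isomorphism Q P \<phi> \<psi>" "weak_isomorphism Q P' \<phi>' \<psi>'"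
    using w unfolding weakly_isomorphic_def by blast
  note par = parametrizes_weak_isomorphism[OF Q P(1) w(1)] parametrizes_weak_isomorphism[OF Q P(2) w(2)]
  have "dist_cost p P P' (net_nu Q) (\<lambda>y. Some (\<psi> y)) (\<lambda>y. Some (\<psi>' y)) = 0"
  proof -
    have "AE y in net_nu Q. net_iota Q y = net_iota P (\<psi> y)" "AE y in net_nu Q. net_iota Q y = net_iota P' (\<psi>' y)"
      using w by (auto simp: weak_isomorphism_def)
    then have "AE y in net_nu Q. ennreal (lam_dist p (ext_iota P (Some (\<psi> y))) (ext_iota P' (Some (\<psi>' y))) powr p) = 0"
    proof eventually_elim
      case (elim y)
      then have "net_iota P (\<psi> y) = net_iota P' (\<psi>' y)" by simp
      then show ?case using lp_norm_eq_0[OF p, of 0] by (simp add: ext_iota_def)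
    qed
    then show ?thesis unfolding dist_cost_def by (subst nn_integral_cong_AE) auto
  qed
  moreover have "k_cost p P P' (net_mu Q) \<phi> \<phi>' = 0"
  proof -
    have "AE z in net_mu Q \<Otimes>\<^sub>M net_mu Q. net_k Q (fst z) (snd z) = net_k P (\<phi> (fst z)) (\<phi> (snd z))"
      "AE z in net_mu Q \<Otimes>\<^sub>M net_mu Q. net_k Q (fst z) (snd z) = net_k P' (\<phi>' (fst z)) (\<phi>' (snd z))"
      using w by (auto simp: weak_isomorphism_def case_prod_unfold)
    then have "AE z in net_mu Q \<Otimes>\<^sub>M net_mu Q. ennreal (\<bar>net_k P (\<phi> (fst z)) (\<phi> (snd z)) - net_k P' (\<phi>' (fst z)) (\<phi>' (snd z))\<bar> powr p) = 0"
      by eventually_elim simp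
    then show ?thesis unfolding k_cost_def by (subst nn_integral_cong_AE) auto
  qed
  moreover have "omega_cost p P P' (net_mu Q) (net_nu Q) \<phi> \<phi>' (\<lambda>y. Some (\<psi> y)) (\<lambda>y. Some (\<psi>' y)) = 0"
  proof -
    have "AE z in net_mu Q \<Otimes>\<^sub>M net_nu Q. net_omega Q (fst z) (snd z) = net_omega P (\<phi> (fst z)) (\<psi> (snd z))"
      "AE z in net_mu Q \<Otimes>\<^sub>M net_nu Q. net_omega Q (fst z) (snd z) = net_omega P' (\<phi>' (fst z)) (\<psi>' (snd z))"
      using w by (auto simp: weak_isomorphism_def case_prod_unfold)
    then have "AE z in net_mu Q \<Otimes>\<^sub>M net_nu Q. ennreal (\<bar>ext_omega P (\<phi> (fst z)) (Some (\<psi> (snd z))) - ext_omega P' (\<phi>' (fst z)) (Some (\<psi>' (snd z)))\<bar> powr p) = 0"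
      by eventually_elim simp
    then show ?thesis unfolding omega_cost_def by (subst nn_integral_cong_AE) auto
  qed
  ultimately have zero: "total_cost p P P' (net_mu Q) (net_nu Q) \<phi> \<phi>' (\<lambda>y. Some (\<psi> y)) (\<lambda>y. Some (\<psi>' y)) = 0"
    by (simp add: total_cost_def)
  show thesis
    by (rule couplings_of_parametrizations[OF p P par]) (rule that, auto simp: zero ennreal_powr_eq_0)
qed

lemma weakly_isomorphic_sym: "weakly_isomorphic P P' \<Longrightarrow> weakly_isomorphic P' P"
  unfolding weakly_isomorphic_def by blast

lemma weakly_isomorphic_imp_d_TpOT_0:
  assumes "p \<ge> 1" "weakly_isomorphic P P'" shows "d_TpOT p P P' = 0"
proof -
  obtain \<pi>v \<pi>e where "\<pi>v \<in> couplings P P'" "\<pi>e \<in> adm_couplings P P'" "TpOT_cost p P P' \<pi>v \<pi>e = 0"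
    using weakly_isomorphic_imp_zero_cost[OF assms] by blast
  then have "d_TpOT p P P' \<le> 0"
    unfolding d_TpOT_def by (intro INF_lower2[of "(\<pi>v, \<pi>e)"]) auto
  then show ?thesis by simp
qed

text \<open>The detour from \<open>R\<close> through \<open>P\<close> and \<open>P'\<close> to
  \<open>R'\<close> has outer legs of length zero.\<close>

lemma d_TpOT_weakly_isomorphic_le:
  assumes p: "p \<ge> 1" and w: "weakly_isomorphic P R" "weakly_isomorphic P' R'"
  shows "d_TpOT p R R' \<le> d_TpOT p P P'"
proof -
  have n: "topological_network P" "topological_network R" "topological_network P'" "topological_network R'"
    using w by (auto simp: weakly_isomorphic_def)
  have "d_TpOT p R R' \<le> d_TpOT p R P + d_TpOT p P R'" by (intro d_TpOT_triangle p n)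
  also have "\<dots> \<le> d_TpOT p R P + (d_TpOT p P P' + d_TpOT p P' R')" by (intro add_mono d_TpOT_triangle p n order_refl)
  finally show ?thesis
    using weakly_isomorphic_imp_d_TpOT_0[OF p w(2)] weakly_isomorphic_imp_d_TpOT_0[OF p weakly_isomorphic_sym[OF w(1)]]
    by simp
qed

lemma d_TpOT_weakly_isomorphic:
  assumes p: "p \<ge> 1" and w: "weakly_isomorphic P R" "weakly_isomorphic P' R'"
  shows "d_TpOT p R R' = d_TpOT p P P'"
  using d_TpOT_weakly_isomorphic_le[OF p w] d_TpOT_weakly_isomorphic_le[OF p w[THEN weakly_isomorphic_sym]]
  by (rule antisym)

section \<open>Measure persistence diagrams\<close>

lemma lp_norm_Proj_powr:
  assumes "q \<ge> 1"
  shows "lp_norm q (v - Proj v) powr q = 2 * (\<bar>snd v - fst v\<bar> / 2) powr q"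
proof -
  have "\<bar>fst (v - Proj v)\<bar> = \<bar>snd v - fst v\<bar> / 2" "\<bar>snd (v - Proj v)\<bar> = \<bar>snd v - fst v\<bar> / 2"
    by (auto simp: Proj_def field_simps abs_if)
  then show ?thesis using assms by (simp only: lp_norm_powr)
qed

lemma measurable_persistence [measurable]:
  "(\<lambda>v. ennreal (lp_norm q (v - Proj v) powr q)) \<in> borel_measurable borel"
  by measurable

lemma measurable_persistence_Lam:
  "(\<lambda>v. ennreal (lp_norm q (v - Proj v) powr q)) \<in> borel_measurable (borel_of (top_of_set Lam))"
proof -
  have "(\<lambda>v. v) \<in> measurable (borel_of (top_of_set Lam)) (borel_of euclidean)"
    by (intro continuous_map_measurable continuous_map_from_subtopology) simp
  then have "(\<lambda>v. v) \<in> measurable (borel_of (top_of_set Lam)) borel"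
    using measurable_cong_sets[OF refl sets_borel_of_euclidean] by blast
  from measurable_compose[OF this measurable_persistence] show ?thesis .
qed

text \<open>Local finiteness of the image is not inherited along \<open>f\<close>; it comes from
  Markov's inequality applied to the total persistence. Inner regularity is inherited, continuous
  images of compact sets being compact.\<close>

lemma measure_persistence_diagram_distr:
  assumes rad: "radon_measure_on T \<nu>" and f: "continuous_map T (top_of_set Lam) f"
    and fin: "\<And>q. q \<ge> 1 \<Longrightarrow> (\<integral>\<^sup>+y. ennreal (lp_norm q (f y - Proj (f y)) powr q) \<partial>\<nu>) < \<infinity>"
  shows "measure_persistence_diagram (distr \<nu> (borel_of (top_of_set Lam)) f)"
proof -
  let ?B = "borel_of (top_of_set Lam)"
  have \<nu>: "sets \<nu> = sets (borel_of T)" "space \<nu> = topspace T"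
    using rad borel_measure_onD[of T \<nu>] by (auto simp: radon_measure_on_def)
  have fm: "f \<in> measurable \<nu> ?B"
    using continuous_map_measurable[OF f] measurable_cong_sets[OF \<nu>(1) refl] by blast
  let ?\<sigma> = "distr \<nu> ?B f"
  have int: "(\<integral>\<^sup>+l. ennreal (lp_norm q (l - Proj l) powr q) \<partial>?\<sigma>) < \<infinity>" if "q \<ge> 1" for q
    using fin[OF that] fm measurable_persistence_Lam[of q] by (simp add: nn_integral_distr)
  have "radon_measure_on (top_of_set Lam) ?\<sigma>"
    unfolding radon_measure_on_def
  proof (intro conjI ballI)
    show "borel_measure_on (top_of_set Lam) ?\<sigma>" by (simp add: borel_measure_on_def)
  next
    fix x assume "x \<in> topspace (top_of_set Lam)"
    then have x: "x \<in> Lam" by simp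
    \<comment> \<open>Half the persistence of \<open>x\<close>, so that the open set of points with
      persistence above \<open>c\<close> contains \<open>x\<close>. For exponent 1 the integrand is
      the persistence itself, and Markov's inequality bounds the mass of that set.\<close>
    define c where "c = (snd x - fst x) / 2"
    have c: "c > 0" using x by (auto simp: c_def Lam_def)
    let ?U = "Lam \<inter> {v. c < snd v - fst v}"
    have L: "lp_norm 1 (v - Proj v) = \<bar>snd v - fst v\<bar>" for v using lp_norm_Proj_powr[of 1 v] by simp
    have U: "openin (top_of_set Lam) ?U"
      by (intro openin_open_Int open_Collect_less continuous_intros)
    have "ennreal c * emeasure ?\<sigma> ?U = (\<integral>\<^sup>+v. ennreal c * indicator ?U v \<partial>?\<sigma>)"
      using openin_in_borel_of[OF U] by (subst nn_integral_cmult_indicator) auto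
    also have "\<dots> \<le> (\<integral>\<^sup>+v. ennreal (lp_norm 1 (v - Proj v) powr 1) \<partial>?\<sigma>)"
      using c by (intro nn_integral_mono) (auto simp: L split: split_indicator intro!: ennreal_leI)
    also have "\<dots> < \<infinity>" by (rule int) simp
    finally have "emeasure ?\<sigma> ?U < \<infinity>" using c by (auto simp: ennreal_mult_less_top)
    then show "\<exists>U. openin (top_of_set Lam) U \<and> x \<in> U \<and> emeasure ?\<sigma> U < \<infinity>"
      using U x c by (intro exI[of _ ?U]) (auto simp: c_def)
  next
    fix A assume A: "A \<in> sets ?\<sigma>"
    then have fA: "f -` A \<inter> space \<nu> \<in> sets \<nu>" using measurable_sets[OF fm] by simp
    have met: "Hausdorff_space (top_of_set Lam)"
      by (simp add: Hausdorff_space_subtopology)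
    show "emeasure ?\<sigma> A = (SUP K\<in>{K. compactin (top_of_set Lam) K \<and> K \<subseteq> A}. emeasure ?\<sigma> K)"
    proof (rule antisym)
      show "(SUP K\<in>{K. compactin (top_of_set Lam) K \<and> K \<subseteq> A}. emeasure ?\<sigma> K) \<le> emeasure ?\<sigma> A"
        using A by (intro SUP_least emeasure_mono) auto
      have "emeasure ?\<sigma> A = emeasure \<nu> (f -` A \<inter> space \<nu>)" using A fm by (simp add: emeasure_distr)
      also have "\<dots> = (SUP K\<in>{K. compactin T K \<and> K \<subseteq> f -` A \<inter> space \<nu>}. emeasure \<nu> K)"
        using rad fA by (simp add: radon_measure_on_def)
      also have "\<dots> \<le> (SUP K\<in>{K. compactin (top_of_set Lam) K \<and> K \<subseteq> A}. emeasure ?\<sigma> K)"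
      proof (rule SUP_least)
        fix K assume "K \<in> {K. compactin T K \<and> K \<subseteq> f -` A \<inter> space \<nu>}"
        then have K: "compactin T K" "K \<subseteq> f -` A \<inter> space \<nu>" by auto
        have fK: "compactin (top_of_set Lam) (f ` K)" using K(1) f by (rule image_compactin)
        have fKm: "f ` K \<in> sets ?B"
          by (intro closedin_in_borel_of compactin_imp_closedin met fK)
        have "emeasure \<nu> K \<le> emeasure \<nu> (f -` (f ` K) \<inter> space \<nu>)"
          using K measurable_sets[OF fm fKm] by (intro emeasure_mono) auto
        also have "\<dots> = emeasure ?\<sigma> (f ` K)" using fm fKm by (simp add: emeasure_distr)
        also have "\<dots> \<le> (SUP K\<in>{K. compactin (top_of_set Lam) K \<and> K \<subseteq> A}. emeasure ?\<sigma> K)"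
          using fK K(2) by (intro SUP_upper) auto
        finally show "emeasure \<nu> K \<le> \<dots>" .
      qed
      finally show "emeasure ?\<sigma> A \<le> \<dots>" .
    qed
  qed
  then show ?thesis using int by (simp add: measure_persistence_diagram_def)
qed

lemma persistence_finite:
  assumes P: "topological_network P" and "q \<ge> 1"
  shows "(\<integral>\<^sup>+y. ennreal (lp_norm q (net_iota P y - Proj (net_iota P y)) powr q) \<partial>net_nu P) < \<infinity>"
proof -
  let ?B = "borel_of (top_of_set Lam)"
  have "net_iota P \<in> measurable (net_nu P) ?B"
    using continuous_map_measurable[OF topological_networkD(12)[OF P]]
      measurable_cong_sets[OF topological_networkD(6)[OF P] refl] by blast
  moreover have "(\<integral>\<^sup>+l. ennreal (lp_norm q (l - Proj l) powr q) \<partial>distr (net_nu P) ?B (net_iota P)) < \<infinity>"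
    using assms by (simp add: topological_network_def measure_persistence_diagram_def)
  ultimately show ?thesis using measurable_persistence_Lam[of q] by (simp add: nn_integral_distr)
qed

text \<open>Moves the finiteness of total persistence from a network to one coordinate of an edge
  coupling, with virtual points contributing nothing.\<close>

lemma persistence_marginal_finite:
  assumes P: "topological_network P" and q: "q \<ge> 1" and F: "F \<in> measurable N (edge_borel P)"
    and mF: "\<And>A. A \<in> sets (borel_of (net_Y P)) \<Longrightarrow> emeasure N (F -` (Some ` A) \<inter> space N) = emeasure (net_nu P) A"
  shows "(\<integral>\<^sup>+z. case_option 0 (\<lambda>y. ennreal (lp_norm q (net_iota P y - Proj (net_iota P y)) powr q)) (F z) \<partial>N) < \<infinity>"
proof -
  define u where "u = (\<lambda>y. ennreal (lp_norm q (net_iota P y - Proj (net_iota P y)) powr q))"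
  let ?S = "{z \<in> space N. F z \<noteq> None}"
  have R: "?S \<in> sets N" "(\<lambda>z. the (F z)) \<in> measurable (restrict_space N ?S) (net_nu P)"
    "distr (restrict_space N ?S) (net_nu P) (\<lambda>z. the (F z)) = net_nu P"
    by (intro distr_the_restrict[OF F P] mF; assumption)+
  have u: "u \<in> borel_measurable (net_nu P)"
    using measurable_compose[OF measurable_net_iota[OF P] measurable_persistence[of q]]
      measurable_cong_sets[OF topological_networkD(6)[OF P] refl] unfolding u_def by blast
  have "(\<integral>\<^sup>+z. case_option 0 u (F z) \<partial>N) = (\<integral>\<^sup>+z. case_option 0 u (F z) * indicator ?S z \<partial>N)"
    by (intro nn_integral_cong) (auto split: split_indicator option.splits)
  also have "\<dots> = (\<integral>\<^sup>+z. case_option 0 u (F z) \<partial>restrict_space N ?S)"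
    using R(1) sets.Int_space_eq2[OF R(1)] by (subst nn_integral_restrict_space) auto
  also have "\<dots> = (\<integral>\<^sup>+z. u (the (F z)) \<partial>restrict_space N ?S)"
    by (intro nn_integral_cong) (auto simp: space_restrict_space)
  also have "\<dots> = (\<integral>\<^sup>+y. u y \<partial>distr (restrict_space N ?S) (net_nu P) (\<lambda>z. the (F z)))"
    using u by (subst nn_integral_distr[OF R(2)]) auto
  also have "\<dots> < \<infinity>" unfolding u_def by (subst R(3)) (rule persistence_finite[OF P q])
  finally show ?thesis unfolding u_def .
qed

section \<open>The interpolating network\<close>

lemma continuous_map_case_option:
  assumes "continuous_map T S f" "c \<in> topspace S"
  shows "continuous_map (add_point T) S (case_option c f)"
  unfolding continuous_map_def
proof (intro conjI allI impI)
  show "case_option c f \<in> topspace (add_point T) \<rightarrow> topspace S"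
    using assms by (auto simp: topspace_add_point continuous_map_def)
  fix U assume U: "openin S U"
  have "{x. Some x \<in> {x \<in> topspace (add_point T). case_option c f x \<in> U}} = {x \<in> topspace T. f x \<in> U}"
    by (auto simp: topspace_add_point)
  then show "openin (add_point T) {x \<in> topspace (add_point T). case_option c f x \<in> U}"
    unfolding openin_add_point using openin_continuous_map_preimage[OF assms(1) U]
    by (auto simp: topspace_add_point)
qed

lemma openin_add_point_None_pattern: "openin (add_point T) {y \<in> topspace (add_point T). (y = None) = b}"
proof -
  have "{x. Some x \<in> {y \<in> topspace (add_point T). (y = None) = b}} = (if b then {} else topspace T)"
    by (auto simp: topspace_add_point)
  then show ?thesis unfolding openin_add_point by (auto simp: topspace_add_point)
qed

text \<open>Virtual points are isolated, so which coordinates are virtual is locally constant. Any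
  condition \<open>Q\<close> on this pattern is therefore open and, through its negation, also
  closed.\<close>

lemma openin_ext_prod_None_pattern:
  "openin (ext_prod P P') {z \<in> topspace (ext_prod P P'). Q (fst z = None) (snd z = None)}"
proof -
  let ?D = "\<lambda>T b. {y \<in> topspace (add_point T). (y = None) = b}" and ?D' = "\<lambda>T b. {y \<in> topspace (add_point T). (y = None) = b}"
  have D: "openin (prod_topology (add_point (net_Y P)) (add_point (net_Y P'))) (?D (net_Y P) b \<times> ?D' (net_Y P') c)" for b c
    unfolding openin_prod_Times_iff by (intro disjI2 conjI openin_add_point_None_pattern)
  have "openin (ext_prod P P') (\<Union>bc\<in>{bc. Q (fst bc) (snd bc)}. ?D (net_Y P) (fst bc) \<times> ?D' (net_Y P') (snd bc))"
    unfolding ext_prod_def by (rule openin_Union, elim imageE) (simp only: D)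
  also have "(\<Union>bc\<in>{bc. Q (fst bc) (snd bc)}. ?D (net_Y P) (fst bc) \<times> ?D' (net_Y P') (snd bc)) =
      {z \<in> topspace (ext_prod P P'). Q (fst z = None) (snd z = None)}"
    by (rule set_eqI) (simp add: ext_prod_def mem_Times_iff, blast)
  finally show ?thesis .
qed

lemma closedin_ext_prod_None_pattern:
  "closedin (ext_prod P P') {z \<in> topspace (ext_prod P P'). Q (fst z = None) (snd z = None)}"
proof -
  have "topspace (ext_prod P P') - {z \<in> topspace (ext_prod P P'). Q (fst z = None) (snd z = None)} =
      {z \<in> topspace (ext_prod P P'). \<not> Q (fst z = None) (snd z = None)}" by auto
  then show ?thesis
    unfolding closedin_def using openin_ext_prod_None_pattern[of P P' "\<lambda>b c. \<not> Q b c"] by auto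
qed

text \<open>The couplings are arbitrary here since the construction is used twice: with optimal
  couplings for the geodesic, and with couplings of cost zero to produce weak isomorphisms.\<close>

locale coupled_networks =
  fixes P :: "('a, 'b) network" and P' :: "('c, 'd) network"
    and \<pi>v :: "('a \<times> 'c) measure" and \<pi>e :: "('b option \<times> 'd option) measure"
  assumes P: "topological_network P" and P': "topological_network P'"
    and v: "\<pi>v \<in> couplings P P'" and e: "\<pi>e \<in> adm_couplings P P'"
begin

abbreviation "I t \<equiv> interp_network P P' \<pi>v \<pi>e t"
abbreviation "X \<equiv> interp_X P P' \<pi>v"
abbreviation "Y t \<equiv> interp_Y P P' \<pi>e t"

lemmas V = couplingsD[OF P P' v]
lemmas E = adm_couplingsD[OF P P' e]

lemma topspace_ext_prod: "topspace (ext_prod P P') = topspace (add_point (net_Y P)) \<times> topspace (add_point (net_Y P'))"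
  by (simp add: ext_prod_def)

lemma space_\<pi>v: "space \<pi>v = topspace (net_X P) \<times> topspace (net_X P')"
  using sets_eq_imp_space_eq[OF V(2)] by (simp add: space_pair_measure)

text \<open>The pairs which are not sent to the virtual point at time \<open>t\<close>, and their position in the plane,
  written as one expression by letting the virtual point contribute the projection of its partner.\<close>

definition alive :: "real \<Rightarrow> bool \<Rightarrow> bool \<Rightarrow> bool" where
  "alive t n n' \<longleftrightarrow> \<not> (n \<and> n') \<and> \<not> (t = 0 \<and> n) \<and> \<not> (t = 1 \<and> n')"

definition position :: "real \<Rightarrow> 'b option \<times> 'd option \<Rightarrow> real \<times> real" where
  "position t z =
    (1 - t) *\<^sub>R (case_option 0 (net_iota P) (fst z) + case_option 1 (\<lambda>_. 0 :: real) (fst z) *\<^sub>R Proj (case_option 0 (net_iota P') (snd z))) +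
    t *\<^sub>R (case_option 0 (net_iota P') (snd z) + case_option 1 (\<lambda>_. 0 :: real) (snd z) *\<^sub>R Proj (case_option 0 (net_iota P) (fst z)))"

text \<open>The case distinction inside the interpolation is traded for a condition on the pattern
  of virtual coordinates and a single formula that is continuous on the whole extended
  product.\<close>

lemma interp_iota_eq:
  assumes z: "z \<in> topspace (ext_prod P P')" and t: "0 \<le> t" "t \<le> 1"
  shows "interp_iota P P' t z = (if alive t (fst z = None) (snd z = None) then Some (position t z) else None)"
proof -
  obtain y y' where zy: "z = (y, y')" by (cases z)
  have y: "y = Some b \<Longrightarrow> net_iota P b \<in> Lam" "y' = Some d \<Longrightarrow> net_iota P' d \<in> Lam" for b d
    using z zy net_iota_Lam[OF P] net_iota_Lam[OF P'] by (auto simp: topspace_ext_prod topspace_add_point)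
  show ?thesis
    unfolding zy interp_iota_def
    using lam_interp_Some_None[OF y(1) t] lam_interp_None_Some[OF y(2) t] lam_interp_Some_Some[OF y(1) y(2) t]
    by (cases y; cases y') (auto simp: ext_iota_def alive_def position_def simp del: lam_interp.simps(1-3))
qed

lemma position_Lam:
  assumes z: "z \<in> topspace (ext_prod P P')" and t: "0 \<le> t" "t \<le> 1" and "alive t (fst z = None) (snd z = None)"
  shows "position t z \<in> Lam"
proof -
  have "lam_interp t (ext_iota P (fst z)) (ext_iota P' (snd z)) = Some (position t z)"
    using interp_iota_eq[OF z t] assms(4) by (cases z) (simp add: interp_iota_def)
  then show ?thesis
    by (rule lam_interp_in_Lam[OF t, rotated 2])
      (use z ext_iota_Lam[OF P] ext_iota_Lam[OF P'] in \<open>auto simp: topspace_ext_prod mem_Times_iff\<close>)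
qed

text \<open>Exhibits the edge space as the support cut by a pattern condition: it is closed in the
  product, which makes it Polish and locally compact, and relatively open in the support, which
  keeps the measure fully supported.\<close>

lemma Y_eq:
  assumes t: "0 \<le> t" "t \<le> 1"
  shows "Y t = measure_support (ext_prod P P') \<pi>e \<inter> {z \<in> topspace (ext_prod P P'). alive t (fst z = None) (snd z = None)}"
proof (rule set_eqI)
  fix z
  show "z \<in> Y t \<longleftrightarrow> z \<in> measure_support (ext_prod P P') \<pi>e \<inter> {z \<in> topspace (ext_prod P P'). alive t (fst z = None) (snd z = None)}"
  proof (cases "z \<in> topspace (ext_prod P P')")
    case True
    then show ?thesis using interp_iota_eq[OF True t] by (cases z) (auto simp: interp_Y_def alive_def)
  qed (auto simp: interp_Y_def measure_support_def)
qed

lemma closedin_X: "closedin (prod_topology (net_X P) (net_X P')) X"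
  unfolding interp_X_def by (rule closedin_measure_support)

lemma closedin_Y:
  assumes t: "0 \<le> t" "t \<le> 1" shows "closedin (ext_prod P P') (Y t)"
  unfolding Y_eq[OF t] by (intro closedin_Int closedin_measure_support closedin_ext_prod_None_pattern)

lemma X_sets: "X \<in> sets \<pi>v"
  unfolding V(2) sets_prod_vertex[OF P P', symmetric] by (rule closedin_in_borel_of[OF closedin_X])

lemma Y_sets: "0 \<le> t \<Longrightarrow> t \<le> 1 \<Longrightarrow> Y t \<in> sets \<pi>e"
  unfolding E(1) sets_ext_prod[OF P P', symmetric] by (rule closedin_in_borel_of[OF closedin_Y])

lemma Y_space: "0 \<le> t \<Longrightarrow> t \<le> 1 \<Longrightarrow> Y t \<subseteq> topspace (ext_prod P P')"
  by (auto simp: Y_eq)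

lemma AE_X: "AE x in \<pi>v. x \<in> X"
  unfolding interp_X_def using V(2) sets_prod_vertex[OF P P'] topological_networkD(13)[OF P] topological_networkD(13)[OF P']
  by (intro AE_measure_support second_countable_prod_topology) auto

lemma AE_support: "AE z in \<pi>e. z \<in> measure_support (ext_prod P P') \<pi>e \<and> z \<noteq> (None, None)"
proof -
  have "AE z in \<pi>e. z \<in> measure_support (ext_prod P P') \<pi>e"
    using E(1) sets_ext_prod[OF P P'] polish_second_countable[OF polish_ext_prod(1)[OF P P']]
    by (intro AE_measure_support) auto
  moreover have "AE z in \<pi>e. z \<noteq> (None, None)"
  proof (rule AE_I')
    show "{(None, None)} \<in> null_sets \<pi>e" using E(1,8) sets_virtual_pair by (auto simp: null_sets_def)
  qed auto
  ultimately show ?thesis by (rule AE_conjI)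
qed

lemma AE_alive:
  assumes t: "0 \<le> t" "t \<le> 1"
  shows "AE z in \<pi>e. z \<in> Y t \<longleftrightarrow> alive t (fst z = None) (snd z = None)"
  using AE_support by eventually_elim (auto simp: Y_eq[OF t] measure_support_def)

lemma continuous_map_position: "continuous_map (ext_prod P P') euclidean (position t)"
proof -
  have c: "continuous_map (net_Y P) euclidean (net_iota P)" "continuous_map (net_Y P') euclidean (net_iota P')"
    using topological_networkD(12)[OF P] topological_networkD(12)[OF P'] continuous_map_into_fulltopology by blast+
  have "continuous_map (ext_prod P P') euclidean (\<lambda>z. case_option 0 (net_iota P) (fst z))"
    "continuous_map (ext_prod P P') euclidean (\<lambda>z. case_option 0 (net_iota P') (snd z))"
    "continuous_map (ext_prod P P') euclidean (\<lambda>z. case_option 1 (\<lambda>_. 0 :: real) (fst z))"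
    "continuous_map (ext_prod P P') euclidean (\<lambda>z. case_option 1 (\<lambda>_. 0 :: real) (snd z))"
    unfolding ext_prod_def
    using continuous_map_compose[OF continuous_map_fst continuous_map_case_option[OF c(1), of 0]]
      continuous_map_compose[OF continuous_map_snd continuous_map_case_option[OF c(2), of 0]]
      continuous_map_compose[OF continuous_map_fst continuous_map_case_option[of _ euclidean "\<lambda>_. 0 :: real" 1]]
      continuous_map_compose[OF continuous_map_snd continuous_map_case_option[of _ euclidean "\<lambda>_. 0 :: real" 1]]
    by (simp_all add: comp_def)
  then show ?thesis
    unfolding position_def[abs_def] Proj_def continuous_map_atin limitin_canonical_iff
    by (intro ballI tendsto_intros) auto
qed

lemma interp_network_sel [simp]:
  "net_X (I t) = subtopology (prod_topology (net_X P) (net_X P')) X"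
  "net_k (I t) = (\<lambda>(x1, x1') (x2, x2'). (1 - t) * net_k P x1 x2 + t * net_k P' x1' x2')"
  "net_mu (I t) = restrict_space \<pi>v X"
  "net_Y (I t) = subtopology (ext_prod P P') (Y t)"
  "net_iota (I t) = (\<lambda>z. the (interp_iota P P' t z))"
  "net_nu (I t) = restrict_space \<pi>e (Y t)"
  "net_omega (I t) = (\<lambda>(x, x') (y, y'). (1 - t) * ext_omega P x y + t * ext_omega P' x' y')"
  by (simp_all add: interp_network_def)

text \<open>The difference of coordinates of an interpolant is the convex combination of those of
  its two partners, a virtual partner counting as zero. It is at most their maximum, whose
  \<open>q\<close>-th power is at most the sum of the two powers.\<close>

lemma persistence_interp_finite:
  assumes t: "0 \<le> t" "t \<le> 1" and q: "q \<ge> 1"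
  shows "(\<integral>\<^sup>+z. ennreal (lp_norm q (position t z - Proj (position t z)) powr q) \<partial>restrict_space \<pi>e (Y t)) < \<infinity>"
proof -
  define u where "u = case_option 0 (\<lambda>y. ennreal (lp_norm q (net_iota P y - Proj (net_iota P y)) powr q))"
  define u' where "u' = case_option 0 (\<lambda>y. ennreal (lp_norm q (net_iota P' y - Proj (net_iota P' y)) powr q))"
  have u: "u \<in> borel_measurable (edge_borel P)" "u' \<in> borel_measurable (edge_borel P')"
    unfolding u_def u'_def
    using measurable_compose[OF measurable_net_iota[OF P] measurable_persistence[of q]]
      measurable_compose[OF measurable_net_iota[OF P'] measurable_persistence[of q]]
    by (auto intro: measurable_case_option_add_point)
  have le: "ennreal (lp_norm q (position t z - Proj (position t z)) powr q) \<le> u (fst z) + u' (snd z)" if z: "z \<in> topspace (ext_prod P P')" for z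
  proof -
    define w where "w = case_option 0 (\<lambda>y. snd (net_iota P y) - fst (net_iota P y)) (fst z)"
    define w' where "w' = case_option 0 (\<lambda>y. snd (net_iota P' y) - fst (net_iota P' y)) (snd z)"
    have w: "0 \<le> w" "0 \<le> w'"
      using z net_iota_Lam[OF P] net_iota_Lam[OF P']
      by (auto simp: w_def w'_def topspace_ext_prod topspace_add_point Lam_def split: option.splits) fastforce+
    have "snd (position t z) - fst (position t z) = (1 - t) * w + t * w'"
      by (simp add: position_def w_def w'_def Proj_def algebra_simps split: option.splits)
    moreover have "0 \<le> (1 - t) * w + t * w'" "(1 - t) * w + t * w' \<le> max w w'"
      using w t convex_bound_le[of w "max w w'" w' "1 - t" t] by auto
    ultimately have "(\<bar>snd (position t z) - fst (position t z)\<bar> / 2) powr q \<le> (max w w' / 2) powr q"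
      using q by (intro powr_mono2) auto
    also have "\<dots> \<le> (w / 2) powr q + (w' / 2) powr q" by (auto simp: max_def)
    finally have "lp_norm q (position t z - Proj (position t z)) powr q \<le> 2 * (w / 2) powr q + 2 * (w' / 2) powr q"
      by (simp add: lp_norm_Proj_powr[OF q])
    moreover have "u (fst z) = ennreal (2 * (w / 2) powr q)" "u' (snd z) = ennreal (2 * (w' / 2) powr q)"
      using w q unfolding u_def u'_def w_def w'_def by (auto simp: lp_norm_Proj_powr[OF q] split: option.splits)
    ultimately show ?thesis by (simp add: ennreal_plus[symmetric] ennreal_leI del: ennreal_plus)
  qed
  have fin: "(\<integral>\<^sup>+z. u (fst z) \<partial>\<pi>e) < \<infinity>" "(\<integral>\<^sup>+z. u' (snd z) \<partial>\<pi>e) < \<infinity>"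
    unfolding u_def u'_def by (intro persistence_marginal_finite P P' q E; assumption)+
  have sub: "Y t \<inter> space \<pi>e = Y t" using Y_sets[OF t] sets.Int_space_eq2 by auto
  have "(\<integral>\<^sup>+z. ennreal (lp_norm q (position t z - Proj (position t z)) powr q) \<partial>restrict_space \<pi>e (Y t)) \<le>
    (\<integral>\<^sup>+z. u (fst z) + u' (snd z) \<partial>restrict_space \<pi>e (Y t))"
    using le Y_space[OF t] by (intro nn_integral_mono) (auto simp: space_restrict_space)
  also have "\<dots> = (\<integral>\<^sup>+z. (u (fst z) + u' (snd z)) * indicator (Y t) z \<partial>\<pi>e)"
    using Y_sets[OF t] by (subst nn_integral_restrict_space) (auto simp: sub)
  also have "\<dots> \<le> (\<integral>\<^sup>+z. u (fst z) + u' (snd z) \<partial>\<pi>e)"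
    by (intro nn_integral_mono) (auto split: split_indicator)
  also have "\<dots> = (\<integral>\<^sup>+z. u (fst z) \<partial>\<pi>e) + (\<integral>\<^sup>+z. u' (snd z) \<partial>\<pi>e)"
    using measurable_compose[OF E(4) u(1)] measurable_compose[OF E(5) u(2)] by (rule nn_integral_add)
  also have "\<dots> < \<infinity>" using fin by (simp add: ennreal_add_less_top)
  finally show ?thesis .
qed

lemma prob_X: "prob_space (restrict_space \<pi>v X)"
proof -
  interpret prob_space \<pi>v by (rule V(1))
  show ?thesis
    using X_sets emeasure_eq_1_AE[OF X_sets AE_X] by (rule prob_space_restrict_space)
qed

lemma ext_omega_bounds:
  assumes "topological_network R"
  obtains C where "C \<ge> 0" "\<And>x y. x \<in> topspace (net_X R) \<Longrightarrow> y \<in> topspace (add_point (net_Y R)) \<Longrightarrow> 0 \<le> ext_omega R x y \<and> ext_omega R x y \<le> C"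
proof -
  obtain C where C: "\<forall>x\<in>topspace (net_X R). \<forall>y\<in>topspace (net_Y R). net_omega R x y \<le> C"
    and nn: "\<forall>x\<in>topspace (net_X R). \<forall>y\<in>topspace (net_Y R). net_omega R x y \<ge> 0"
    using assms unfolding topological_network_def by blast
  show thesis
  proof
    show "0 \<le> max C 0" by simp
    show "0 \<le> ext_omega R x y \<and> ext_omega R x y \<le> max C 0"
      if "x \<in> topspace (net_X R)" "y \<in> topspace (add_point (net_Y R))" for x y
      using that C nn by (cases y) (auto simp: topspace_add_point le_max_iff_disj)
  qed
qed

end

context coupled_networks
begin

text \<open>Closedness of the two carriers gives the topological conditions and cutting to supports
  gives full support; the functions are convex combinations, so bounds, signs and symmetry pass over
  from the two given networks.\<close>

lemma topological_network_interp:
  assumes t: "0 \<le> t" "t \<le> 1"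
  shows "topological_network (I t)"
proof -
  have scV: "second_countable (prod_topology (net_X P) (net_X P'))"
    using topological_networkD(13)[OF P] topological_networkD(13)[OF P'] by (rule second_countable_prod_topology)
  have sV: "sets \<pi>v = sets (borel_of (prod_topology (net_X P) (net_X P')))"
    using V(2) sets_prod_vertex[OF P P'] by simp
  have sE: "sets \<pi>e = sets (borel_of (ext_prod P P'))" using E(1) sets_ext_prod[OF P P'] by simp
  have scE: "second_countable (ext_prod P P')" by (rule polish_second_countable[OF polish_ext_prod(1)[OF P P']])
  have radE: "radon_measure_on (ext_prod P P') \<pi>e" using e by (simp add: adm_couplings_def)
  have Xsub: "X \<subseteq> topspace (net_X P) \<times> topspace (net_X P')" using closedin_subset[OF closedin_X] by simp
  have Ysub: "Y t \<subseteq> topspace (add_point (net_Y P)) \<times> topspace (add_point (net_Y P'))"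
    using Y_space[OF t] by (simp add: topspace_ext_prod)
  have "polish_topology (net_X (I t))"
    using topological_networkD(1)[OF P] topological_networkD(1)[OF P']
    by (simp add: polish_topology_closedin[OF polish_topology_prod closedin_X])
  moreover have "borel_measure_on (net_X (I t)) (net_mu (I t))"
    unfolding borel_measure_on_def interp_network_sel sets_borel_of_subtopology
    by (rule sets_restrict_space_cong[OF sV])
  moreover have "prob_space (net_mu (I t))" using prob_X by simp
  moreover have "fully_supported (net_X (I t)) (net_mu (I t))"
    unfolding interp_network_sel
  proof (rule fully_supported_restrict_support[OF scV sV])
    show "X \<in> sets (borel_of (prod_topology (net_X P) (net_X P')))" using X_sets sV by simp
  qed (auto simp: interp_X_def openin_subtopology)
  moreover have "\<forall>x\<in>topspace (net_X (I t)). \<forall>x'\<in>topspace (net_X (I t)). net_k (I t) x x' = net_k (I t) x' x"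
  proof (intro ballI)
    fix x x' assume "x \<in> topspace (net_X (I t))" "x' \<in> topspace (net_X (I t))"
    then have m: "fst x \<in> topspace (net_X P)" "snd x \<in> topspace (net_X P')" "fst x' \<in> topspace (net_X P)" "snd x' \<in> topspace (net_X P')"
      by auto
    have "net_k P (fst x) (fst x') = net_k P (fst x') (fst x)"
      using P m unfolding topological_network_def by meson
    moreover have "net_k P' (snd x) (snd x') = net_k P' (snd x') (snd x)"
      using P' m unfolding topological_network_def by meson
    ultimately show "net_k (I t) x x' = net_k (I t) x' x"
      by (simp add: case_prod_unfold)
  qed
  moreover have "(\<lambda>(x, x'). net_k (I t) x x') \<in> borel_measurable (net_mu (I t) \<Otimes>\<^sub>M net_mu (I t))"
  proof -
    have f: "fst \<in> measurable (restrict_space \<pi>v X) (vertex_borel P)" "snd \<in> measurable (restrict_space \<pi>v X) (vertex_borel P')"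
      using V(3,4) by (auto intro: measurable_restrict_space1)
    have "(\<lambda>z. (fst (fst z), fst (snd z))) \<in> measurable (restrict_space \<pi>v X \<Otimes>\<^sub>M restrict_space \<pi>v X) (vertex_borel P \<Otimes>\<^sub>M vertex_borel P)"
      "(\<lambda>z. (snd (fst z), snd (snd z))) \<in> measurable (restrict_space \<pi>v X \<Otimes>\<^sub>M restrict_space \<pi>v X) (vertex_borel P' \<Otimes>\<^sub>M vertex_borel P')"
      using measurable_compose[OF measurable_fst f(1)] measurable_compose[OF measurable_snd f(1)]
        measurable_compose[OF measurable_fst f(2)] measurable_compose[OF measurable_snd f(2)]
      by (auto intro!: measurable_Pair)
    from measurable_compose[OF this(1) measurable_net_k[OF P]] measurable_compose[OF this(2) measurable_net_k[OF P']]
    show ?thesis by (simp add: case_prod_unfold)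
  qed
  moreover have "\<exists>C. \<forall>x\<in>topspace (net_X (I t)). \<forall>x'\<in>topspace (net_X (I t)). \<bar>net_k (I t) x x'\<bar> \<le> C"
  proof -
    obtain C where C: "\<And>x x'. x \<in> topspace (net_X P) \<Longrightarrow> x' \<in> topspace (net_X P) \<Longrightarrow> \<bar>net_k P x x'\<bar> \<le> C"
      using P unfolding topological_network_def by meson
    obtain C' where C': "\<And>x x'. x \<in> topspace (net_X P') \<Longrightarrow> x' \<in> topspace (net_X P') \<Longrightarrow> \<bar>net_k P' x x'\<bar> \<le> C'"
      using P' unfolding topological_network_def by meson
    have "\<bar>net_k (I t) x x'\<bar> \<le> (1 - t) * C + t * C'"
      if x: "x \<in> topspace (net_X (I t))" "x' \<in> topspace (net_X (I t))" for x x'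
    proof -
      have m: "fst x \<in> topspace (net_X P)" "snd x \<in> topspace (net_X P')" "fst x' \<in> topspace (net_X P)" "snd x' \<in> topspace (net_X P')"
        using x by auto
      have "\<bar>(1 - t) * net_k P (fst x) (fst x') + t * net_k P' (snd x) (snd x')\<bar> \<le>
        (1 - t) * \<bar>net_k P (fst x) (fst x')\<bar> + t * \<bar>net_k P' (snd x) (snd x')\<bar>"
        using t by (intro order_trans[OF abs_triangle_ineq]) (simp add: abs_mult)
      also have "\<dots> \<le> (1 - t) * C + t * C'"
        using t C[OF m(1,3)] C'[OF m(2,4)] by (intro add_mono mult_left_mono) auto
      finally show ?thesis by (simp add: case_prod_unfold)
    qed
    then show ?thesis by blast
  qed
  moreover have "polish_topology (net_Y (I t))" "locally_compact_space (net_Y (I t))"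
    using polish_topology_closedin[OF polish_ext_prod(1)[OF P P'] closedin_Y[OF t]]
      locally_compact_space_closed_subset[OF polish_ext_prod(2)[OF P P'] closedin_Y[OF t]] by simp_all
  moreover have rad: "radon_measure_on (net_Y (I t)) (net_nu (I t))"
    using radon_measure_on_restrict[OF radE Y_sets[OF t]] by simp
  moreover have "fully_supported (net_Y (I t)) (net_nu (I t))"
    unfolding interp_network_sel
  proof (rule fully_supported_restrict_support[OF scE sE])
    show "Y t \<in> sets (borel_of (ext_prod P P'))" using Y_sets[OF t] sE by simp
    show "Y t \<subseteq> measure_support (ext_prod P P') \<pi>e" by (auto simp: Y_eq[OF t])
    fix U assume "openin (subtopology (ext_prod P P') (Y t)) U"
    then obtain W where W: "openin (ext_prod P P') W" "U = W \<inter> Y t" by (auto simp: openin_subtopology)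
    \<comment> \<open>Intersecting with the open pattern condition shows \<open>U\<close> as the
      trace of an open set on the entire support, as relative openness demands.\<close>
    let ?A = "{z \<in> topspace (ext_prod P P'). alive t (fst z = None) (snd z = None)}"
    have "openin (ext_prod P P') (W \<inter> ?A)" by (intro openin_Int W openin_ext_prod_None_pattern)
    moreover have "W \<inter> ?A \<inter> measure_support (ext_prod P P') \<pi>e = U" using W(2) by (auto simp: Y_eq[OF t])
    ultimately show "\<exists>V. openin (ext_prod P P') V \<and> V \<inter> measure_support (ext_prod P P') \<pi>e = U" by blast
  qed
  moreover have cont: "continuous_map (net_Y (I t)) (top_of_set Lam) (net_iota (I t))"
  proof -
    have eq: "net_iota (I t) z = position t z" "position t z \<in> Lam" if "z \<in> Y t" for z
      using that interp_iota_eq[OF _ t, of z] position_Lam[OF _ t, of z] by (auto simp: Y_eq[OF t])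
    have "continuous_map (net_Y (I t)) euclidean (position t)"
      using continuous_map_from_subtopology[OF continuous_map_position] by simp
    then have "continuous_map (net_Y (I t)) euclidean (net_iota (I t))"
      by (rule continuous_map_eq) (use eq(1) in simp)
    then show ?thesis
      by (rule continuous_map_into_subtopology) (use eq in auto)
  qed
  moreover have "measure_persistence_diagram (distr (net_nu (I t)) (borel_of (top_of_set Lam)) (net_iota (I t)))"
  proof (rule measure_persistence_diagram_distr[OF rad cont])
    fix q :: real assume q: "q \<ge> 1"
    have "(\<integral>\<^sup>+z. ennreal (lp_norm q (net_iota (I t) z - Proj (net_iota (I t) z)) powr q) \<partial>net_nu (I t)) =
      (\<integral>\<^sup>+z. ennreal (lp_norm q (position t z - Proj (position t z)) powr q) \<partial>restrict_space \<pi>e (Y t))"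
    proof (simp only: interp_network_sel, rule nn_integral_cong)
      fix z assume "z \<in> space (restrict_space \<pi>e (Y t))"
      then have "z \<in> Y t" by (simp add: space_restrict_space)
      then have "the (interp_iota P P' t z) = position t z"
        using interp_iota_eq[OF _ t, of z] by (auto simp: Y_eq[OF t])
      then show "ennreal (lp_norm q (the (interp_iota P P' t z) - Proj (the (interp_iota P P' t z))) powr q) =
        ennreal (lp_norm q (position t z - Proj (position t z)) powr q)" by simp
    qed
    then show "(\<integral>\<^sup>+z. ennreal (lp_norm q (net_iota (I t) z - Proj (net_iota (I t) z)) powr q) \<partial>net_nu (I t)) < \<infinity>"
      using persistence_interp_finite[OF t q] by simp
  qed
  moreover have "\<forall>x\<in>topspace (net_X (I t)). \<forall>y\<in>topspace (net_Y (I t)). net_omega (I t) x y \<ge> 0"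
    "\<exists>C. \<forall>x\<in>topspace (net_X (I t)). \<forall>y\<in>topspace (net_Y (I t)). net_omega (I t) x y \<le> C"
  proof -
    obtain C where C: "C \<ge> 0" "\<And>x y. x \<in> topspace (net_X P) \<Longrightarrow> y \<in> topspace (add_point (net_Y P)) \<Longrightarrow> 0 \<le> ext_omega P x y \<and> ext_omega P x y \<le> C"
      using ext_omega_bounds[OF P] by blast
    obtain C' where C': "C' \<ge> 0" "\<And>x y. x \<in> topspace (net_X P') \<Longrightarrow> y \<in> topspace (add_point (net_Y P')) \<Longrightarrow> 0 \<le> ext_omega P' x y \<and> ext_omega P' x y \<le> C'"
      using ext_omega_bounds[OF P'] by blast
    have "0 \<le> net_omega (I t) x y \<and> net_omega (I t) x y \<le> (1 - t) * C + t * C'"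
      if xy: "x \<in> topspace (net_X (I t))" "y \<in> topspace (net_Y (I t))" for x y
    proof -
      have m: "fst x \<in> topspace (net_X P)" "snd x \<in> topspace (net_X P')"
        "fst y \<in> topspace (add_point (net_Y P))" "snd y \<in> topspace (add_point (net_Y P'))"
        using xy Ysub by (auto simp: topspace_ext_prod)
      have "0 \<le> (1 - t) * ext_omega P (fst x) (fst y) + t * ext_omega P' (snd x) (snd y)"
        using t C(2)[OF m(1,3)] C'(2)[OF m(2,4)] by simp
      moreover have "(1 - t) * ext_omega P (fst x) (fst y) + t * ext_omega P' (snd x) (snd y) \<le> (1 - t) * C + t * C'"
        using t C(2)[OF m(1,3)] C'(2)[OF m(2,4)] by (intro add_mono mult_left_mono) auto
      ultimately show ?thesis by (simp add: case_prod_unfold)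
    qed
    then show "\<forall>x\<in>topspace (net_X (I t)). \<forall>y\<in>topspace (net_Y (I t)). net_omega (I t) x y \<ge> 0"
      "\<exists>C. \<forall>x\<in>topspace (net_X (I t)). \<forall>y\<in>topspace (net_Y (I t)). net_omega (I t) x y \<le> C" by blast+
  qed
  moreover have "(\<lambda>(x, y). net_omega (I t) x y) \<in> borel_measurable (net_mu (I t) \<Otimes>\<^sub>M net_nu (I t))"
  proof -
    have f: "fst \<in> measurable (restrict_space \<pi>v X) (vertex_borel P)" "snd \<in> measurable (restrict_space \<pi>v X) (vertex_borel P')"
      "fst \<in> measurable (restrict_space \<pi>e (Y t)) (edge_borel P)" "snd \<in> measurable (restrict_space \<pi>e (Y t)) (edge_borel P')"
      using V(3,4) E(4,5) by (auto intro: measurable_restrict_space1)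
    have "(\<lambda>z. (fst (fst z), fst (snd z))) \<in> measurable (restrict_space \<pi>v X \<Otimes>\<^sub>M restrict_space \<pi>e (Y t)) (vertex_borel P \<Otimes>\<^sub>M edge_borel P)"
      "(\<lambda>z. (snd (fst z), snd (snd z))) \<in> measurable (restrict_space \<pi>v X \<Otimes>\<^sub>M restrict_space \<pi>e (Y t)) (vertex_borel P' \<Otimes>\<^sub>M edge_borel P')"
      using measurable_compose[OF measurable_fst f(1)] measurable_compose[OF measurable_snd f(3)]
        measurable_compose[OF measurable_fst f(2)] measurable_compose[OF measurable_snd f(4)]
      by (auto intro!: measurable_Pair)
    from measurable_compose[OF this(1) measurable_ext_omega[OF P]] measurable_compose[OF this(2) measurable_ext_omega[OF P']]
    show ?thesis by (simp add: case_prod_unfold)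
  qed
  ultimately show ?thesis unfolding topological_network_def by blast
qed

text \<open>The value off the support matters only up to a null set, but it has to lie in the
  carrier for the map to be measurable into the interpolating network.\<close>

definition to_vertex :: "'a \<times> 'c \<Rightarrow> 'a \<times> 'c" where
  "to_vertex m = (if m \<in> X then m else (SOME x. x \<in> X))"

text \<open>Pairs missing from the carrier go to the virtual point. Besides a null set these are the
  pairs which reach the diagonal at time 0 or 1; they may carry mass, and the virtual point is their
  true position.\<close>

definition to_edge :: "real \<Rightarrow> 'b option \<times> 'd option \<Rightarrow> ('b option \<times> 'd option) option" where
  "to_edge t z = (if z \<in> Y t then Some z else None)"

lemma parametrizes_interp:
  assumes t: "0 \<le> t" "t \<le> 1"
  shows "parametrizes (I t) \<pi>v \<pi>e to_vertex (to_edge t)"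
proof -
  note T = topological_network_interp[OF t]
  have Xsub: "X \<subseteq> space \<pi>v" using sets.sets_into_space[OF X_sets] .
  have Ysub: "Y t \<subseteq> space \<pi>e" using sets.sets_into_space[OF Y_sets[OF t]] .
  have sX: "sets (vertex_borel (I t)) = sets (restrict_space \<pi>v X)"
    using topological_networkD(4)[OF T] by simp
  have spX: "topspace (net_X (I t)) = X"
    using topological_networkD(5)[OF T] X_sets by simp
  have sY: "sets (borel_of (net_Y (I t))) = sets (restrict_space \<pi>e (Y t))"
    using topological_networkD(6)[OF T] by simp
  have spY: "topspace (net_Y (I t)) = Y t"
    using topological_networkD(7)[OF T] Y_sets[OF t] by simp
  have "X \<noteq> {}" using topological_networkD(11)[OF T] spX by simp
  then have some: "(SOME x. x \<in> X) \<in> X" by (simp add: some_in_eq)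
  have pre: "to_vertex -` A \<inter> space \<pi>v = A \<union> (if (SOME x. x \<in> X) \<in> A then space \<pi>v - X else {})" if "A \<subseteq> X" for A
    using that Xsub by (auto simp: to_vertex_def split: if_splits)
  have f: "to_vertex \<in> measurable \<pi>v (vertex_borel (I t))"
  proof (rule measurableI)
    show "to_vertex m \<in> space (vertex_borel (I t))" for m using some by (simp add: spX to_vertex_def del: interp_network_sel)
    fix A assume "A \<in> sets (vertex_borel (I t))"
    then have "A \<in> sets \<pi>v" "A \<subseteq> X" using sX X_sets by (auto simp: sets_restrict_space_iff)
    then show "to_vertex -` A \<inter> space \<pi>v \<in> sets \<pi>v" using pre X_sets by auto
  qed
  have df: "distr \<pi>v (vertex_borel (I t)) to_vertex = net_mu (I t)"
  proof (rule measure_eqI)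
    fix A assume "A \<in> sets (distr \<pi>v (vertex_borel (I t)) to_vertex)"
    then have A: "A \<in> sets (vertex_borel (I t))" by simp
    then have A': "A \<in> sets \<pi>v" "A \<subseteq> X" using sX X_sets by (auto simp: sets_restrict_space_iff)
    have "emeasure (distr \<pi>v (vertex_borel (I t)) to_vertex) A = emeasure \<pi>v (to_vertex -` A \<inter> space \<pi>v)"
      using A f by (simp add: emeasure_distr del: interp_network_sel)
    also have "\<dots> = emeasure \<pi>v A"
    proof (rule emeasure_eq_AE)
      show "AE x in \<pi>v. x \<in> to_vertex -` A \<inter> space \<pi>v \<longleftrightarrow> x \<in> A"
        using AE_X AE_space by eventually_elim (use A'(2) in \<open>auto simp: to_vertex_def\<close>)
    qed (use A' measurable_sets[OF f A] in auto)
    also have "\<dots> = emeasure (net_mu (I t)) A"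
      using A' X_sets by (simp add: emeasure_restrict_space)
    finally show "emeasure (distr \<pi>v (vertex_borel (I t)) to_vertex) A = emeasure (net_mu (I t)) A" .
  qed (simp only: sets_distr topological_networkD(4)[OF T])
  have g: "to_edge t \<in> measurable \<pi>e (edge_borel (I t))"
  proof (rule measurableI)
    show "to_edge t z \<in> space (edge_borel (I t))" for z
      by (simp add: to_edge_def topspace_add_point spY del: interp_network_sel)
    fix A assume A: "A \<in> sets (edge_borel (I t))"
    then have "{z. Some z \<in> A} \<in> sets (restrict_space \<pi>e (Y t))" unfolding sets_borel_of_add_point sY by simp
    then have S: "{z. Some z \<in> A} \<in> sets \<pi>e" "{z. Some z \<in> A} \<subseteq> Y t" using Y_sets[OF t] by (auto simp: sets_restrict_space_iff)
    have "to_edge t -` A \<inter> space \<pi>e = {z. Some z \<in> A} \<union> (if None \<in> A then space \<pi>e - Y t else {})"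
      using S(2) Ysub by (auto simp: to_edge_def split: if_splits)
    then show "to_edge t -` A \<inter> space \<pi>e \<in> sets \<pi>e" using S(1) Y_sets[OF t] by auto
  qed
  have mg: "emeasure \<pi>e (to_edge t -` (Some ` A) \<inter> space \<pi>e) = emeasure (net_nu (I t)) A" if "A \<in> sets (borel_of (net_Y (I t)))" for A
  proof -
    have A: "A \<in> sets \<pi>e" "A \<subseteq> Y t" using that Y_sets[OF t] unfolding sY by (auto simp: sets_restrict_space_iff)
    have "to_edge t -` (Some ` A) \<inter> space \<pi>e = A" using A Ysub by (auto simp: to_edge_def split: if_splits)
    then show ?thesis using A Y_sets[OF t] by (simp add: emeasure_restrict_space)
  qed
  show ?thesis unfolding parametrizes_def using V(1) E(3) f df g mg by blast
qed

text \<open>On the support a pair is dropped exactly when its interpolated position is the virtual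
  point, so one formula covers kept and dropped pairs alike, including the end times.\<close>

lemma ext_iota_to_edge:
  assumes t: "0 \<le> t" "t \<le> 1" and z: "z \<in> measure_support (ext_prod P P') \<pi>e"
  shows "ext_iota (I t) (to_edge t z) = lam_interp t (ext_iota P (fst z)) (ext_iota P' (snd z))"
proof -
  have zT: "z \<in> topspace (ext_prod P P')" using z by (simp add: measure_support_def)
  have "interp_iota P P' t z = lam_interp t (ext_iota P (fst z)) (ext_iota P' (snd z))"
    by (simp add: interp_iota_def case_prod_unfold)
  moreover have "ext_iota (I t) (to_edge t z) = interp_iota P P' t z"
    using interp_iota_eq[OF zT t] z zT by (auto simp: to_edge_def ext_iota_def Y_eq[OF t])
  ultimately show ?thesis by simp
qed

text \<open>For a dropped pair the interpolated weight is zero as well: at an end time the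
  coordinate with nonzero coefficient is virtual, and virtual edges have weight zero.\<close>

lemma ext_omega_to_edge:
  assumes t: "0 \<le> t" "t \<le> 1" and z: "z \<in> measure_support (ext_prod P P') \<pi>e"
  shows "ext_omega (I t) x (to_edge t z) = (1 - t) * ext_omega P (fst x) (fst z) + t * ext_omega P' (snd x) (snd z)"
proof -
  have zT: "z \<in> topspace (ext_prod P P')" using z by (simp add: measure_support_def)
  show ?thesis
    using z zT by (cases z) (auto simp: to_edge_def Y_eq[OF t] case_prod_unfold alive_def)
qed

text \<open>Both networks are parametrised by the same couplings, and all data are affine in time.
  Almost everywhere each integrand is \<open>(t - s) powr p\<close> times that of the original
  couplings, and the root turns this factor into \<open>t - s\<close>.\<close>

lemma d_TpOT_interp_le:
  assumes p: "p \<ge> 1" and st: "0 \<le> s" "s \<le> t" "t \<le> 1"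
  shows "d_TpOT p (I s) (I t) \<le> ennreal (t - s) * TpOT_cost p P P' \<pi>v \<pi>e"
proof -
  have s: "0 \<le> s" "s \<le> 1" and t: "0 \<le> t" "t \<le> 1" using st by auto
  interpret v: prob_space \<pi>v by (rule V(1))
  interpret e: sigma_finite_measure \<pi>e by (rule E(3))
  interpret vv: pair_sigma_finite \<pi>v \<pi>v ..
  interpret ve: pair_sigma_finite \<pi>v \<pi>e ..
  let ?c = "ennreal ((t - s) powr p)"
  let ?S = "measure_support (ext_prod P P') \<pi>e"
  have S: "?S \<in> sets \<pi>e"
    unfolding E(1) sets_ext_prod[OF P P', symmetric] by (rule closedin_in_borel_of[OF closedin_measure_support])
  have AE_vv: "AE z in \<pi>v \<Otimes>\<^sub>M \<pi>v. fst z \<in> X \<and> snd z \<in> X"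
  proof (rule vv.AE_pair_measure)
    show "{x \<in> space (\<pi>v \<Otimes>\<^sub>M \<pi>v). fst x \<in> X \<and> snd x \<in> X} \<in> sets (\<pi>v \<Otimes>\<^sub>M \<pi>v)" using X_sets by measurable
    show "AE x in \<pi>v. AE y in \<pi>v. fst (x, y) \<in> X \<and> snd (x, y) \<in> X"
      using AE_X by (auto elim: eventually_mono)
  qed
  have AE_ve: "AE z in \<pi>v \<Otimes>\<^sub>M \<pi>e. fst z \<in> X \<and> snd z \<in> ?S"
  proof (rule ve.AE_pair_measure)
    show "{x \<in> space (\<pi>v \<Otimes>\<^sub>M \<pi>e). fst x \<in> X \<and> snd x \<in> ?S} \<in> sets (\<pi>v \<Otimes>\<^sub>M \<pi>e)" using X_sets S by measurable
    have "AE y in \<pi>e. y \<in> ?S" using AE_support by eventually_elim simp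
    then show "AE x in \<pi>v. AE y in \<pi>e. fst (x, y) \<in> X \<and> snd (x, y) \<in> ?S"
      using AE_X by (auto elim: eventually_mono)
  qed
  have scale: "ennreal (\<bar>(t - s) * r\<bar> powr p) = ?c * ennreal (\<bar>r\<bar> powr p)" for r :: real
    using st by (simp add: abs_mult powr_mult ennreal_mult)
  have mV: "fst \<in> measurable \<pi>v (vertex_borel P)" "snd \<in> measurable \<pi>v (vertex_borel P')"
    and mE: "fst \<in> measurable \<pi>e (edge_borel P)" "snd \<in> measurable \<pi>e (edge_borel P')"
    by (rule V E)+
  have 1: "dist_cost p (I s) (I t) \<pi>e (to_edge s) (to_edge t) = ?c * dist_cost p P P' \<pi>e fst snd"
  proof -
    have "dist_cost p (I s) (I t) \<pi>e (to_edge s) (to_edge t) =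
      (\<integral>\<^sup>+z. ?c * ennreal (lam_dist p (ext_iota P (fst z)) (ext_iota P' (snd z)) powr p) \<partial>\<pi>e)"
      unfolding dist_cost_def
    proof (rule nn_integral_cong_AE, use AE_support in eventually_elim)
      case (elim z)
      then have z: "z \<in> ?S" and zT: "z \<in> topspace (ext_prod P P')" by (auto simp: measure_support_def)
      have "lam_dist p (ext_iota (I s) (to_edge s z)) (ext_iota (I t) (to_edge t z)) =
        (t - s) * lam_dist p (ext_iota P (fst z)) (ext_iota P' (snd z))"
        unfolding ext_iota_to_edge[OF s z] ext_iota_to_edge[OF t z]
        using zT ext_iota_Lam[OF P] ext_iota_Lam[OF P']
        by (intro lam_dist_interp p st) (auto simp: topspace_ext_prod mem_Times_iff)
      then show ?case
        using scale[of "lam_dist p (ext_iota P (fst z)) (ext_iota P' (snd z))"] st by simp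
    qed
    also have "\<dots> = ?c * dist_cost p P P' \<pi>e fst snd"
      unfolding dist_cost_def using measurable_dist_integrand[OF P P' mE] by (intro nn_integral_cmult) simp
    finally show ?thesis .
  qed
  have 2: "k_cost p (I s) (I t) \<pi>v to_vertex to_vertex = ?c * k_cost p P P' \<pi>v fst snd"
  proof -
    have "k_cost p (I s) (I t) \<pi>v to_vertex to_vertex = (\<integral>\<^sup>+z. ?c *
      ennreal (\<bar>net_k P (fst (fst z)) (fst (snd z)) - net_k P' (snd (fst z)) (snd (snd z))\<bar> powr p) \<partial>(\<pi>v \<Otimes>\<^sub>M \<pi>v))"
      unfolding k_cost_def
    proof (rule nn_integral_cong_AE, use AE_vv in eventually_elim)
      case (elim z)
      have "net_k (I s) (fst z) (snd z) - net_k (I t) (fst z) (snd z) =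
        (t - s) * (net_k P (fst (fst z)) (fst (snd z)) - net_k P' (snd (fst z)) (snd (snd z)))"
        by (simp add: case_prod_unfold algebra_simps)
      then show ?case using elim unfolding scale[symmetric] by (simp add: to_vertex_def del: interp_network_sel)
    qed
    also have "\<dots> = ?c * k_cost p P P' \<pi>v fst snd"
      unfolding k_cost_def using measurable_k_integrand[OF P P' mV] by (intro nn_integral_cmult) simp
    finally show ?thesis .
  qed
  have 3: "omega_cost p (I s) (I t) \<pi>v \<pi>e to_vertex to_vertex (to_edge s) (to_edge t) = ?c * omega_cost p P P' \<pi>v \<pi>e fst snd fst snd"
  proof -
    have "omega_cost p (I s) (I t) \<pi>v \<pi>e to_vertex to_vertex (to_edge s) (to_edge t) = (\<integral>\<^sup>+z. ?c *
      ennreal (\<bar>ext_omega P (fst (fst z)) (fst (snd z)) - ext_omega P' (snd (fst z)) (snd (snd z))\<bar> powr p) \<partial>(\<pi>v \<Otimes>\<^sub>M \<pi>e))"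
      unfolding omega_cost_def
    proof (rule nn_integral_cong_AE, use AE_ve in eventually_elim)
      case (elim z)
      have "ext_omega (I s) (fst z) (to_edge s (snd z)) - ext_omega (I t) (fst z) (to_edge t (snd z)) =
        (t - s) * (ext_omega P (fst (fst z)) (fst (snd z)) - ext_omega P' (snd (fst z)) (snd (snd z)))"
        using elim by (simp add: ext_omega_to_edge[OF s] ext_omega_to_edge[OF t] algebra_simps del: interp_network_sel)
      then show ?case using elim unfolding scale[symmetric] by (simp add: to_vertex_def del: interp_network_sel)
    qed
    also have "\<dots> = ?c * omega_cost p P P' \<pi>v \<pi>e fst snd fst snd"
      unfolding omega_cost_def using measurable_omega_integrand[OF P P' mV mE] by (intro nn_integral_cmult) simp
    finally show ?thesis .
  qed
  have "total_cost p (I s) (I t) \<pi>v \<pi>e to_vertex to_vertex (to_edge s) (to_edge t) = ?c * total_cost p P P' \<pi>v \<pi>e fst snd fst snd"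
    unfolding total_cost_def 1 2 3 by (simp add: distrib_left)
  then show ?thesis
    using d_TpOT_le[OF p topological_network_interp[OF s] topological_network_interp[OF t] parametrizes_interp[OF s] parametrizes_interp[OF t]]
      ennreal_powr_cmult[OF p, of "t - s"] st
    by (simp add: TpOT_cost_eq_total_cost)
qed

end

section \<open>Weak isomorphisms from interpolating networks\<close>

text \<open>The exceptional set is handled through its sections: an almost everywhere statement in
  each variable can be restricted separately and then reassembled on the product of the restricted
  measures.\<close>

lemma AE_pair_restrict_space:
  assumes M: "sigma_finite_measure M" and N: "sigma_finite_measure N" and A: "A \<in> sets M" and B: "B \<in> sets N"
    and AE: "AE z in M \<Otimes>\<^sub>M N. fst z \<in> A \<longrightarrow> snd z \<in> B \<longrightarrow> Q z"
  shows "AE z in restrict_space M A \<Otimes>\<^sub>M restrict_space N B. Q z"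
proof -
  interpret MN: pair_sigma_finite M N using M N by (simp add: pair_sigma_finite_def)
  interpret RS: pair_sigma_finite "restrict_space M A" "restrict_space N B"
    using sigma_finite_measure_restrict_space[OF M A] sigma_finite_measure_restrict_space[OF N B]
    by (simp add: pair_sigma_finite_def)
  have id: "(\<lambda>z. (fst z, snd z)) \<in> measurable (restrict_space M A \<Otimes>\<^sub>M restrict_space N B) (M \<Otimes>\<^sub>M N)"
    using measurable_compose[OF measurable_fst measurable_restrict_space1[of "\<lambda>x. x" M M A]]
      measurable_compose[OF measurable_snd measurable_restrict_space1[of "\<lambda>x. x" N N B]]
    by (intro measurable_Pair) auto
  \<comment> \<open>\<open>Q\<close> need not be measurable; the measurable null set
    \<open>Z\<close> is what permits the return from sections to the product.\<close>
  obtain Z where Z: "Z \<in> null_sets (M \<Otimes>\<^sub>M N)" "{z \<in> space (M \<Otimes>\<^sub>M N). \<not> (fst z \<in> A \<longrightarrow> snd z \<in> B \<longrightarrow> Q z)} \<subseteq> Z"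
    using AE unfolding eventually_ae_filter by blast
  have "AE z in M \<Otimes>\<^sub>M N. z \<notin> Z" using Z(1) by (rule AE_not_in)
  then have "AE x in M. AE y in N. (x, y) \<notin> Z" by (rule MN.AE_pair)
  then have "AE x in restrict_space M A. AE y in N. (x, y) \<notin> Z"
    using A sets.Int_space_eq2[OF A] by (subst AE_restrict_space_iff) auto
  then have "AE x in restrict_space M A. AE y in restrict_space N B. (x, y) \<notin> Z"
    using B sets.Int_space_eq2[OF B] by (subst AE_restrict_space_iff) (auto elim: eventually_mono)
  moreover have "{z \<in> space (restrict_space M A \<Otimes>\<^sub>M restrict_space N B). z \<notin> Z} \<in> sets (restrict_space M A \<Otimes>\<^sub>M restrict_space N B)"
  proof -
    have "(\<lambda>z. (fst z, snd z)) -` Z \<inter> space (restrict_space M A \<Otimes>\<^sub>M restrict_space N B) \<in> sets (restrict_space M A \<Otimes>\<^sub>M restrict_space N B)"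
      using Z(1) by (intro measurable_sets[OF id]) auto
    then have "space (restrict_space M A \<Otimes>\<^sub>M restrict_space N B) - ((\<lambda>z. (fst z, snd z)) -` Z \<inter> space (restrict_space M A \<Otimes>\<^sub>M restrict_space N B))
      \<in> sets (restrict_space M A \<Otimes>\<^sub>M restrict_space N B)" by (intro sets.Diff sets.top)
    also have "space (restrict_space M A \<Otimes>\<^sub>M restrict_space N B) - ((\<lambda>z. (fst z, snd z)) -` Z \<inter> space (restrict_space M A \<Otimes>\<^sub>M restrict_space N B)) =
      {z \<in> space (restrict_space M A \<Otimes>\<^sub>M restrict_space N B). z \<notin> Z}" by auto
    finally show ?thesis .
  qed
  ultimately have "AE z in restrict_space M A \<Otimes>\<^sub>M restrict_space N B. z \<notin> Z"
    by (intro RS.AE_pair_measure)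
  then show ?thesis using AE_space
  proof eventually_elim
    case (elim z)
    then have "z \<in> space (M \<Otimes>\<^sub>M N)" "fst z \<in> A" "snd z \<in> B"
      by (auto simp: space_pair_measure space_restrict_space)
    then show ?case using elim(1) Z(2) by blast
  qed
qed

context coupled_networks
begin

text \<open>A parametrisation by the couplings whose virtual part agrees with the dropped pairs
  becomes a weak isomorphism once both are removed. \<open>some\<close> is required at every point,
  since \<open>the (F z)\<close> has to land in the edge space; the converse \<open>ae\<close> is
  required only almost everywhere, to preserve mass.\<close>

lemma weak_isomorphism_interp:
  assumes t: "0 \<le> t" "t \<le> 1" and R: "topological_network R" and par: "parametrizes R \<pi>v \<pi>e f F"
    and some: "\<And>z. z \<in> Y t \<Longrightarrow> F z \<noteq> None" and ae: "AE z in \<pi>e. F z \<noteq> None \<longrightarrow> z \<in> Y t"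
    and iota: "AE z in \<pi>e. z \<in> Y t \<longrightarrow> net_iota (I t) z = net_iota R (the (F z))"
    and k: "AE z in \<pi>v \<Otimes>\<^sub>M \<pi>v. net_k (I t) (fst z) (snd z) = net_k R (f (fst z)) (f (snd z))"
    and omega: "AE z in \<pi>v \<Otimes>\<^sub>M \<pi>e. snd z \<in> Y t \<longrightarrow> net_omega (I t) (fst z) (snd z) = net_omega R (f (fst z)) (the (F (snd z)))"
  shows "weak_isomorphism (I t) R f (\<lambda>z. the (F z))"
proof -
  have f: "f \<in> measurable \<pi>v (vertex_borel R)" and df: "distr \<pi>v (vertex_borel R) f = net_mu R"
    and F: "F \<in> measurable \<pi>e (edge_borel R)"
    and mF: "\<And>A. A \<in> sets (borel_of (net_Y R)) \<Longrightarrow> emeasure \<pi>e (F -` (Some ` A) \<inter> space \<pi>e) = emeasure (net_nu R) A"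
    using par by (auto simp: parametrizes_def)
  note sR = topological_networkD(4,6)[OF R]
  interpret v: prob_space \<pi>v by (rule V(1))
  have f': "f \<in> measurable (restrict_space \<pi>v X) (net_mu R)"
    using measurable_restrict_space1[OF f] measurable_cong_sets[OF refl sR(1)] by blast
  have mv: "measure_preserving (restrict_space \<pi>v X) (net_mu R) f"
    unfolding measure_preserving_def
  proof (intro conjI f' measure_eqI)
    fix A assume "A \<in> sets (distr (restrict_space \<pi>v X) (net_mu R) f)"
    then have A: "A \<in> sets (net_mu R)" by simp
    then have A': "A \<in> sets (vertex_borel R)" using sR by simp
    have sp: "space (restrict_space \<pi>v X) = X" using X_sets by simp
    have m: "f -` A \<inter> space \<pi>v \<in> sets \<pi>v" using measurable_sets[OF f A'] .
    have "f -` A \<inter> X = (f -` A \<inter> space \<pi>v) \<inter> X" using sets.sets_into_space[OF X_sets] by auto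
    then have m': "f -` A \<inter> X \<in> sets \<pi>v" using m X_sets by (simp add: sets.Int)
    have "emeasure (distr (restrict_space \<pi>v X) (net_mu R) f) A = emeasure (restrict_space \<pi>v X) (f -` A \<inter> X)"
      using A f' by (simp add: emeasure_distr sp)
    also have "\<dots> = emeasure \<pi>v (f -` A \<inter> X)"
      using X_sets sets.Int_space_eq2[OF X_sets] by (intro emeasure_restrict_space) auto
    also have "\<dots> = emeasure \<pi>v (f -` A \<inter> space \<pi>v)"
    proof (rule emeasure_eq_AE[OF _ m' m])
      show "AE x in \<pi>v. x \<in> f -` A \<inter> X \<longleftrightarrow> x \<in> f -` A \<inter> space \<pi>v"
        using AE_X AE_space by eventually_elim auto
    qed
    also have "\<dots> = emeasure (net_mu R) A" using A' f by (simp add: emeasure_distr df[symmetric])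
    finally show "emeasure (distr (restrict_space \<pi>v X) (net_mu R) f) A = emeasure (net_mu R) A" .
  qed simp
  have Yt: "Y t \<in> sets \<pi>e" by (rule Y_sets[OF t])
  have sp: "space (restrict_space \<pi>e (Y t)) = Y t" using Yt by simp
  have F': "(\<lambda>z. the (F z)) \<in> measurable (restrict_space \<pi>e (Y t)) (net_nu R)"
  proof -
    have "F \<in> measurable (restrict_space \<pi>e (Y t)) (restrict_space (edge_borel R) (- {None}))"
      using some by (intro measurable_restrict_space3 F) auto
    then have "(\<lambda>z. the (F z)) \<in> measurable (restrict_space \<pi>e (Y t)) (borel_of (net_Y R))"
      using measurable_the_restrict by (rule measurable_compose)
    then show ?thesis using measurable_cong_sets[OF refl sR(2)] by blast
  qed
  have me: "measure_preserving (restrict_space \<pi>e (Y t)) (net_nu R) (\<lambda>z. the (F z))"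
    unfolding measure_preserving_def
  proof (intro conjI F' measure_eqI)
    fix A assume "A \<in> sets (distr (restrict_space \<pi>e (Y t)) (net_nu R) (\<lambda>z. the (F z)))"
    then have A: "A \<in> sets (net_nu R)" by simp
    then have A': "A \<in> sets (borel_of (net_Y R))" using sR by simp
    have m: "F -` (Some ` A) \<inter> space \<pi>e \<in> sets \<pi>e" using measurable_sets[OF F Some_image_in_sets[OF A']] .
    have eq: "(\<lambda>z. the (F z)) -` A \<inter> Y t = (F -` (Some ` A) \<inter> space \<pi>e) \<inter> Y t"
      using sets.sets_into_space[OF Yt] some by force
    then have m': "(\<lambda>z. the (F z)) -` A \<inter> Y t \<in> sets \<pi>e" using m Yt by (simp add: sets.Int)
    have "emeasure (distr (restrict_space \<pi>e (Y t)) (net_nu R) (\<lambda>z. the (F z))) A = emeasure (restrict_space \<pi>e (Y t)) ((\<lambda>z. the (F z)) -` A \<inter> Y t)"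
      using A F' by (simp add: emeasure_distr sp)
    also have "\<dots> = emeasure \<pi>e ((\<lambda>z. the (F z)) -` A \<inter> Y t)"
      using Yt sets.Int_space_eq2[OF Yt] by (intro emeasure_restrict_space) auto
    also have "\<dots> = emeasure \<pi>e (F -` (Some ` A) \<inter> space \<pi>e)"
    proof (rule emeasure_eq_AE[OF _ m' m])
      show "AE x in \<pi>e. x \<in> (\<lambda>z. the (F z)) -` A \<inter> Y t \<longleftrightarrow> x \<in> F -` (Some ` A) \<inter> space \<pi>e"
        using ae AE_space by eventually_elim (unfold eq, auto)
    qed
    also have "\<dots> = emeasure (net_nu R) A" by (rule mF[OF A'])
    finally show "emeasure (distr (restrict_space \<pi>e (Y t)) (net_nu R) (\<lambda>z. the (F z))) A = emeasure (net_nu R) A" .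
  qed simp
  have i: "AE z in restrict_space \<pi>e (Y t). net_iota (I t) z = net_iota R (the (F z))"
    using iota Yt sets.Int_space_eq2[OF Yt] by (subst AE_restrict_space_iff) auto
  have k': "AE z in restrict_space \<pi>v X \<Otimes>\<^sub>M restrict_space \<pi>v X. net_k (I t) (fst z) (snd z) = net_k R (f (fst z)) (f (snd z))"
    using k by (intro AE_pair_restrict_space v.sigma_finite_measure_axioms X_sets) (auto elim: eventually_mono)
  have o': "AE z in restrict_space \<pi>v X \<Otimes>\<^sub>M restrict_space \<pi>e (Y t). net_omega (I t) (fst z) (snd z) = net_omega R (f (fst z)) (the (F (snd z)))"
    using omega by (intro AE_pair_restrict_space v.sigma_finite_measure_axioms X_sets Yt E(3)) (auto elim: eventually_mono)
  show ?thesis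
    unfolding weak_isomorphism_def using mv me i k' o'
    by (simp only: interp_network_sel(3,6) case_prod_unfold simp_thms)
qed

text \<open>At time 0 the dropped pairs are those whose first coordinate is virtual, and the data
  depend on the first coordinates only.\<close>

lemma weak_isomorphism_interp_0: "weak_isomorphism (I 0) P fst (\<lambda>z. the (fst z))"
proof (rule weak_isomorphism_interp[OF _ _ P parametrizes_couplings(1)[OF P P' v e]])
  have "AE z in \<pi>e. z \<in> Y 0 \<longleftrightarrow> alive 0 (fst z = None) (snd z = None)" by (rule AE_alive) auto
  then show "AE z in \<pi>e. fst z \<noteq> None \<longrightarrow> z \<in> Y 0"
    by eventually_elim (simp add: alive_def)
  show nn: "fst z \<noteq> None" if "z \<in> Y 0" for z
    using that by (auto simp: Y_eq alive_def)
  show "AE z in \<pi>e. z \<in> Y 0 \<longrightarrow> net_iota (I 0) z = net_iota P (the (fst z))"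
  proof (rule AE_I2, rule impI)
    fix z assume z: "z \<in> Y 0"
    then have "net_iota (I 0) z = position 0 z"
      using interp_iota_eq[of z 0] by (auto simp: Y_eq)
    also have "\<dots> = net_iota P (the (fst z))" using nn[OF z] by (auto simp: position_def)
    finally show "net_iota (I 0) z = net_iota P (the (fst z))" .
  qed
  show "AE z in \<pi>v \<Otimes>\<^sub>M \<pi>e. snd z \<in> Y 0 \<longrightarrow> net_omega (I 0) (fst z) (snd z) = net_omega P (fst (fst z)) (the (fst (snd z)))"
  proof (rule AE_I2, rule impI)
    fix z :: "('a \<times> 'c) \<times> ('b option \<times> 'd option)" assume "snd z \<in> Y 0"
    then obtain y where "fst (snd z) = Some y" using nn by blast
    then show "net_omega (I 0) (fst z) (snd z) = net_omega P (fst (fst z)) (the (fst (snd z)))"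
      by (simp add: case_prod_unfold)
  qed
qed (auto simp: case_prod_unfold)

lemma weak_isomorphism_interp_1: "weak_isomorphism (I 1) P' snd (\<lambda>z. the (snd z))"
proof (rule weak_isomorphism_interp[OF _ _ P' parametrizes_couplings(2)[OF P P' v e]])
  have "AE z in \<pi>e. z \<in> Y 1 \<longleftrightarrow> alive 1 (fst z = None) (snd z = None)" by (rule AE_alive) auto
  then show "AE z in \<pi>e. snd z \<noteq> None \<longrightarrow> z \<in> Y 1"
    by eventually_elim (simp add: alive_def)
  show nn: "snd z \<noteq> None" if "z \<in> Y 1" for z
    using that by (auto simp: Y_eq alive_def)
  show "AE z in \<pi>e. z \<in> Y 1 \<longrightarrow> net_iota (I 1) z = net_iota P' (the (snd z))"
  proof (rule AE_I2, rule impI)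
    fix z assume z: "z \<in> Y 1"
    then have "net_iota (I 1) z = position 1 z"
      using interp_iota_eq[of z 1] by (auto simp: Y_eq)
    also have "\<dots> = net_iota P' (the (snd z))" using nn[OF z] by (auto simp: position_def)
    finally show "net_iota (I 1) z = net_iota P' (the (snd z))" .
  qed
  show "AE z in \<pi>v \<Otimes>\<^sub>M \<pi>e. snd z \<in> Y 1 \<longrightarrow> net_omega (I 1) (fst z) (snd z) = net_omega P' (snd (fst z)) (the (snd (snd z)))"
  proof (rule AE_I2, rule impI)
    fix z :: "('a \<times> 'c) \<times> ('b option \<times> 'd option)" assume "snd z \<in> Y 1"
    then obtain y where "snd (snd z) = Some y" using nn by blast
    then show "net_omega (I 1) (fst z) (snd z) = net_omega P' (snd (fst z)) (the (snd (snd z)))"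
      by (simp add: case_prod_unfold)
  qed
qed (auto simp: case_prod_unfold)

text \<open>Points of \<open>Lam\<close> lie off the diagonal, so zero cost excludes pairs with
  exactly one virtual coordinate and identifies the remaining data almost everywhere. Hence the
  second projection from the network at time 0 is a weak isomorphism too, beside the first
  one.\<close>

lemma weak_isomorphism_zero_cost:
  assumes p: "p \<ge> 1" and zero: "TpOT_cost p P P' \<pi>v \<pi>e = 0"
  shows "weak_isomorphism (I 0) P' snd (\<lambda>z. the (snd z))"
proof -
  have mV: "fst \<in> measurable \<pi>v (vertex_borel P)" "snd \<in> measurable \<pi>v (vertex_borel P')"
    and mE: "fst \<in> measurable \<pi>e (edge_borel P)" "snd \<in> measurable \<pi>e (edge_borel P')"
    by (rule V E)+
  have z: "dist_cost p P P' \<pi>e fst snd = 0" "k_cost p P P' \<pi>v fst snd = 0" "omega_cost p P P' \<pi>v \<pi>e fst snd fst snd = 0"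
    using zero unfolding TpOT_cost_eq_total_cost ennreal_powr_eq_0 total_cost_def by auto
  have "AE z in \<pi>e. ennreal (lam_dist p (ext_iota P (fst z)) (ext_iota P' (snd z)) powr p) = 0"
    using z(1) measurable_dist_integrand[OF P P' mE, of p] unfolding dist_cost_def by (subst (asm) nn_integral_0_iff_AE) auto
  then have i: "AE z in \<pi>e. fst z \<noteq> None \<and> snd z \<noteq> None \<and> net_iota P (the (fst z)) = net_iota P' (the (snd z))"
    using AE_support
  proof eventually_elim
    case (elim z)
    then have zT: "z \<in> topspace (ext_prod P P')" by (auto simp: measure_support_def)
    have 0: "lam_dist p (ext_iota P (fst z)) (ext_iota P' (snd z)) = 0" using elim(1) by simp
    have L: "l - Proj l \<noteq> 0" if "l \<in> Lam" for l using that by (auto simp: Lam_def Proj_def)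
    obtain y y' where zy: "z = (y, y')" by (cases z)
    have y: "y = Some b \<Longrightarrow> net_iota P b \<in> Lam" "y' = Some d \<Longrightarrow> net_iota P' d \<in> Lam" for b d
      using zT zy net_iota_Lam[OF P] net_iota_Lam[OF P'] by (auto simp: topspace_ext_prod topspace_add_point)
    show ?case
      using 0 elim(2) y L unfolding zy
      by (cases y; cases y') (auto simp: ext_iota_def lp_norm_eq_0[OF p])
  qed
  have k: "AE z in \<pi>v \<Otimes>\<^sub>M \<pi>v. net_k P (fst (fst z)) (fst (snd z)) = net_k P' (snd (fst z)) (snd (snd z))"
  proof -
    have "AE z in \<pi>v \<Otimes>\<^sub>M \<pi>v. ennreal (\<bar>net_k P (fst (fst z)) (fst (snd z)) - net_k P' (snd (fst z)) (snd (snd z))\<bar> powr p) = 0"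
      using z(2) measurable_k_integrand[OF P P' mV] unfolding k_cost_def by (subst (asm) nn_integral_0_iff_AE) auto
    then show ?thesis by eventually_elim simp
  qed
  have o: "AE z in \<pi>v \<Otimes>\<^sub>M \<pi>e. ext_omega P (fst (fst z)) (fst (snd z)) = ext_omega P' (snd (fst z)) (snd (snd z))"
  proof -
    have "AE z in \<pi>v \<Otimes>\<^sub>M \<pi>e. ennreal (\<bar>ext_omega P (fst (fst z)) (fst (snd z)) - ext_omega P' (snd (fst z)) (snd (snd z))\<bar> powr p) = 0"
      using z(3) measurable_omega_integrand[OF P P' mV mE] unfolding omega_cost_def by (subst (asm) nn_integral_0_iff_AE) auto
    then show ?thesis by eventually_elim simp
  qed
  \<comment> \<open>Upgrades an almost everywhere property to every point of \<open>Y 0\<close>: the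
    forbidden pattern is an open set, and a null open set misses the support.\<close>
  have nn: "fst z \<noteq> None \<and> snd z \<noteq> None" if "z \<in> Y 0" for z
  proof -
    let ?U = "{z \<in> topspace (ext_prod P P'). \<not> fst z = None \<and> snd z = None}"
    have U: "openin (ext_prod P P') ?U"
      using openin_ext_prod_None_pattern[of P P' "\<lambda>b c. \<not> b \<and> c"] .
    have "emeasure \<pi>e {z \<in> space \<pi>e. \<not> fst z = None \<and> snd z = None} = 0"
    proof (rule emeasure_eq_0_AE)
      show "AE z in \<pi>e. \<not> (\<not> fst z = None \<and> snd z = None)" using i by eventually_elim auto
    qed
    then have "emeasure \<pi>e ?U = 0" by (simp add: E(2) topspace_ext_prod)
    then have "?U \<inter> measure_support (ext_prod P P') \<pi>e = {}" by (rule null_openin_Int_measure_support[OF U])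
    then show ?thesis using that by (auto simp: Y_eq alive_def)
  qed
  show ?thesis
  proof (rule weak_isomorphism_interp[OF _ _ P' parametrizes_couplings(2)[OF P P' v e]])
    have "AE z in \<pi>e. z \<in> Y 0 \<longleftrightarrow> alive 0 (fst z = None) (snd z = None)" by (rule AE_alive) auto
    then show "AE z in \<pi>e. snd z \<noteq> None \<longrightarrow> z \<in> Y 0"
      using i by eventually_elim (simp add: alive_def)
    show "snd z \<noteq> None" if "z \<in> Y 0" for z using nn[OF that] by simp
    show "AE z in \<pi>e. z \<in> Y 0 \<longrightarrow> net_iota (I 0) z = net_iota P' (the (snd z))"
      using i
    proof eventually_elim
      case (elim z)
      show ?case
      proof
        assume z: "z \<in> Y 0"
        then have "net_iota (I 0) z = position 0 z"
          using interp_iota_eq[of z 0] by (auto simp: Y_eq)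
        also have "\<dots> = net_iota P (the (fst z))" using nn[OF z] by (auto simp: position_def)
        finally show "net_iota (I 0) z = net_iota P' (the (snd z))" using elim by simp
      qed
    qed
    show "AE z in \<pi>v \<Otimes>\<^sub>M \<pi>v. net_k (I 0) (fst z) (snd z) = net_k P' (snd (fst z)) (snd (snd z))"
      using k by eventually_elim (simp add: case_prod_unfold)
    show "AE z in \<pi>v \<Otimes>\<^sub>M \<pi>e. snd z \<in> Y 0 \<longrightarrow> net_omega (I 0) (fst z) (snd z) = net_omega P' (snd (fst z)) (the (snd (snd z)))"
      using o
    proof eventually_elim
      case (elim z)
      show ?case
      proof
        assume "snd z \<in> Y 0"
        then obtain y where "snd (snd z) = Some y" using nn by blast
        then show "net_omega (I 0) (fst z) (snd z) = net_omega P' (snd (fst z)) (the (snd (snd z)))"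
          using elim by (simp add: case_prod_unfold)
      qed
    qed
  qed simp_all
qed

end

section \<open>Copies of networks on subsets of a fixed type\<close>

text \<open>In a Hausdorff space the basic open sets around a point determine it, so the code is
  injective; pulling the topology back along the decoding map makes it a homeomorphism.\<close>

lemma homeomorphic_small_topology:
  assumes "polish_topology T"
  obtains T' :: "nat set topology" and h g where "homeomorphic_maps T' T h g"
proof -
  obtain B where B: "\<And>n. openin T (B n)" "\<And>U x. openin T U \<Longrightarrow> x \<in> U \<Longrightarrow> \<exists>n::nat. x \<in> B n \<and> B n \<subseteq> U"
    using second_countable_sequence[OF polish_second_countable[OF assms]] by blast
  define g where "g x = {n. x \<in> B n}" for x
  have haus: "Hausdorff_space T"
    using assms completely_metrizable_imp_metrizable_space metrizable_imp_Hausdorff_space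
    by (auto simp: polish_topology_def)
  have inj: "inj_on g (topspace T)"
  proof (rule inj_onI, rule ccontr)
    fix x y assume xy: "x \<in> topspace T" "y \<in> topspace T" "g x = g y" "x \<noteq> y"
    then obtain U V where U: "openin T U" "openin T V" "x \<in> U" "y \<in> V" "disjnt U V"
      using haus unfolding Hausdorff_space_def by metis
    then obtain n where "x \<in> B n" "B n \<subseteq> U" using B by blast
    moreover have "y \<in> B n" using xy(3) \<open>x \<in> B n\<close> by (auto simp: g_def)
    ultimately show False using U by (auto simp: disjnt_iff)
  qed
  define h where "h = inv_into (topspace T) g"
  have hg: "h (g x) = x" if "x \<in> topspace T" for x using inj that by (simp add: h_def)
  define T' where "T' = pullback_topology (g ` topspace T) h T"
  have T': "topspace T' = g ` topspace T"
    unfolding T'_def topspace_pullback_topology using hg by auto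
  have "homeomorphic_maps T' T h g"
    unfolding homeomorphic_maps_def
  proof (intro conjI ballI)
    show "continuous_map T' T h"
      using continuous_map_pullback[OF continuous_map_id, of "g ` topspace T" h T] by (simp add: T'_def)
    show "continuous_map T T' g"
      unfolding T'_def
    proof (rule continuous_map_pullback')
      have "continuous_map T T (\<lambda>x. x)" by simp
      then show "continuous_map T T (h \<circ> g)" by (rule continuous_map_eq) (simp add: hg)
    qed auto
  qed (auto simp: T' hg)
  then show thesis by (rule that)
qed

section \<open>Composition of weak isomorphisms\<close>

text \<open>The product of the image measures is the image of the product under the pair of maps, so
  almost everywhere statements pull back along both variables simultaneously.\<close>

lemma AE_pair_distrD:
  assumes h: "h \<in> measurable M M'" "distr M M' h = M'" and g: "g \<in> measurable N N'" "distr N N' g = N'"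
    and N': "sigma_finite_measure N'" and AE: "AE z in M' \<Otimes>\<^sub>M N'. Q (fst z) (snd z)"
  shows "AE z in M \<Otimes>\<^sub>M N. Q (h (fst z)) (g (snd z))"
proof -
  have eq: "M' \<Otimes>\<^sub>M N' = distr (M \<Otimes>\<^sub>M N) (M' \<Otimes>\<^sub>M N') (\<lambda>(x, y). (h x, g y))"
    using pair_measure_distr[OF h(1) g(1)] N' h(2) g(2) by simp
  have hg: "(\<lambda>(x, y). (h x, g y)) \<in> measurable (M \<Otimes>\<^sub>M N) (M' \<Otimes>\<^sub>M N')"
    using h(1) g(1) by measurable
  have "AE z in distr (M \<Otimes>\<^sub>M N) (M' \<Otimes>\<^sub>M N') (\<lambda>(x, y). (h x, g y)). Q (fst z) (snd z)"
    using AE by (subst (asm) eq)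
  from AE_distrD[OF hg this] show ?thesis by (simp add: case_prod_unfold)
qed

lemma weak_isomorphism_comp:
  assumes Q: "topological_network Q" and P: "topological_network P" and R: "topological_network R"
    and w: "weak_isomorphism Q P h g" and w': "weak_isomorphism P R \<phi> \<psi>"
  shows "weak_isomorphism Q R (\<phi> \<circ> h) (\<psi> \<circ> g)"
proof -
  have m: "h \<in> measurable (net_mu Q) (net_mu P)" "distr (net_mu Q) (net_mu P) h = net_mu P"
    "g \<in> measurable (net_nu Q) (net_nu P)" "distr (net_nu Q) (net_nu P) g = net_nu P"
    "\<phi> \<in> measurable (net_mu P) (net_mu R)" "distr (net_mu P) (net_mu R) \<phi> = net_mu R"
    "\<psi> \<in> measurable (net_nu P) (net_nu R)" "distr (net_nu P) (net_nu R) \<psi> = net_nu R"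
    using w w' by (auto simp: weak_isomorphism_def measure_preserving_def)
  have mp: "measure_preserving (net_mu Q) (net_mu R) (\<phi> \<circ> h)" "measure_preserving (net_nu Q) (net_nu R) (\<psi> \<circ> g)"
    unfolding measure_preserving_def
    using measurable_comp[OF m(1,5)] measurable_comp[OF m(3,7)] distr_distr[OF m(5,1)] distr_distr[OF m(7,3)] m(2,4,6,8) by auto
  interpret mu: prob_space "net_mu P" by (rule topological_networkD(8)[OF P])
  interpret nu: sigma_finite_measure "net_nu P" by (rule topological_networkD(10)[OF P])
  have i: "AE y in net_nu Q. net_iota Q y = net_iota R ((\<psi> \<circ> g) y)"
  proof -
    have "AE y in distr (net_nu Q) (net_nu P) g. net_iota P y = net_iota R (\<psi> y)"
      using w' unfolding m(4) by (simp add: weak_isomorphism_def)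
    from AE_distrD[OF m(3) this] have "AE y in net_nu Q. net_iota P (g y) = net_iota R (\<psi> (g y))" .
    moreover have "AE y in net_nu Q. net_iota Q y = net_iota P (g y)" using w by (simp add: weak_isomorphism_def)
    ultimately show ?thesis by eventually_elim simp
  qed
  have o: "AE z in net_mu Q \<Otimes>\<^sub>M net_nu Q. net_omega Q (fst z) (snd z) = net_omega R ((\<phi> \<circ> h) (fst z)) ((\<psi> \<circ> g) (snd z))"
  proof -
    have "AE z in net_mu Q \<Otimes>\<^sub>M net_nu Q. net_omega P (h (fst z)) (g (snd z)) = net_omega R (\<phi> (h (fst z))) (\<psi> (g (snd z)))"
      using w' by (intro AE_pair_distrD[OF m(1-4) nu.sigma_finite_measure_axioms]) (simp add: weak_isomorphism_def case_prod_unfold)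
    moreover have "AE z in net_mu Q \<Otimes>\<^sub>M net_nu Q. net_omega Q (fst z) (snd z) = net_omega P (h (fst z)) (g (snd z))"
      using w by (simp add: weak_isomorphism_def case_prod_unfold)
    ultimately show ?thesis by eventually_elim simp
  qed
  have k: "AE z in net_mu Q \<Otimes>\<^sub>M net_mu Q. net_k Q (fst z) (snd z) = net_k R ((\<phi> \<circ> h) (fst z)) ((\<phi> \<circ> h) (snd z))"
  proof -
    have "AE z in net_mu Q \<Otimes>\<^sub>M net_mu Q. net_k P (h (fst z)) (h (snd z)) = net_k R (\<phi> (h (fst z))) (\<phi> (h (snd z)))"
      using w' by (intro AE_pair_distrD[OF m(1,2,1,2) mu.sigma_finite_measure_axioms]) (simp add: weak_isomorphism_def case_prod_unfold)
    moreover have "AE z in net_mu Q \<Otimes>\<^sub>M net_mu Q. net_k Q (fst z) (snd z) = net_k P (h (fst z)) (h (snd z))"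
      using w by (simp add: weak_isomorphism_def case_prod_unfold)
    ultimately show ?thesis by eventually_elim simp
  qed
  show ?thesis unfolding weak_isomorphism_def case_prod_unfold using mp i o k by blast
qed

lemma weak_isomorphism_refl: "weak_isomorphism P P (\<lambda>x. x) (\<lambda>y. y)"
  by (simp add: weak_isomorphism_def measure_preserving_def distr_id2 case_prod_unfold)

section \<open>Transport of structure along homeomorphisms\<close>

lemma transport_measure:
  assumes "homeomorphic_maps T' T h g" "sets \<mu> = sets (borel_of T)"
  shows "g \<in> measurable \<mu> (borel_of T')" "h \<in> measurable (distr \<mu> (borel_of T') g) \<mu>"
    "distr (distr \<mu> (borel_of T') g) \<mu> h = \<mu>"
    "\<And>U. openin T' U \<Longrightarrow> emeasure (distr \<mu> (borel_of T') g) U = emeasure \<mu> (h ` U)"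
    "\<And>U. openin T' U \<Longrightarrow> openin T (h ` U)"
proof -
  have c: "continuous_map T' T h" "continuous_map T T' g" and hg: "\<And>x. x \<in> topspace T \<Longrightarrow> h (g x) = x"
    and gh: "\<And>x. x \<in> topspace T' \<Longrightarrow> g (h x) = x"
    using assms(1) by (auto simp: homeomorphic_maps_def)
  have sp: "space \<mu> = topspace T" using sets_eq_imp_space_eq[OF assms(2)] by simp
  show g: "g \<in> measurable \<mu> (borel_of T')"
    using continuous_map_measurable[OF c(2)] measurable_cong_sets[OF assms(2) refl] by blast
  have h: "h \<in> measurable (borel_of T') \<mu>"
    using continuous_map_measurable[OF c(1)] measurable_cong_sets[OF refl assms(2)] by blast
  then show h': "h \<in> measurable (distr \<mu> (borel_of T') g) \<mu>" by simp
  have "distr (distr \<mu> (borel_of T') g) \<mu> h = distr \<mu> \<mu> (h \<circ> g)" by (rule distr_distr[OF h g])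
  also have "\<dots> = distr \<mu> \<mu> (\<lambda>x. x)" using hg by (intro distr_cong) (auto simp: sp)
  finally show "distr (distr \<mu> (borel_of T') g) \<mu> h = \<mu>" by (simp add: distr_id2)
  fix U assume U: "openin T' U"
  have hU: "h ` U = g -` U \<inter> topspace T"
  proof (intro equalityI subsetI)
    fix x assume "x \<in> h ` U"
    then obtain u where u: "x = h u" "u \<in> U" by blast
    then have "u \<in> topspace T'" using openin_subset[OF U] by blast
    then show "x \<in> g -` U \<inter> topspace T" using u gh c(1) by (auto simp: continuous_map_def)
  next
    fix x assume "x \<in> g -` U \<inter> topspace T"
    then show "x \<in> h ` U" using hg[of x] by (auto intro!: image_eqI[of x h "g x"])
  qed
  show "emeasure (distr \<mu> (borel_of T') g) U = emeasure \<mu> (h ` U)"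
    using g openin_in_borel_of[OF U] by (simp add: emeasure_distr sp hU)
  show "openin T (h ` U)"
    unfolding hU using openin_continuous_map_preimage[OF c(2) U] by (simp add: Collect_conj_eq vimage_def Int_commute)
qed

lemma polish_topology_homeomorphic:
  assumes "homeomorphic_maps T' T h g" "polish_topology T" shows "polish_topology T'"
proof -
  have "T' homeomorphic_space T" using assms(1) unfolding homeomorphic_space_def by blast
  then show ?thesis
    using assms(2) homeomorphic_completely_metrizable_space homeomorphic_separable_space
    unfolding polish_topology_def by blast
qed

text \<open>All data are transported along homeomorphisms with carriers of the fixed type, and the
  maps back to \<open>P\<close> are weak isomorphisms by construction. This supplies the witnesses
  and the representatives that the quotient needs.\<close>

lemma small_copy:
  assumes P: "topological_network P"
  obtains Q :: small_network and h g where "topological_network Q" "weak_isomorphism Q P h g"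
proof -
  obtain TX :: "nat set topology" and h h' where hX: "homeomorphic_maps TX (net_X P) h h'"
    using homeomorphic_small_topology[OF topological_networkD(1)[OF P]] by blast
  obtain TY :: "nat set topology" and g g' where gY: "homeomorphic_maps TY (net_Y P) g g'"
    using homeomorphic_small_topology[OF topological_networkD(2)[OF P]] by blast
  note tX = transport_measure[OF hX topological_networkD(4)[OF P]]
  note tY = transport_measure[OF gY topological_networkD(6)[OF P]]
  have cX: "continuous_map TX (net_X P) h" and cY: "continuous_map TY (net_Y P) g"
    and ggY: "\<And>y. y \<in> topspace (net_Y P) \<Longrightarrow> g (g' y) = y"
    using hX gY by (auto simp: homeomorphic_maps_def)
  have hT: "\<And>x. x \<in> topspace TX \<Longrightarrow> h x \<in> topspace (net_X P)" and gT: "\<And>y. y \<in> topspace TY \<Longrightarrow> g y \<in> topspace (net_Y P)"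
    using cX cY by (auto simp: continuous_map_def)
  let ?mu = "distr (net_mu P) (borel_of TX) h'" and ?nu = "distr (net_nu P) (borel_of TY) g'"
  define Q :: small_network where
    "Q = \<lparr>net_X = TX, net_k = (\<lambda>x x'. net_k P (h x) (h x')), net_mu = ?mu, net_Y = TY,
      net_iota = (\<lambda>y. net_iota P (g y)), net_nu = ?nu, net_omega = (\<lambda>x y. net_omega P (h x) (g y))\<rparr>"
  have Q: "net_X Q = TX" "net_k Q = (\<lambda>x x'. net_k P (h x) (h x'))" "net_mu Q = ?mu" "net_Y Q = TY"
    "net_iota Q = (\<lambda>y. net_iota P (g y))" "net_nu Q = ?nu" "net_omega Q = (\<lambda>x y. net_omega P (h x) (g y))"
    by (simp_all add: Q_def)
  have polX: "polish_topology TX" and polY: "polish_topology TY"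
    using polish_topology_homeomorphic[OF hX topological_networkD(1)[OF P]]
      polish_topology_homeomorphic[OF gY topological_networkD(2)[OF P]] by auto
  have lc: "locally_compact_space TY"
  proof -
    have "TY homeomorphic_space net_Y P" using gY unfolding homeomorphic_space_def by blast
    then show ?thesis using homeomorphic_locally_compact_space topological_networkD(3)[OF P] by blast
  qed
  have mh: "h \<in> measurable ?mu (vertex_borel P)" and mg: "g \<in> measurable ?nu (borel_of (net_Y P))"
    using continuous_map_measurable[OF cX] continuous_map_measurable[OF cY] by simp_all
  have "prob_space ?mu"
  proof -
    interpret prob_space "net_mu P" by (rule topological_networkD(8)[OF P])
    show ?thesis by (rule prob_space_distr[OF tX(1)])
  qed
  moreover have "fully_supported TX ?mu"
    unfolding fully_supported_def
  proof (intro allI impI)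
    fix U assume U: "openin TX U \<and> U \<noteq> {}"
    have "fully_supported (net_X P) (net_mu P)" using P by (simp add: topological_network_def)
    then show "0 < emeasure ?mu U" using U tX(4)[of U] tX(5)[of U] by (simp add: fully_supported_def)
  qed
  moreover have "fully_supported TY ?nu"
    unfolding fully_supported_def
  proof (intro allI impI)
    fix U assume U: "openin TY U \<and> U \<noteq> {}"
    have "fully_supported (net_Y P) (net_nu P)" using P by (simp add: topological_network_def)
    then show "0 < emeasure ?nu U" using U tY(4)[of U] tY(5)[of U] by (simp add: fully_supported_def)
  qed
  moreover have "\<forall>x\<in>topspace TX. \<forall>x'\<in>topspace TX. net_k P (h x) (h x') = net_k P (h x') (h x)"
    using P hT unfolding topological_network_def by meson
  moreover have "(\<lambda>z. net_k P (h (fst z)) (h (snd z))) \<in> borel_measurable (?mu \<Otimes>\<^sub>M ?mu)"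
  proof -
    have "(\<lambda>z. (h (fst z), h (snd z))) \<in> measurable (?mu \<Otimes>\<^sub>M ?mu) (vertex_borel P \<Otimes>\<^sub>M vertex_borel P)"
      using measurable_compose[OF measurable_fst mh] measurable_compose[OF measurable_snd mh] by (rule measurable_Pair)
    from measurable_compose[OF this measurable_net_k[OF P]] show ?thesis by simp
  qed
  moreover have "\<exists>C. \<forall>x\<in>topspace TX. \<forall>x'\<in>topspace TX. \<bar>net_k P (h x) (h x')\<bar> \<le> C"
    using P hT unfolding topological_network_def by meson
  moreover have "radon_measure_on TY ?nu"
  proof (rule radon_measure_onI[OF polY lc])
    show "borel_measure_on TY ?nu" by (simp add: borel_measure_on_def)
    fix y assume y: "y \<in> topspace TY"
    obtain U where U: "openin (net_Y P) U" "g y \<in> U" "emeasure (net_nu P) U < \<infinity>"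
      using topological_networkD(9)[OF P] gT[OF y] unfolding radon_measure_on_def by meson
    let ?V = "{y \<in> topspace TY. g y \<in> U}"
    have V: "openin TY ?V" using openin_continuous_map_preimage[OF cY U(1)] .
    have "emeasure ?nu ?V \<le> emeasure (net_nu P) U"
      unfolding tY(4)[OF V]
      using openin_in_borel_of[OF U(1)] topological_networkD(6)[OF P] by (intro emeasure_mono) auto
    then show "\<exists>U. openin TY U \<and> y \<in> U \<and> emeasure ?nu U < \<infinity>"
      using V U y by (intro exI[of _ ?V]) auto
  qed
  moreover have "continuous_map TY (top_of_set Lam) (\<lambda>y. net_iota P (g y))"
    using continuous_map_compose[OF cY topological_networkD(12)[OF P]] by (simp add: comp_def)
  moreover have "measure_persistence_diagram (distr ?nu (borel_of (top_of_set Lam)) (\<lambda>y. net_iota P (g y)))"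
  proof -
    have "(\<lambda>y. net_iota P (g y)) \<in> measurable (borel_of TY) (borel_of (top_of_set Lam))"
      using continuous_map_measurable[OF continuous_map_compose[OF cY topological_networkD(12)[OF P]]] by (simp add: comp_def)
    then have "distr ?nu (borel_of (top_of_set Lam)) (\<lambda>y. net_iota P (g y)) =
      distr (net_nu P) (borel_of (top_of_set Lam)) ((\<lambda>y. net_iota P (g y)) \<circ> g')"
      by (rule distr_distr[OF _ tY(1)])
    also have "\<dots> = distr (net_nu P) (borel_of (top_of_set Lam)) (net_iota P)"
      using ggY topological_networkD(7)[OF P] by (intro distr_cong) auto
    finally show ?thesis using P by (simp add: topological_network_def)
  qed
  moreover have "\<forall>x\<in>topspace TX. \<forall>y\<in>topspace TY. net_omega P (h x) (g y) \<ge> 0"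
    "\<exists>C. \<forall>x\<in>topspace TX. \<forall>y\<in>topspace TY. net_omega P (h x) (g y) \<le> C"
    using P hT gT unfolding topological_network_def by meson+
  moreover have "(\<lambda>z. net_omega P (h (fst z)) (g (snd z))) \<in> borel_measurable (?mu \<Otimes>\<^sub>M ?nu)"
  proof -
    have "(\<lambda>z. (h (fst z), g (snd z))) \<in> measurable (?mu \<Otimes>\<^sub>M ?nu) (vertex_borel P \<Otimes>\<^sub>M borel_of (net_Y P))"
      using measurable_compose[OF measurable_fst mh] measurable_compose[OF measurable_snd mg] by (rule measurable_Pair)
    from measurable_compose[OF this measurable_net_omega[OF P]] show ?thesis by simp
  qed
  ultimately have "topological_network Q"
    unfolding topological_network_def Q case_prod_unfold
    using polX polY lc by (simp add: borel_measure_on_def)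
  moreover have "weak_isomorphism Q P h g"
    unfolding weak_isomorphism_def Q measure_preserving_def
    using tX(2,3) tY(2,3) by (simp add: case_prod_unfold)
  ultimately show thesis by (rule that)
qed

section \<open>The quotient and the geodesic\<close>

text \<open>Admits a common source of any type, such as an interpolating network on product types,
  by composing with the projections from its small copy.\<close>

lemma weakly_isomorphicI:
  assumes N: "topological_network N" and P: "topological_network P" "topological_network P'"
    and w: "weak_isomorphism N P \<phi> \<psi>" "weak_isomorphism N P' \<phi>' \<psi>'"
  shows "weakly_isomorphic P P'"
proof -
  obtain Q :: small_network and h g where Q: "topological_network Q" "weak_isomorphism Q N h g"
    using small_copy[OF N] by blast
  show ?thesis
    unfolding weakly_isomorphic_def
    using P Q(1) weak_isomorphism_comp[OF Q(1) N P(1) Q(2) w(1)] weak_isomorphism_comp[OF Q(1) N P(2) Q(2) w(2)] by blast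
qed

text \<open>A coupling of cost zero makes the interpolating network at time 0 a common source,
  weakly isomorphic to the two networks by the two projections.\<close>

lemma weakly_isomorphic_iff_zero_cost:
  assumes p: "p \<ge> 1" and nets: "topological_network P" "topological_network P'"
  shows "weakly_isomorphic P P' \<longleftrightarrow> (\<exists>\<pi>v\<in>couplings P P'. \<exists>\<pi>e\<in>adm_couplings P P'. TpOT_cost p P P' \<pi>v \<pi>e = 0)"
proof
  assume "weakly_isomorphic P P'"
  from weakly_isomorphic_imp_zero_cost[OF p this]
  show "\<exists>\<pi>v\<in>couplings P P'. \<exists>\<pi>e\<in>adm_couplings P P'. TpOT_cost p P P' \<pi>v \<pi>e = 0" by blast
next
  assume "\<exists>\<pi>v\<in>couplings P P'. \<exists>\<pi>e\<in>adm_couplings P P'. TpOT_cost p P P' \<pi>v \<pi>e = 0"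
  then obtain \<pi>v \<pi>e where c: "\<pi>v \<in> couplings P P'" "\<pi>e \<in> adm_couplings P P'" "TpOT_cost p P P' \<pi>v \<pi>e = 0" by blast
  then interpret coupled_networks P P' \<pi>v \<pi>e using nets by unfold_locales
  show "weakly_isomorphic P P'"
    by (rule weakly_isomorphicI[OF topological_network_interp nets weak_isomorphism_interp_0 weak_isomorphism_zero_cost[OF p c(3)]]) simp_all
qed

text \<open>Two weak isomorphisms onto \<open>P2\<close> from different sources have no evident
  common refinement, but couplings of cost zero compose by gluing.\<close>

lemma weakly_isomorphic_trans:
  assumes w: "weakly_isomorphic P1 P2" "weakly_isomorphic P2 P3"
  shows "weakly_isomorphic P1 P3"
proof -
  have P: "topological_network P1" "topological_network P2" "topological_network P3"
    using w by (auto simp: weakly_isomorphic_def)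
  \<comment> \<open>Weak isomorphism does not mention an exponent, so the passage through costs may
    use a fixed one.\<close>
  have p: "(1 :: real) \<le> 1" by simp
  obtain \<pi>v \<pi>e where 1: "\<pi>v \<in> couplings P1 P2" "\<pi>e \<in> adm_couplings P1 P2" "TpOT_cost 1 P1 P2 \<pi>v \<pi>e = 0"
    using weakly_isomorphic_imp_zero_cost[OF p w(1)] by blast
  obtain \<rho>v \<rho>e where 2: "\<rho>v \<in> couplings P2 P3" "\<rho>e \<in> adm_couplings P2 P3" "TpOT_cost 1 P2 P3 \<rho>v \<rho>e = 0"
    using weakly_isomorphic_imp_zero_cost[OF p w(2)] by blast
  obtain \<sigma>v \<sigma>e where "\<sigma>v \<in> couplings P1 P3" "\<sigma>e \<in> adm_couplings P1 P3"
    "TpOT_cost 1 P1 P3 \<sigma>v \<sigma>e \<le> TpOT_cost 1 P1 P2 \<pi>v \<pi>e + TpOT_cost 1 P2 P3 \<rho>v \<rho>e"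
    by (rule TpOT_cost_triangle[OF p P 1(1) 2(1) 1(2) 2(2)])
  then show ?thesis
    unfolding weakly_isomorphic_iff_zero_cost[OF p P(1,3)] using 1(3) 2(3) by auto
qed

lemma weak_class_eq:
  assumes "weakly_isomorphic P P'" shows "weak_class P = weak_class P'"
  unfolding weak_class_def
  using weakly_isomorphic_trans[OF assms] weakly_isomorphic_trans[OF weakly_isomorphic_sym[OF assms]] by blast

text \<open>The class contains only small networks, so a network of another type is represented in
  it by its small copy.\<close>

lemma weak_class_representative:
  assumes P: "topological_network P"
  obtains R where "R \<in> weak_class P"
proof -
  obtain Q :: small_network and h g where Q: "topological_network Q" "weak_isomorphism Q P h g"
    using small_copy[OF P] by blast
  have "weakly_isomorphic P Q" using weakly_isomorphicI[OF Q(1) P Q(1) Q(2) weak_isomorphism_refl] .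
  then show thesis by (intro that[of Q]) (simp add: weak_class_def)
qed

lemma weak_class_in_quotient:
  assumes P: "topological_network P" shows "weak_class P \<in> network_quotient"
proof -
  obtain R where R: "R \<in> weak_class P" using weak_class_representative[OF P] by blast
  then have w: "weakly_isomorphic P R" by (simp add: weak_class_def)
  have eq: "weak_class P = {(R, R'). weakly_isomorphic R R'} `` {R}"
    using weak_class_eq[OF w] by (auto simp: weak_class_def)
  have "topological_network R" using w by (simp add: weakly_isomorphic_def)
  then show ?thesis unfolding network_quotient_def eq by (intro quotientI) simp
qed

text \<open>Both classes are nonempty and the distance is the same for all representatives, so the
  set of values is a singleton, as \<open>the_elem\<close> requires.\<close>

lemma d_TpOT_quotient_weak_class:
  assumes p: "p \<ge> 1" and P: "topological_network P" "topological_network P'"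
  shows "d_TpOT_quotient p (weak_class P) (weak_class P') = d_TpOT p P P'"
proof -
  obtain R R' where "R \<in> weak_class P" "R' \<in> weak_class P'"
    using weak_class_representative[OF P(1)] weak_class_representative[OF P(2)] by metis
  moreover have "d_TpOT p R R' = d_TpOT p P P'" if "R \<in> weak_class P" "R' \<in> weak_class P'" for R R'
    using that d_TpOT_weakly_isomorphic[OF p] by (simp add: weak_class_def)
  ultimately have "(\<lambda>(R, R'). d_TpOT p R R') ` (weak_class P \<times> weak_class P') = {d_TpOT p P P'}"
    by (auto simp: image_iff)
  then show ?thesis by (simp add: d_TpOT_quotient_def)
qed

theorem theorem6:
  fixes p :: real
    and P :: "('a, 'b) network"
    and P' :: "('c, 'd) network"
    and \<pi>v :: "('a \<times> 'c) measure"
    and \<pi>e :: "('b option \<times> 'd option) measure"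
  assumes "p \<ge> 1"
    and "topological_network P" and "topological_network P'"
    and "optimal_couplings p P P' \<pi>v \<pi>e"
    and "d_TpOT p P P' < \<infinity>"
  shows "geodesic_between network_quotient (d_TpOT_quotient p)
           (\<lambda>t. weak_class (interp_network P P' \<pi>v \<pi>e t))
           (weak_class P) (weak_class P')"
proof -
  note p = assms(1) and nets = assms(2,3)
  have c: "\<pi>v \<in> couplings P P'" "\<pi>e \<in> adm_couplings P P'" and opt: "TpOT_cost p P P' \<pi>v \<pi>e = d_TpOT p P P'"
    using assms(4) by (auto simp: optimal_couplings_def)
  interpret coupled_networks P P' \<pi>v \<pi>e using nets c by unfold_locales
  have net: "topological_network (I t)" if "0 \<le> t" "t \<le> 1" for t
    using topological_network_interp[OF that] .
  have w0: "weakly_isomorphic (I 0) P"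
    by (rule weakly_isomorphicI[OF net net nets(1) weak_isomorphism_refl weak_isomorphism_interp_0]) simp_all
  have w1: "weakly_isomorphic (I 1) P'"
    by (rule weakly_isomorphicI[OF net net nets(2) weak_isomorphism_refl weak_isomorphism_interp_1]) simp_all
  \<comment> \<open>Finiteness of the distance moves the argument to real numbers, where the outer
    legs of the path can be subtracted.\<close>
  obtain D where D: "d_TpOT p P P' = ennreal D" "D \<ge> 0" using assms(5) by (cases "d_TpOT p P P'") auto
  have le: "d_TpOT p (I s) (I t) \<le> ennreal ((t - s) * D)" if "0 \<le> s" "s \<le> t" "t \<le> 1" for s t
    using d_TpOT_interp_le[OF p that] that D by (simp add: opt ennreal_mult)
  have eq: "d_TpOT p (I s) (I t) = ennreal (t - s) * d_TpOT p P P'" if st: "0 \<le> s" "s \<le> t" "t \<le> 1" for s t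
  proof (rule antisym)
    obtain q where q: "d_TpOT p (I s) (I t) = ennreal q" "q \<ge> 0"
      using le[OF st] by (cases "d_TpOT p (I s) (I t)") (auto simp: top_unique)
    \<comment> \<open>The legs before \<open>s\<close> and after \<open>t\<close> cost at most
      \<open>s * D\<close> and \<open>(1 - t) * D\<close>, so at least \<open>(t - s) * D\<close>
      remains for the middle one.\<close>
    have "ennreal D = d_TpOT p (I 0) (I 1)"
      using d_TpOT_weakly_isomorphic[OF p w0 w1] D by simp
    also have "\<dots> \<le> d_TpOT p (I 0) (I s) + d_TpOT p (I s) (I 1)"
      using st by (intro d_TpOT_triangle p net) auto
    also have "\<dots> \<le> d_TpOT p (I 0) (I s) + (d_TpOT p (I s) (I t) + d_TpOT p (I t) (I 1))"
      using st by (intro add_mono order_refl d_TpOT_triangle p net) auto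
    also have "\<dots> \<le> ennreal ((s - 0) * D) + (ennreal q + ennreal ((1 - t) * D))"
      using st by (intro add_mono le) (auto simp: q)
    also have "\<dots> = ennreal (s * D + (q + (1 - t) * D))"
      using st D q by simp
    finally have "D \<le> s * D + (q + (1 - t) * D)"
      by (subst (asm) ennreal_le_iff) (use st D q in auto)
    then have "(t - s) * D \<le> q" by (simp add: algebra_simps)
    then show "ennreal (t - s) * d_TpOT p P P' \<le> d_TpOT p (I s) (I t)"
      using st D q by (simp add: ennreal_mult[symmetric] ennreal_leI)
    show "d_TpOT p (I s) (I t) \<le> ennreal (t - s) * d_TpOT p P P'"
      using le[OF st] st D by (simp add: ennreal_mult)
  qed
  show ?thesis
    unfolding geodesic_between_def
    using weak_class_in_quotient[OF net] weak_class_eq[OF w0] weak_class_eq[OF w1]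
      d_TpOT_quotient_weak_class[OF p nets] d_TpOT_quotient_weak_class[OF p net net] eq by auto
qed

end
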